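(* Let $K$ be a bi-even bilinear kernel on $\mathbf R$ (that is, $K\in\mathcal S'(\mathbf R^2)$ is even in each of its two variables), and suppose that $T_K$ is a bilinear Fourier multiplier on $\mathbf R$ of Marcinkiewicz type. Then for every odd integer $n\ge3$, the bilinear operator $T_{\widetilde K}$, where $\widetilde K$ is the bilinear kernel on $\mathbf R^n$ given by $$\widetilde K(y,z)=(|y|\,|z|)^{-(n-1)}K(|y|,|z|),\qquad y,z\in\mathbf R^n,$$ is a bilinear Fourier multiplier of Marcinkiewicz type on $\mathbf R^n$.
   Context: A bilinear operator $T$ from $\mathcal S(\mathbf R^n)\times\mathcal S(\mathbf R^n)$ into $\mathcal S'(\mathbf R^n)$ is a bilinear Fourier multiplier if it commutes with simultaneous translations; equivalently there are a bilinear kernel $K\in\mathcal S'(\mathbf R^{2n})$ and a bilinear symbol $m\in\mathcal S'(\mathbf R^{2n})$ such that for all $f,g,h\in\mathcal S(\mathbf R^n)$ $$\langle T(f,g),h\rangle=\int_{\mathbf R^{3n}}K(y,z)f(x-y)g(x-z)h(x)\,dx\,dy\,dz=\int_{\mathbf R^{2n}}m(\xi,\eta)\widehat f(\xi)\widehat g(\eta)\widehat h(\xi+\eta)\,d\xi\,d\eta$$ (integrals understood in the distributional sense). The kernel and the symbol are related by the Fourier transform, and $T_K$ denotes the bilinear operator with kernel $K$. The Fourier transform is normalized with $e^{-2\pi i x\cdot\xi}$. Since all kernels considered are even in each variable, the symbol of $T_{\widetilde K}$ is $\widetilde m(\xi,\eta)=\widehat{\widetilde K}(\xi,\eta)$,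 the Fourier transform of $\widetilde K$ on $\mathbf R^{2n}$. A bilinear Fourier multiplier on $\mathbf R^n$ is of Marcinkiewicz type if its symbol $m$ satisfies, for all multi-indices $\alpha,\beta\in\mathbf N_0^n$, $$\sup_{\xi,\eta}\,|\xi|^{|\alpha|}|\eta|^{|\beta|}\left|\partial_\xi^\alpha\partial_\eta^\beta m(\xi,\eta)\right|\le C_{\alpha,\beta}<\infty ,$$ the supremum being over nonzero $\xi,\eta\in\mathbf R^n$. *)

theory Defs
  imports "HOL-Analysis.Analysis"
begin

text \<open>
  Multi-indices are written as lists of basis vectors, one entry for each differentiation, so
  that the order \<open>|\<alpha>|\<close> is the length of the list. On smooth functions the order of the entries
  does not matter; every multi-index occurs, since all lists over the basis are considered.
\<close>

primrec partials ::
  "'a::euclidean_space list \<Rightarrow> ('a \<Rightarrow> complex) \<Rightarrow> 'a \<Rightarrow> complex" where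
  "partials [] f = f"
| "partials (b # bs) f = (\<lambda>x. frechet_derivative (partials bs f) (at x) b)"

text \<open>Infinite differentiability; meant for open \<open>U\<close>.\<close>

definition smooth_on :: "'a::euclidean_space set \<Rightarrow> ('a \<Rightarrow> complex) \<Rightarrow> bool" where
  "smooth_on U f \<longleftrightarrow> (\<forall>bs \<in> lists Basis. \<forall>x\<in>U. partials bs f differentiable (at x))"


section \<open>Schwartz functions and tempered distributions\<close>

definition schwartz :: "('a::euclidean_space \<Rightarrow> complex) \<Rightarrow> bool" where
  "schwartz f \<longleftrightarrow> smooth_on UNIV f \<and>
     (\<forall>k. \<forall>bs \<in> lists Basis. \<exists>C. \<forall>x. norm x ^ k * norm (partials bs f x) \<le> C)"

definition schwartz_tendsto ::
  "(nat \<Rightarrow> 'a::euclidean_space \<Rightarrow> complex) \<Rightarrow> ('a \<Rightarrow> complex) \<Rightarrow> bool" where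
  "schwartz_tendsto F f \<longleftrightarrow> (\<forall>j. schwartz (F j)) \<and> schwartz f \<and>
     (\<forall>k. \<forall>bs \<in> lists Basis.
        uniform_limit UNIV (\<lambda>j x. norm x ^ k *\<^sub>R partials bs (F j) x)
          (\<lambda>x. norm x ^ k *\<^sub>R partials bs f x) sequentially)"

text \<open>
  A distribution is a functional on all functions of which only the values on Schwartz functions
  matter. The Schwartz space is metrizable, so sequential continuity is continuity.
\<close>

definition tempered_distribution :: "(('a::euclidean_space \<Rightarrow> complex) \<Rightarrow> complex) \<Rightarrow> bool" where
  "tempered_distribution u \<longleftrightarrow>
     (\<forall>f g. schwartz f \<longrightarrow> schwartz g \<longrightarrow> u (\<lambda>x. f x + g x) = u f + u g) \<and>
     (\<forall>c f. schwartz f \<longrightarrow> u (\<lambda>x. c * f x) = c * u f) \<and>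
     (\<forall>F f. schwartz_tendsto F f \<longrightarrow> (\<lambda>j. u (F j)) \<longlonglongrightarrow> u f)"

definition fourier :: "('a::euclidean_space \<Rightarrow> complex) \<Rightarrow> 'a \<Rightarrow> complex" where
  "fourier f \<xi> = (LINT x|lborel. cis (- 2 * pi * (x \<bullet> \<xi>)) * f x)"

text \<open>
  Completed Lebesgue measure is used so that the values of \<open>m\<close> on a null set (such as the
  coordinate subspaces where a Marcinkiewicz symbol is unconstrained) play no role.
\<close>

definition represented_by ::
  "(('a::euclidean_space \<Rightarrow> complex) \<Rightarrow> complex) \<Rightarrow> ('a \<Rightarrow> complex) \<Rightarrow> bool" where
  "represented_by u m \<longleftrightarrow> (\<forall>\<phi>. schwartz \<phi> \<longrightarrow>
     integrable lebesgue (\<lambda>x. m x * \<phi> x) \<and> u \<phi> = (LINT x|lebesgue. m x * \<phi> x))"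


section \<open>Bilinear Fourier multipliers\<close>

text \<open>
  An operator from pairs of Schwartz functions to tempered distributions is curried:
  \<open>T f g h\<close> is \<open>\<langle>T(f,g),h\<rangle>\<close>.
\<close>

type_synonym 'a bilinear_op =
  "('a \<Rightarrow> complex) \<Rightarrow> ('a \<Rightarrow> complex) \<Rightarrow> ('a \<Rightarrow> complex) \<Rightarrow> complex"

text \<open>
  The last condition says \<open>T(\<tau>\<^sub>a f, \<tau>\<^sub>a g) = \<tau>\<^sub>a T(f,g)\<close>, where translation acts on distributions by
  \<open>\<langle>\<tau>\<^sub>a u, h\<rangle> = \<langle>u, \<tau>\<^sub>-\<^sub>a h\<rangle>\<close>. Continuity is into the weak-star topology.
\<close>

definition bilinear_fourier_multiplier :: "'a::euclidean_space bilinear_op \<Rightarrow> bool" where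
  "bilinear_fourier_multiplier T \<longleftrightarrow>
     (\<forall>f g. schwartz f \<longrightarrow> schwartz g \<longrightarrow> tempered_distribution (T f g)) \<and>
     (\<forall>f\<^sub>1 f\<^sub>2 g h. schwartz f\<^sub>1 \<longrightarrow> schwartz f\<^sub>2 \<longrightarrow> schwartz g \<longrightarrow> schwartz h \<longrightarrow>
        T (\<lambda>x. f\<^sub>1 x + f\<^sub>2 x) g h = T f\<^sub>1 g h + T f\<^sub>2 g h \<and>
        T g (\<lambda>x. f\<^sub>1 x + f\<^sub>2 x) h = T g f\<^sub>1 h + T g f\<^sub>2 h) \<and>
     (\<forall>c f g h. schwartz f \<longrightarrow> schwartz g \<longrightarrow> schwartz h \<longrightarrow>
        T (\<lambda>x. c * f x) g h = c * T f g h \<and> T f (\<lambda>x. c * g x) h = c * T f g h) \<and>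
     (\<forall>F f G g h. schwartz_tendsto F f \<longrightarrow> schwartz_tendsto G g \<longrightarrow> schwartz h \<longrightarrow>
        (\<lambda>j. T (F j) (G j) h) \<longlonglongrightarrow> T f g h) \<and>
     (\<forall>a f g h. schwartz f \<longrightarrow> schwartz g \<longrightarrow> schwartz h \<longrightarrow>
        T (\<lambda>x. f (x - a)) (\<lambda>x. g (x - a)) h = T f g (\<lambda>x. h (x + a)))"

text \<open>
  \<open>\<langle>T(f,g),h\<rangle> = \<integral> m(\<xi>,\<eta>) f^(\<xi>) g^(\<eta>) h^(-(\<xi>+\<eta>)) d\<xi> d\<eta>\<close>. The pairing is bilinear, not
  sesquilinear; this forces the minus sign, both for invariance under translations and for the
  symbol to be the Fourier transform of the kernel.
\<close>

definition bilinear_symbol ::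
  "'a::euclidean_space bilinear_op \<Rightarrow> (('a \<times> 'a \<Rightarrow> complex) \<Rightarrow> complex) \<Rightarrow> bool" where
  "bilinear_symbol T m \<longleftrightarrow> tempered_distribution m \<and>
     (\<forall>f g h. schwartz f \<longrightarrow> schwartz g \<longrightarrow> schwartz h \<longrightarrow>
        T f g h = m (\<lambda>(\<xi>,\<eta>). fourier f \<xi> * fourier g \<eta> * fourier h (- (\<xi> + \<eta>))))"

text \<open>The operator \<open>T\<^sub>K\<close> with bilinear kernel \<open>K\<close>.\<close>

definition bilinear_operator ::
  "(('a::euclidean_space \<times> 'a \<Rightarrow> complex) \<Rightarrow> complex) \<Rightarrow> 'a bilinear_op" where
  "bilinear_operator K f g h = K (\<lambda>(y,z). LINT x|lborel. f (x - y) * g (x - z) * h x)"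

definition marcinkiewicz_function :: "('a::euclidean_space \<times> 'a \<Rightarrow> complex) \<Rightarrow> bool" where
  "marcinkiewicz_function m \<longleftrightarrow>
     smooth_on {(\<xi>,\<eta>). \<xi> \<noteq> 0 \<and> \<eta> \<noteq> 0} m \<and>
     (\<forall>\<alpha> \<in> lists Basis. \<forall>\<beta> \<in> lists Basis. \<exists>C. \<forall>\<xi> \<eta>. \<xi> \<noteq> 0 \<longrightarrow> \<eta> \<noteq> 0 \<longrightarrow>
        norm \<xi> ^ length \<alpha> * norm \<eta> ^ length \<beta> *
          norm (partials (map (\<lambda>b. (b, 0)) \<alpha> @ map (\<lambda>b. (0, b)) \<beta>) m (\<xi>, \<eta>)) \<le> C)"

definition marcinkiewicz_type :: "'a::euclidean_space bilinear_op \<Rightarrow> bool" where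
  "marcinkiewicz_type T \<longleftrightarrow> bilinear_fourier_multiplier T \<and>
     (\<exists>u m. bilinear_symbol T u \<and> represented_by u m \<and> marcinkiewicz_function m)"


section \<open>Bi-even kernels and their radial extensions\<close>

definition bi_even :: "((real \<times> real \<Rightarrow> complex) \<Rightarrow> complex) \<Rightarrow> bool" where
  "bi_even K \<longleftrightarrow> (\<forall>\<phi>. schwartz \<phi> \<longrightarrow>
     K (\<lambda>(y,z). \<phi> (- y, z)) = K \<phi> \<and> K (\<lambda>(y,z). \<phi> (y, - z)) = K \<phi>)"

text \<open>
  Surface measure on the unit sphere as the cone measure: a Borel set \<open>A\<close> has measure
  \<open>n\<close> times the volume of \<open>{x. 0 < |x| < 1 \<and> x / |x| \<in> A}\<close>, where \<open>n\<close> is the dimension.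
\<close>

definition sphere_measure :: "'a::euclidean_space measure" where
  "sphere_measure =
     distr (density lborel (\<lambda>x. ennreal (real DIM('a)) * indicator (ball 0 1) x)) borel sgn"

text \<open>
  The distribution \<open>(|y| |z|)\<^bsup>-(n-1)\<^esup> K(|y|,|z|)\<close>. Polar coordinates in \<open>y\<close> and \<open>z\<close> cancel the
  weight, and since \<open>K\<close> is even in both variables
  \<open>\<integral>\<integral> (|y| |z|)\<^bsup>-(n-1)\<^esup> K(|y|,|z|) \<phi>(y,z) dy dz
     = \<integral>\<^sub>0\<^sup>\<infinity> \<integral>\<^sub>0\<^sup>\<infinity> K(r,s) \<Phi>(r,s) dr ds = 1/4 \<integral>\<integral> K(r,s) \<Phi>(r,s) dr ds\<close>,
  where \<open>\<Phi>(r,s)\<close>, the integral of \<open>\<phi>(r\<theta>,s\<omega>)\<close> over both unit spheres, is again a Schwartz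
  function. The right-hand side makes sense for distributional \<open>K\<close>.
\<close>

definition radial_extension ::
  "((real \<times> real \<Rightarrow> complex) \<Rightarrow> complex) \<Rightarrow> ('a::euclidean_space \<times> 'a \<Rightarrow> complex) \<Rightarrow> complex" where
  "radial_extension K \<phi> = 1 / 4 *
     K (\<lambda>(r,s). LINT \<theta>|sphere_measure. LINT \<omega>|sphere_measure. \<phi> (r *\<^sub>R \<theta>, s *\<^sub>R \<omega>))"

end

theory Submission
  imports Defs "HOL-Probability.Characteristic_Functions"
begin

text \<open>
  On the Fourier side the radial extension is explicit: its symbol is
  \<open>m~(\<xi>,\<eta>) = 1/4 \<integral>\<integral> m(\<xi>\<sqdot>\<theta>, \<eta>\<sqdot>\<omega>) d\<theta> d\<omega>\<close> over both unit spheres. By rotation invariance this is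
  \<open>1/4 \<integral>\<integral> m(|\<xi>| t, |\<eta>| s) d\<mu>(t) d\<mu>(s)\<close>, where \<open>\<mu>\<close> is the image of surface measure under a
  coordinate. The expressions \<open>\<rho>\<^sup>a \<sigma>\<^sup>b \<partial>\<^sub>\<rho>\<^sup>a \<partial>\<^sub>\<sigma>\<^sup>b\<close> of \<open>m(\<rho>t, \<sigma>s)\<close> are dilation invariant, so differentiation
  under the integral sign carries the Marcinkiewicz bounds over to \<open>m~\<close>.

  To identify the symbol, \<open>K\<close> is evaluated by mollification. Testing \<open>T\<^sub>K\<close> on three Gaussians gives the
  value of \<open>K\<close> on all translates of a Gaussian, hence on the convolution of that Gaussian with any
  Schwartz function; two Gaussian limits, one in the mollifier and one in a Fubini argument, then
  give \<open>K(\<psi>) = \<integral> w m(p)\<close> for every Schwartz superposition of characters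
  \<open>\<psi>(a) = \<integral> w cis(- 2\<pi> a\<sqdot>p)\<close>. The function on which the radial extension evaluates \<open>K\<close> has this form
  by Fourier inversion.
\<close>

section \<open>Schwartz functions\<close>

text \<open>The hypothesis constrains \<open>K\<close> only through trilinear averages of
  \<open>f\<close>, \<open>g\<close>, \<open>h\<close>, and the symbol can be inserted there only
  when the product of the three transforms is itself a test function. For Gaussians that product is
  again an explicit Gaussian, and mollifying by the resulting kernel reaches every Schwartz
  function. On R^n the new symbol acts by integration, where rapid decay of the transforms is
  enough.

  The second difficulty is that the symbol is unconstrained on the coordinate axes, and an
  approximate identity recovers it only at points of continuity. The frequencies
  (\<xi>\<bullet>\<theta>, \<eta>\<bullet>\<omega>) produced by slicing avoid the axes almost
  everywhere, since hyperplanes are null sets. For this reason continuity is required almost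
  everywhere along a map \<open>p\<close> from an arbitrary measure space: the parameter there is
  the whole quadruple (\<theta>, \<omega>, \<xi>, \<eta>), and the superposition of characters
  requires no density in R^2.\<close>

lemma partials_append: "partials (xs @ ys) f = partials xs (partials ys f)"
  by (induction xs) auto

lemma frechet_derivative_cong_open:
  assumes "open U" "x \<in> U" "\<And>y. y \<in> U \<Longrightarrow> f y = g y"
  shows "frechet_derivative f (at x) = frechet_derivative g (at x)"
proof -
  have "(f has_derivative D) (at x) = (g has_derivative D) (at x)" for D
    using has_derivative_transform_within_open[OF _ assms(1,2), of f D UNIV g]
      has_derivative_transform_within_open[OF _ assms(1,2), of g D UNIV f] assms(3) by auto
  then show ?thesis by (simp add: frechet_derivative_def)
qed

lemma partials_cong_open:
  assumes "open U" "x \<in> U" "\<And>y. y \<in> U \<Longrightarrow> f y = g y"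
  shows "partials bs f x = partials bs g x"
  using assms(2)
proof (induction bs arbitrary: x)
  case (Cons b bs)
  then show ?case
    using frechet_derivative_cong_open[OF assms(1) Cons.prems Cons.IH] by simp
qed (use assms in auto)

text \<open>A class of functions stable under directional derivatives contains all iterated partials
  by induction on the list. Agreement is asked on \<open>U\<close> only, because outside
  \<open>U\<close> an iterated \<open>frechet_derivative\<close> may be an arbitrary value; openness
  of \<open>U\<close> lets derivatives be compared inside it.\<close>

lemma smooth_on_coinduct:
  fixes f :: "'a::euclidean_space \<Rightarrow> complex"
  assumes U: "open U" and "X f"
    and step: "\<And>f. X f \<Longrightarrow> \<exists>D. (\<forall>x\<in>U. (f has_derivative D x) (at x)) \<and>
        (\<forall>b\<in>Basis. \<exists>g. X g \<and> (\<forall>x\<in>U. D x b = g x))"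
  shows "smooth_on U f"
    and "bs \<in> lists Basis \<Longrightarrow> \<exists>g. X g \<and> (\<forall>x\<in>U. partials bs f x = g x)"
proof -
  have *: "\<exists>g. X g \<and> (\<forall>x\<in>U. partials bs f x = g x)" if "bs \<in> lists Basis" for bs
    using that
  proof (induction bs rule: list.induct)
    case Nil
    then show ?case using assms by auto
  next
    case (Cons b bs)
    from Cons obtain g where g: "X g" "\<forall>x\<in>U. partials bs f x = g x" by auto
    obtain D where D: "\<forall>x\<in>U. (g has_derivative D x) (at x)"
      "\<forall>b\<in>Basis. \<exists>g. X g \<and> (\<forall>x\<in>U. D x b = g x)" using step[OF g(1)] by blast
    have "b \<in> Basis" using Cons(2) by (simp only: Cons_in_lists_iff)
    then obtain h where h: "X h" "\<forall>x\<in>U. D x b = h x" using D(2) by blast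
    have "partials (b # bs) f x = h x" if "x \<in> U" for x
    proof -
      have "frechet_derivative (partials bs f) (at x) = frechet_derivative g (at x)"
        by (rule frechet_derivative_cong_open[OF U that]) (use g in auto)
      also have "\<dots> = D x" using D that frechet_derivative_at by metis
      finally show ?thesis using h that by simp
    qed
    then show ?case using h by blast
  qed
  show "bs \<in> lists Basis \<Longrightarrow> \<exists>g. X g \<and> (\<forall>x\<in>U. partials bs f x = g x)" by (rule *)
  show "smooth_on U f"
    unfolding smooth_on_def
  proof (intro ballI)
    fix bs :: "'a list" and x assume bs: "bs \<in> lists Basis" and x: "x \<in> U"
    obtain g where g: "X g" "\<forall>x\<in>U. partials bs f x = g x" using * bs by blast
    obtain D where "\<forall>x\<in>U. (g has_derivative D x) (at x)" using step[OF g(1)] by blast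
    then have "(partials bs f has_derivative D x) (at x)"
      using has_derivative_transform_within_open[OF _ U x, of g "D x" UNIV "partials bs f"] g x
      by auto
    then show "partials bs f differentiable at x" by (auto simp: differentiable_def)
  qed
qed

section \<open>Rapid decay and a coinduction principle for Schwartz functions\<close>

definition rapidly_decreasing :: "('a::euclidean_space \<Rightarrow> complex) \<Rightarrow> bool" where
  "rapidly_decreasing f \<longleftrightarrow> (\<forall>k. \<exists>C. \<forall>x. norm x ^ k * norm (f x) \<le> C)"

lemma one_plus_power_le: "0 \<le> t \<Longrightarrow> (1 + t) ^ k \<le> 2 ^ k * (1 + t ^ k)" for t :: real
proof -
  assume t: "0 \<le> t"
  have "(1 + t) ^ k \<le> (2 * max 1 t) ^ k" using t by (intro power_mono) auto
  also have "\<dots> = 2 ^ k * (max 1 t) ^ k" by (simp add: power_mult_distrib)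
  also have "(max 1 t) ^ k \<le> 1 + t ^ k" using t by (auto simp: max_def)
  finally show ?thesis by simp
qed

text \<open>The weight 1 + |x| is at least 1, so it can be divided by and combined multiplicatively
  under shifts, unlike the weight |x| of the definition. The weights of orders 0 and
  \<open>k\<close> together control it.\<close>

lemma rapidly_decreasingD:
  assumes "rapidly_decreasing f"
  obtains C where "C > 0" "\<And>x. (1 + norm x) ^ k * norm (f x) \<le> C"
proof -
  obtain C0 where C0: "\<And>x. norm x ^ 0 * norm (f x) \<le> C0"
    using assms unfolding rapidly_decreasing_def by meson
  obtain Ck where Ck: "\<And>x. norm x ^ k * norm (f x) \<le> Ck"
    using assms unfolding rapidly_decreasing_def by meson
  show ?thesis
  proof (rule that)
    have "0 \<le> C0" "0 \<le> Ck"
      using C0[of 0] Ck[of 0] by (meson norm_ge_zero order_trans mult_nonneg_nonneg zero_le_power)+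
    then show "2 ^ k * (C0 + Ck) + 1 > 0" by (simp add: add_nonneg_pos)
    fix x
    have "(1 + norm x) ^ k * norm (f x) \<le> 2 ^ k * (1 + norm x ^ k) * norm (f x)"
      by (intro mult_right_mono one_plus_power_le) auto
    also have "\<dots> = 2 ^ k * (norm x ^ 0 * norm (f x) + norm x ^ k * norm (f x))"
      by (simp add: algebra_simps)
    also have "\<dots> \<le> 2 ^ k * (C0 + Ck)"
      by (intro mult_left_mono add_mono C0 Ck) auto
    finally show "(1 + norm x) ^ k * norm (f x) \<le> 2 ^ k * (C0 + Ck) + 1" by simp
  qed
qed

lemma rapidly_decreasing_le:
  assumes "rapidly_decreasing f"
  obtains C where "C > 0" "\<And>x. norm (f x) \<le> C / (1 + norm x) ^ k"
proof -
  obtain C where C: "C > 0" "\<And>x. (1 + norm x) ^ k * norm (f x) \<le> C"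
    using rapidly_decreasingD[OF assms] by blast
  have "norm (f x) \<le> C / (1 + norm x) ^ k" for x
    using C(2)[of x] zero_less_power[of "1 + norm x" k]
    by (simp add: pos_le_divide_eq mult.commute add_pos_nonneg)
  then show ?thesis using C that by blast
qed

lemma rapidly_decreasingI:
  assumes "\<And>k. \<exists>C. \<forall>x. norm x ^ k * norm (f x) \<le> C"
  shows "rapidly_decreasing f"
  using assms by (auto simp: rapidly_decreasing_def)

text \<open>Decay is asked of every member of a derivative-stable class, and the partials stay in
  the class, so no formula for a higher derivative is ever required. Sums, translates, convolutions,
  Gaussians and the slices over the spheres are all handled by a suitable class
  \<open>X\<close>.\<close>

lemma schwartz_coinduct:
  fixes f :: "'a::euclidean_space \<Rightarrow> complex"
  assumes "X f"
    and deriv: "\<And>f. X f \<Longrightarrow> \<exists>D. (\<forall>x. (f has_derivative D x) (at x)) \<and>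
        (\<forall>b\<in>Basis. X (\<lambda>x. D x b))"
    and decay: "\<And>f. X f \<Longrightarrow> rapidly_decreasing f"
  shows "schwartz f"
    and "bs \<in> lists Basis \<Longrightarrow> X (partials bs f)"
proof -
  have step: "\<exists>D. (\<forall>x\<in>UNIV. (f has_derivative D x) (at x)) \<and>
        (\<forall>b\<in>Basis. \<exists>g. X g \<and> (\<forall>x\<in>UNIV. D x b = g x))" if f: "X f" for f
  proof -
    obtain D where "\<forall>x. (f has_derivative D x) (at x)" "\<forall>b\<in>Basis. X (\<lambda>x. D x b)"
      using deriv[OF f] by blast
    then show ?thesis by (intro exI[of _ D]) auto
  qed
  have *: "X (partials bs f)" if bs: "bs \<in> lists Basis" for bs
  proof -
    have "\<exists>g. X g \<and> (\<forall>x\<in>UNIV. partials bs f x = g x)"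
      by (rule smooth_on_coinduct(2)[of UNIV X]) (use step bs \<open>X f\<close> in auto)
    then show ?thesis by (metis UNIV_I ext)
  qed
  show "bs \<in> lists Basis \<Longrightarrow> X (partials bs f)" by (rule *)
  show "schwartz f"
    unfolding schwartz_def
  proof (intro conjI allI ballI)
    show "smooth_on UNIV f"
      by (rule smooth_on_coinduct(1)[of UNIV X, OF open_UNIV \<open>X f\<close> step])
    show "\<exists>C. \<forall>x. norm x ^ k * norm (partials bs f x) \<le> C" if "bs \<in> lists Basis" for k and bs :: "'a list"
      using decay[OF *[OF that]] by (auto simp: rapidly_decreasing_def)
  qed
qed

lemma schwartz_differentiable: "schwartz f \<Longrightarrow> f differentiable (at x)"
  unfolding schwartz_def smooth_on_def
  by (metis UNIV_I lists.Nil partials.simps(1))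

lemma schwartz_rapidly_decreasing: "schwartz f \<Longrightarrow> rapidly_decreasing f"
  unfolding schwartz_def rapidly_decreasing_def
  by (metis lists.Nil partials.simps(1))

lemma schwartz_continuous_on: "schwartz f \<Longrightarrow> continuous_on UNIV f"
  by (meson differentiable_imp_continuous_on differentiable_on_def
      differentiable_at_withinI schwartz_differentiable)

lemma schwartz_borel_measurable [measurable_dest, intro]: "schwartz f \<Longrightarrow> f \<in> borel_measurable borel"
  by (intro borel_measurable_continuous_onI schwartz_continuous_on)

lemma schwartz_partials: "schwartz f \<Longrightarrow> bs \<in> lists Basis \<Longrightarrow> schwartz (partials bs f)"
  unfolding schwartz_def smooth_on_def
  by (auto simp flip: partials_append)

abbreviation dpartial :: "'a::euclidean_space \<Rightarrow> ('a \<Rightarrow> complex) \<Rightarrow> 'a \<Rightarrow> complex" where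
  "dpartial b f x \<equiv> frechet_derivative f (at x) b"

lemma schwartz_dpartial: "schwartz f \<Longrightarrow> b \<in> Basis \<Longrightarrow> schwartz (dpartial b f)"
  using schwartz_partials[of f "[b]"] by simp

text \<open>Expanding in the basis makes the derivative in a fixed direction a finite combination of
  Schwartz functions of \<open>x\<close>; measurability and bounds of derivatives under an integral
  sign come from here.\<close>

lemma schwartz_has_derivative:
  assumes "schwartz f"
  shows "(f has_derivative (\<lambda>v. \<Sum>b\<in>Basis. (v \<bullet> b) *\<^sub>R dpartial b f x)) (at x)"
proof -
  have D: "(f has_derivative frechet_derivative f (at x)) (at x)"
    using schwartz_differentiable[OF assms] frechet_derivative_works by blast
  then have "linear (frechet_derivative f (at x))" by (rule has_derivative_linear)
  then have "frechet_derivative f (at x) v = (\<Sum>b\<in>Basis. (v \<bullet> b) *\<^sub>R dpartial b f x)" for v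
    by (subst (1) euclidean_representation[of v, symmetric])
       (simp add: linear_sum linear_scale)
  then have "frechet_derivative f (at x) = (\<lambda>v. \<Sum>b\<in>Basis. (v \<bullet> b) *\<^sub>R dpartial b f x)"
    by (rule ext)
  with D show ?thesis by simp
qed

section \<open>Stability of the Schwartz class under linear operations and translations\<close>

lemma rapidly_decreasing_add:
  fixes f g :: "'a::euclidean_space \<Rightarrow> complex"
  assumes "rapidly_decreasing f" "rapidly_decreasing g"
  shows "rapidly_decreasing (\<lambda>x. f x + g x)"
proof (rule rapidly_decreasingI)
  fix k
  obtain C D where "\<forall>x. norm x ^ k * norm (f x) \<le> C" "\<forall>x. norm x ^ k * norm (g x) \<le> D"
    using assms unfolding rapidly_decreasing_def by meson
  then have CD: "norm x ^ k * norm (f x) \<le> C" "norm x ^ k * norm (g x) \<le> D" for x by auto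
  have "norm x ^ k * norm (f x + g x) \<le> C + D" for x
  proof -
    have "norm x ^ k * norm (f x + g x) \<le> norm x ^ k * (norm (f x) + norm (g x))"
      by (intro mult_left_mono norm_triangle_ineq) simp
    then show ?thesis using CD[of x] by (simp add: distrib_left)
  qed
  then show "\<exists>C. \<forall>x. norm x ^ k * norm (f x + g x) \<le> C" by blast
qed

lemma rapidly_decreasing_cmult:
  assumes "rapidly_decreasing f"
  shows "rapidly_decreasing (\<lambda>x. c * f x)"
proof (rule rapidly_decreasingI)
  fix k
  obtain C where "\<forall>x. norm x ^ k * norm (f x) \<le> C"
    using assms unfolding rapidly_decreasing_def by meson
  then have "norm x ^ k * norm (c * f x) \<le> norm c * C" for x
    using mult_left_mono[of "norm x ^ k * norm (f x)" C "norm c"]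
    by (simp add: norm_mult mult_ac)
  then show "\<exists>C. \<forall>x. norm x ^ k * norm (c * f x) \<le> C" by blast
qed

lemma rapidly_decreasing_translate:
  assumes "rapidly_decreasing f"
  shows "rapidly_decreasing (\<lambda>x. f (x - a))"
proof (rule rapidly_decreasingI)
  fix k
  obtain C where C: "C > 0" "\<And>x. (1 + norm x) ^ k * norm (f x) \<le> C"
    using rapidly_decreasingD[OF assms] by blast
  have "norm x ^ k * norm (f (x - a)) \<le> (1 + norm a) ^ k * C" for x
  proof -
    have "norm x \<le> norm (x - a) + norm a" by (metis add.commute norm_triangle_sub)
    also have "\<dots> \<le> (1 + norm a) * (1 + norm (x - a))" by (simp add: algebra_simps)
    finally have "norm x ^ k \<le> ((1 + norm a) * (1 + norm (x - a))) ^ k"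
      by (intro power_mono) auto
    then have "norm x ^ k * norm (f (x - a))
        \<le> ((1 + norm a) * (1 + norm (x - a))) ^ k * norm (f (x - a))"
      by (intro mult_right_mono) auto
    also have "\<dots> = (1 + norm a) ^ k * ((1 + norm (x - a)) ^ k * norm (f (x - a)))"
      by (simp add: power_mult_distrib)
    also have "\<dots> \<le> (1 + norm a) ^ k * C" by (intro mult_left_mono C) auto
    finally show ?thesis .
  qed
  then show "\<exists>C. \<forall>x. norm x ^ k * norm (f (x - a)) \<le> C" by blast
qed

lemma schwartz_add:
  fixes f g :: "'a::euclidean_space \<Rightarrow> complex"
  assumes "schwartz f" "schwartz g"
  shows "schwartz (\<lambda>x. f x + g x)"
    and "bs \<in> lists Basis \<Longrightarrow> partials bs (\<lambda>x. f x + g x) = (\<lambda>x. partials bs f x + partials bs g x)"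
proof -
  let ?X = "\<lambda>h :: 'a \<Rightarrow> complex. \<exists>f g. schwartz f \<and> schwartz g \<and> h = (\<lambda>x. f x + g x)"
  have D: "((\<lambda>x. f x + g x) has_derivative (\<lambda>v. frechet_derivative f (at x) v
      + frechet_derivative g (at x) v)) (at x)" if "schwartz f" "schwartz g" for f g :: "'a \<Rightarrow> complex" and x
    using that schwartz_differentiable frechet_derivative_works by (intro derivative_intros) blast+
  show "schwartz (\<lambda>x. f x + g x)"
  proof (rule schwartz_coinduct(1)[of ?X])
    show "?X (\<lambda>x. f x + g x)" using assms by blast
    show "\<exists>D. (\<forall>x. (h has_derivative D x) (at x)) \<and> (\<forall>b\<in>Basis. ?X (\<lambda>x. D x b))" if X: "?X h" for h :: "'a \<Rightarrow> complex"
    proof -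
      obtain f g where "schwartz f" "schwartz g" "h = (\<lambda>x. f x + g x)" using X by auto
      then show ?thesis using D schwartz_dpartial
        by (intro exI[of _ "\<lambda>x v. frechet_derivative f (at x) v + frechet_derivative g (at x) v"]) blast
    qed
    show "rapidly_decreasing h" if X: "?X h" for h :: "'a \<Rightarrow> complex"
      using that rapidly_decreasing_add schwartz_rapidly_decreasing by blast
  qed
  show "bs \<in> lists Basis \<Longrightarrow> partials bs (\<lambda>x. f x + g x) = (\<lambda>x. partials bs f x + partials bs g x)"
  proof (induction bs)
    case (Cons b bs)
    then have "frechet_derivative (\<lambda>x. partials bs f x + partials bs g x) (at x) =
      (\<lambda>v. frechet_derivative (partials bs f) (at x) v
      + frechet_derivative (partials bs g) (at x) v)" for x
      using frechet_derivative_at[OF D[OF schwartz_partials schwartz_partials]] assms by simp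
    then show ?case using Cons by auto
  qed auto
qed

lemma schwartz_cmult:
  fixes f :: "'a::euclidean_space \<Rightarrow> complex"
  assumes "schwartz f"
  shows "schwartz (\<lambda>x. c * f x)"
    and "bs \<in> lists Basis \<Longrightarrow> partials bs (\<lambda>x. c * f x) = (\<lambda>x. c * partials bs f x)"
proof -
  let ?X = "\<lambda>h :: 'a \<Rightarrow> complex. \<exists>f. schwartz f \<and> h = (\<lambda>x. c * f x)"
  have D: "((\<lambda>x. c * f x) has_derivative (\<lambda>v. c * frechet_derivative f (at x) v)) (at x)"
    if "schwartz f" for f :: "'a \<Rightarrow> complex" and x
    using that schwartz_differentiable frechet_derivative_works has_derivative_mult_right by blast
  show "schwartz (\<lambda>x. c * f x)"
  proof (rule schwartz_coinduct(1)[of ?X])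
    show "?X (\<lambda>x. c * f x)" using assms by blast
    show "\<exists>D. (\<forall>x. (h has_derivative D x) (at x)) \<and> (\<forall>b\<in>Basis. ?X (\<lambda>x. D x b))" if X: "?X h" for h :: "'a \<Rightarrow> complex"
    proof -
      obtain f where "schwartz f" "h = (\<lambda>x. c * f x)" using X by auto
      then show ?thesis using D schwartz_dpartial
        by (intro exI[of _ "\<lambda>x v. c * frechet_derivative f (at x) v"]) blast
    qed
    show "rapidly_decreasing h" if X: "?X h" for h :: "'a \<Rightarrow> complex"
      using that rapidly_decreasing_cmult schwartz_rapidly_decreasing by blast
  qed
  show "bs \<in> lists Basis \<Longrightarrow> partials bs (\<lambda>x. c * f x) = (\<lambda>x. c * partials bs f x)"
  proof (induction bs)
    case (Cons b bs)
    then have "frechet_derivative (\<lambda>x. c * partials bs f x) (at x) =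
      (\<lambda>v. c * frechet_derivative (partials bs f) (at x) v)" for x
      using frechet_derivative_at[OF D[OF schwartz_partials]] assms by simp
    then show ?case using Cons by auto
  qed auto
qed

lemma schwartz_translate:
  fixes f :: "'a::euclidean_space \<Rightarrow> complex"
  assumes "schwartz f"
  shows "schwartz (\<lambda>x. f (x - a))"
    and "bs \<in> lists Basis \<Longrightarrow> partials bs (\<lambda>x. f (x - a)) = (\<lambda>x. partials bs f (x - a))"
proof -
  let ?X = "\<lambda>h :: 'a \<Rightarrow> complex. \<exists>f. schwartz f \<and> h = (\<lambda>x. f (x - a))"
  have D: "((\<lambda>x. f (x - a)) has_derivative (\<lambda>v. frechet_derivative f (at (x - a)) v)) (at x)"
    if "schwartz f" for f :: "'a \<Rightarrow> complex" and x
  proof -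
    have 1: "(f has_derivative (frechet_derivative f (at (x - a)))) (at (x - a))"
      using that schwartz_differentiable frechet_derivative_works by blast
    have 2: "((\<lambda>x. x - a) has_derivative (\<lambda>v. v)) (at x)"
      by (auto intro!: derivative_eq_intros)
    show ?thesis using has_derivative_compose[OF 2, of f] 1 by simp
  qed
  show "schwartz (\<lambda>x. f (x - a))"
  proof (rule schwartz_coinduct(1)[of ?X])
    show "?X (\<lambda>x. f (x - a))" using assms by blast
    show "\<exists>D. (\<forall>x. (h has_derivative D x) (at x)) \<and> (\<forall>b\<in>Basis. ?X (\<lambda>x. D x b))" if X: "?X h" for h :: "'a \<Rightarrow> complex"
    proof -
      obtain f where "schwartz f" "h = (\<lambda>x. f (x - a))" using X by auto
      then show ?thesis using D schwartz_dpartial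
        by (intro exI[of _ "\<lambda>x v. frechet_derivative f (at (x - a)) v"]) blast
    qed
    show "rapidly_decreasing h" if X: "?X h" for h :: "'a \<Rightarrow> complex"
      using that rapidly_decreasing_translate schwartz_rapidly_decreasing by blast
  qed
  show "bs \<in> lists Basis \<Longrightarrow> partials bs (\<lambda>x. f (x - a)) = (\<lambda>x. partials bs f (x - a))"
  proof (induction bs)
    case (Cons b bs)
    then have "frechet_derivative (\<lambda>x. partials bs f (x - a)) (at x) =
      (\<lambda>v. frechet_derivative (partials bs f) (at (x - a)) v)" for x
      using frechet_derivative_at[OF D[OF schwartz_partials]] assms by simp
    then show ?case using Cons by auto
  qed auto
qed

lemma schwartz_zero: "schwartz (\<lambda>x. 0)"
  by (rule schwartz_coinduct(1)[of "\<lambda>h. h = (\<lambda>x. 0)"])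
     (auto intro!: exI[of _ "\<lambda>x v. 0"] simp: rapidly_decreasing_def)

lemma schwartz_sum:
  fixes f :: "'i \<Rightarrow> 'a::euclidean_space \<Rightarrow> complex"
  assumes "finite I" "\<And>i. i \<in> I \<Longrightarrow> schwartz (f i)"
  shows "schwartz (\<lambda>x. \<Sum>i\<in>I. f i x)"
    and "bs \<in> lists Basis \<Longrightarrow> partials bs (\<lambda>x. \<Sum>i\<in>I. f i x) = (\<lambda>x. \<Sum>i\<in>I. partials bs (f i) x)"
proof -
  have z: "partials bs (\<lambda>x. 0) = (\<lambda>x::'a. 0)" if "bs \<in> lists Basis" for bs
    using schwartz_cmult(2)[OF schwartz_zero that, of 0] by simp
  have "schwartz (\<lambda>x. \<Sum>i\<in>I. f i x) \<and> (bs \<in> lists Basis \<longrightarrow>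
      partials bs (\<lambda>x. \<Sum>i\<in>I. f i x) = (\<lambda>x. \<Sum>i\<in>I. partials bs (f i) x))"
    using assms
  proof (induction I rule: finite_induct)
    case empty
    then show ?case using schwartz_zero z by auto
  next
    case (insert i I)
    then show ?case using schwartz_add(1)[of "f i" "\<lambda>x. \<Sum>i\<in>I. f i x"]
        schwartz_add(2)[of "f i" "\<lambda>x. \<Sum>i\<in>I. f i x" bs] by auto
  qed
  then show "schwartz (\<lambda>x. \<Sum>i\<in>I. f i x)"
    and "bs \<in> lists Basis \<Longrightarrow> partials bs (\<lambda>x. \<Sum>i\<in>I. f i x) = (\<lambda>x. \<Sum>i\<in>I. partials bs (f i) x)" by auto
qed

section \<open>Integrals depending on a parameter and the Fourier transform\<close>

text \<open>On the shell j <= |x| < j + 1 the integrand is at most (j + 1)^(-k), and the shell lies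
  in a ball of volume proportional to (j + 1)^n. Two powers more than the dimension leave the
  convergent series of (j + 1)^(-2).\<close>

lemma integrable_inverse_one_plus_norm_power:
  assumes "k \<ge> DIM('a::euclidean_space) + 2"
  shows "integrable lborel (\<lambda>x::'a. 1 / (1 + norm x) ^ k)"
proof (rule integrableI_bounded)
  let ?n = "DIM('a)"
  let ?V = "unit_ball_vol (real ?n)"
  let ?g = "\<lambda>j (x::'a). ennreal (1 / (real j + 1) ^ k) * indicator (ball 0 (real j + 1)) x"
  show "(\<lambda>x::'a. 1 / (1 + norm x) ^ k) \<in> borel_measurable lborel" by simp
  have "(\<integral>\<^sup>+x. ennreal (norm (1 / (1 + norm x) ^ k)) \<partial>(lborel :: 'a measure)) \<le> (\<integral>\<^sup>+x. (\<Sum>j. ?g j x) \<partial>lborel)"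
  proof (rule nn_integral_mono)
    fix x :: 'a
    define j where "j = nat \<lfloor>norm x\<rfloor>"
    have j: "real j \<le> norm x" "norm x < real j + 1"
      unfolding j_def by (auto simp: of_nat_floor)
    have "norm (1 / (1 + norm x) ^ k) = 1 / (1 + norm x) ^ k" by simp
    also have "\<dots> \<le> 1 / (real j + 1) ^ k"
      using j by (intro divide_left_mono power_mono mult_pos_pos zero_less_power) auto
    finally have "ennreal (norm (1 / (1 + norm x) ^ k)) \<le> ?g j x"
      using j by (simp add: ennreal_leI)
    also have "\<dots> \<le> (\<Sum>j. ?g j x)"
    proof -
      define G where "G i = ?g i x" for i
      have "G j \<le> (\<Sum>i. G i)" using sum_le_suminf[OF summableI, of "{j}" G] by simp
      then show ?thesis by (simp only: G_def)
    qed
    finally show "ennreal (norm (1 / (1 + norm x) ^ k)) \<le> (\<Sum>j. ?g j x)" .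
  qed
  also have "\<dots> = (\<Sum>j. \<integral>\<^sup>+x. ?g j x \<partial>lborel)"
    by (rule nn_integral_suminf) (auto intro!: borel_measurable_times_ennreal borel_measurable_indicator)
  also have "\<dots> = (\<Sum>j. ennreal (1 / (real j + 1) ^ k * (?V * (real j + 1) ^ ?n)))"
  proof (rule suminf_cong)
    fix j
    have "emeasure lborel (ball (0::'a) (real j + 1)) = ennreal (?V * (real j + 1) ^ ?n)"
      by (simp add: emeasure_ball)
    then show "(\<integral>\<^sup>+x. ?g j x \<partial>lborel) = ennreal (1 / (real j + 1) ^ k * (?V * (real j + 1) ^ ?n))"
      by (subst nn_integral_cmult_indicator) (simp, simp only: ennreal_mult'', subst ennreal_mult''[symmetric], auto)
  qed
  also have "\<dots> \<le> (\<Sum>j. ennreal (?V * (1 / real (Suc j) ^ 2)))"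
  proof (rule suminf_le[OF _ summableI summableI], rule ennreal_leI)
    fix j
    have "(real j + 1) ^ ?n * (real j + 1) ^ 2 \<le> (real j + 1) ^ k"
      using assms by (subst power_add[symmetric]) (intro power_increasing, auto)
    then have "(real j + 1) ^ ?n / (real j + 1) ^ k \<le> 1 / (real j + 1) ^ 2"
      by (simp add: field_simps add_pos_nonneg)
    then show "1 / (real j + 1) ^ k * (?V * (real j + 1) ^ ?n) \<le> ?V * (1 / real (Suc j) ^ 2)"
      using mult_left_mono[of _ _ ?V] by (simp add: field_simps)
  qed
  also have "\<dots> = ennreal (\<Sum>j. ?V * (1 / real (Suc j) ^ 2))"
  proof (rule suminf_ennreal2)
    have "summable (\<lambda>j. 1 / real (Suc j) ^ 2)"
      using inverse_power_summable[of 2, where 'a=real] by (subst summable_Suc_iff) (simp add: field_simps)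
    then show "summable (\<lambda>j. ?V * (1 / real (Suc j) ^ 2))" by (rule summable_mult)
  qed simp
  also have "\<dots> < \<infinity>" by simp
  finally show "(\<integral>\<^sup>+x. ennreal (norm (1 / (1 + norm x) ^ k)) \<partial>(lborel :: 'a measure)) < \<infinity>" .
qed

lemma rapidly_decreasing_integrable:
  fixes f :: "'a::euclidean_space \<Rightarrow> complex"
  assumes "rapidly_decreasing f" "f \<in> borel_measurable borel"
  shows "integrable lborel (\<lambda>x. (1 + norm x) ^ k * norm (f x))"
proof -
  let ?K = "k + (DIM('a) + 2)"
  obtain C where C: "C > 0" "\<And>x. norm (f x) \<le> C / (1 + norm x) ^ ?K"
    using rapidly_decreasing_le[OF assms(1)] by blast
  show ?thesis
  proof (rule Bochner_Integration.integrable_bound)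
    show "integrable lborel (\<lambda>x::'a. C * (1 / (1 + norm x) ^ (DIM('a) + 2)))"
      by (intro integrable_mult_right integrable_inverse_one_plus_norm_power) simp
    show "(\<lambda>x. (1 + norm x) ^ k * norm (f x)) \<in> borel_measurable lborel"
      using assms by simp
    show "AE x in lborel. norm ((1 + norm x) ^ k * norm (f x)) \<le> norm (C * (1 / (1 + norm x) ^ (DIM('a) + 2)))"
    proof (rule AE_I2)
      fix x :: 'a
      have p: "0 < 1 + norm x" by (simp add: add_pos_nonneg)
      have "(1 + norm x) ^ k * norm (f x) \<le> (1 + norm x) ^ k * (C / (1 + norm x) ^ ?K)"
        by (intro mult_left_mono C) simp
      also have "\<dots> = C * (1 / (1 + norm x) ^ (DIM('a) + 2))"
        using p by (simp add: power_add)
      finally show "norm ((1 + norm x) ^ k * norm (f x)) \<le> norm (C * (1 / (1 + norm x) ^ (DIM('a) + 2)))"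
        using C(1) by (simp add: abs_mult)
    qed
  qed
qed

lemma schwartz_integrable_weight:
  fixes f :: "'a::euclidean_space \<Rightarrow> complex"
  shows "schwartz f \<Longrightarrow> integrable lborel (\<lambda>x. (1 + norm x) ^ k * norm (f x))"
  by (intro rapidly_decreasing_integrable schwartz_rapidly_decreasing schwartz_borel_measurable)

lemma schwartz_integrable:
  fixes f :: "'a::euclidean_space \<Rightarrow> complex"
  assumes "schwartz f"
  shows "integrable lborel f"
  using schwartz_integrable_weight[OF assms, of 0] assms
  by (simp add: integrable_norm_iff schwartz_borel_measurable)

text \<open>Peetre's inequality: a polynomial weight moves from \<open>x\<close> to
  \<open>x + y\<close> at the price of the same weight in the shift.\<close>

lemma one_plus_norm_le: "1 + norm x \<le> (1 + norm (x + y)) * (1 + norm y)"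
  for x y :: "'a::real_normed_vector"
proof -
  have "norm x \<le> norm (x + y) + norm y" by (metis add_diff_cancel_right' norm_triangle_ineq4)
  moreover have "0 \<le> norm (x + y) * norm y" by simp
  ultimately show ?thesis
    by (simp only: distrib_left distrib_right mult_1_left mult_1_right)
qed

lemma rapidly_decreasing_translate_le:
  fixes f :: "'a::euclidean_space \<Rightarrow> complex"
  assumes "rapidly_decreasing f"
  obtains C where "C > 0" "\<And>x y. norm (f (x + y)) \<le> C * (1 + norm y) ^ k / (1 + norm x) ^ k"
proof -
  obtain C where C: "C > 0" "\<And>x. (1 + norm x) ^ k * norm (f x) \<le> C"
    using rapidly_decreasingD[OF assms] by blast
  have "norm (f (x + y)) \<le> C * (1 + norm y) ^ k / (1 + norm x) ^ k" for x y
  proof -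
    have "(1 + norm x) ^ k * norm (f (x + y)) \<le> ((1 + norm (x + y)) * (1 + norm y)) ^ k * norm (f (x + y))"
      by (intro mult_right_mono power_mono one_plus_norm_le) auto
    also have "\<dots> = (1 + norm y) ^ k * ((1 + norm (x + y)) ^ k * norm (f (x + y)))"
      by (simp add: power_mult_distrib)
    also have "\<dots> \<le> (1 + norm y) ^ k * C" by (intro mult_left_mono C) auto
    finally show ?thesis
      using zero_less_power[of "1 + norm x" k] by (simp add: pos_le_divide_eq mult_ac add_pos_nonneg)
  qed
  then show ?thesis using C that by blast
qed

text \<open>On a ball inside \<open>U\<close> the mean value inequality bounds the increment by
  \<open>g x\<close> times its length, so the normalized remainder is at most \<open>2 * g x\<close>
  and dominated convergence applies along every sequence of increments tending to 0.\<close>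

lemma has_derivative_integral:
  fixes F :: "'p::euclidean_space \<Rightarrow> 'x \<Rightarrow> complex"
  assumes U: "open U" "p0 \<in> U"
    and int: "\<And>p. p \<in> U \<Longrightarrow> integrable M (F p)"
    and der: "\<And>p x. p \<in> U \<Longrightarrow> x \<in> space M \<Longrightarrow> ((\<lambda>p. F p x) has_derivative F' p x) (at p)"
    and bound: "\<And>p x v. p \<in> U \<Longrightarrow> x \<in> space M \<Longrightarrow> norm (F' p x v) \<le> g x * norm v"
    and g: "integrable M g"
    and meas: "\<And>v. (\<lambda>x. F' p0 x v) \<in> borel_measurable M"
  shows "((\<lambda>p. \<integral>x. F p x \<partial>M) has_derivative (\<lambda>v. \<integral>x. F' p0 x v \<partial>M)) (at p0)"
proof -
  obtain d where d: "d > 0" "ball p0 d \<subseteq> U" using U openE by blast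
  have lin: "linear (F' p0 x)" if "x \<in> space M" for x
    using der[OF U(2) that] by (rule has_derivative_linear)
  have gn: "integrable M (\<lambda>x. g x * norm v)" for v :: 'p using g by simp
  have intF': "integrable M (\<lambda>x. F' p0 x v)" for v
    by (rule Bochner_Integration.integrable_bound[OF gn[of v] meas])
       (use bound[OF U(2)] in \<open>auto intro!: AE_I2 order_trans[OF _ abs_ge_self]\<close>)
  have bl: "bounded_linear (\<lambda>v. \<integral>x. F' p0 x v \<partial>M)"
  proof (rule bounded_linear_intro)
    show "(\<integral>x. F' p0 x (v + w) \<partial>M) = (\<integral>x. F' p0 x v \<partial>M) + (\<integral>x. F' p0 x w \<partial>M)" for v w
      by (subst Bochner_Integration.integral_add[symmetric, OF intF' intF'])
         (auto intro!: Bochner_Integration.integral_cong simp: linear_add[OF lin])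
    show "(\<integral>x. F' p0 x (r *\<^sub>R v) \<partial>M) = r *\<^sub>R (\<integral>x. F' p0 x v \<partial>M)" for r v
    proof -
      have "(\<integral>x. F' p0 x (r *\<^sub>R v) \<partial>M) = (\<integral>x. r *\<^sub>R F' p0 x v \<partial>M)"
        by (rule Bochner_Integration.integral_cong) (auto simp: linear_scale[OF lin])
      then show ?thesis by simp
    qed
    show "norm (\<integral>x. F' p0 x v \<partial>M) \<le> norm v * (\<integral>x. g x \<partial>M)" for v
    proof -
      have "norm (\<integral>x. F' p0 x v \<partial>M) \<le> (\<integral>x. g x * norm v \<partial>M)"
        by (rule order_trans[OF integral_norm_bound integral_mono])
           (use bound[OF U(2)] intF' gn in auto)
      then show ?thesis by (simp add: mult.commute)
    qed
  qed
  \<comment> \<open>Working within a ball keeps \<open>p0 + X i\<close> in \<open>U\<close> for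
    every index, so that the bound by \<open>2 * g x\<close> holds from the start of the sequence.
    The filter is the same as \<open>at 0\<close>, as used at the end.\<close>
  have lim: "((\<lambda>h. norm ((\<integral>x. F (p0 + h) x \<partial>M) - (\<integral>x. F p0 x \<partial>M) - (\<integral>x. F' p0 x h \<partial>M)) / norm h) \<longlongrightarrow> 0)
      (at 0 within ball 0 d)"
    unfolding tendsto_at_iff_sequentially
  proof (intro allI impI)
    fix X :: "nat \<Rightarrow> 'p"
    assume X: "\<forall>i. X i \<in> ball 0 d - {0}" and X0: "X \<longlonglongrightarrow> 0"
    have inU: "p0 + X i \<in> U" for i using X d(2) by (auto simp: subset_iff dist_norm)
    define R where "R i x = (F (p0 + X i) x - F p0 x - F' p0 x (X i)) /\<^sub>R norm (X i)" for i x
    have intR: "(\<integral>x. R i x \<partial>M) = ((\<integral>x. F (p0 + X i) x \<partial>M) - (\<integral>x. F p0 x \<partial>M) - (\<integral>x. F' p0 x (X i) \<partial>M)) /\<^sub>R norm (X i)" for i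
      unfolding R_def using int[OF inU] int[OF U(2)] intF' by simp
    have "(\<lambda>i. \<integral>x. R i x \<partial>M) \<longlonglongrightarrow> (\<integral>x. 0 \<partial>M)"
    proof (rule integral_dominated_convergence[where w="\<lambda>x. 2 * g x"])
      show "R i \<in> borel_measurable M" for i
        unfolding R_def using int[OF inU] int[OF U(2)] meas by measurable
      show "integrable M (\<lambda>x. 2 * g x)" using g by simp
      show "AE x in M. (\<lambda>i. R i x) \<longlonglongrightarrow> 0"
      proof (rule AE_I2)
        fix x assume x: "x \<in> space M"
        have "((\<lambda>h. norm (F (p0 + h) x - F p0 x - F' p0 x h) / norm h) \<longlongrightarrow> 0) (at 0)"
          using der[OF U(2) x] by (simp add: has_derivative_at)
        then have "((\<lambda>h. norm (F (p0 + h) x - F p0 x - F' p0 x h) / norm h) \<circ> X) \<longlonglongrightarrow> 0"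
          using X X0 unfolding tendsto_at_iff_sequentially by auto
        then have "(\<lambda>i. norm (R i x)) \<longlonglongrightarrow> 0"
          by (simp add: R_def o_def divide_inverse mult.commute)
        then show "(\<lambda>i. R i x) \<longlonglongrightarrow> 0" by (rule tendsto_norm_zero_cancel)
      qed
      show "AE x in M. norm (R i x) \<le> 2 * g x" for i
      proof (rule AE_I2)
        fix x assume x: "x \<in> space M"
        have h: "0 < norm (X i)" using X by auto
        have "norm (F (p0 + X i) x - F p0 x) \<le> g x * norm ((p0 + X i) - p0)"
        proof (rule differentiable_bound[of "ball p0 d" "\<lambda>p. F p x" "\<lambda>p. F' p x"])
          show "((\<lambda>p. F p x) has_derivative F' p x) (at p within ball p0 d)" if "p \<in> ball p0 d" for p
            using der[OF _ x] d(2) that has_derivative_at_withinI by blast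
          show "onorm (F' p x) \<le> g x" if "p \<in> ball p0 d" for p
            by (rule onorm_le) (use bound[OF _ x] d(2) that in blast)
        qed (use X d(1) in \<open>auto simp: dist_norm\<close>)
        then have 1: "norm (F (p0 + X i) x - F p0 x) \<le> g x * norm (X i)" by simp
        have 2: "norm (F' p0 x (X i)) \<le> g x * norm (X i)" by (rule bound[OF U(2) x])
        have "norm (F (p0 + X i) x - F p0 x - F' p0 x (X i)) \<le> 2 * g x * norm (X i)"
          using norm_triangle_ineq4[of "F (p0 + X i) x - F p0 x" "F' p0 x (X i)"] 1 2 by linarith
        moreover have "norm (R i x) = norm (F (p0 + X i) x - F p0 x - F' p0 x (X i)) / norm (X i)"
          by (simp add: R_def divide_inverse mult.commute)
        ultimately show "norm (R i x) \<le> 2 * g x" using h by (simp add: pos_divide_le_eq)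
      qed
    qed simp
    then have "(\<lambda>i. norm (\<integral>x. R i x \<partial>M)) \<longlonglongrightarrow> 0" using tendsto_norm_zero by simp
    then show "((\<lambda>h. norm ((\<integral>x. F (p0 + h) x \<partial>M) - (\<integral>x. F p0 x \<partial>M) - (\<integral>x. F' p0 x h \<partial>M)) / norm h) \<circ> X) \<longlonglongrightarrow> 0"
      unfolding intR by (simp add: o_def divide_inverse mult.commute)
  qed
  have "at 0 within ball 0 d = (at 0 :: 'p filter)" using d(1) by (intro at_within_open) auto
  with lim bl show ?thesis by (simp add: has_derivative_at)
qed

text \<open>The equivalence of integrability also settles the case of a non-integrable
  \<open>f\<close>, where both integrals are 0 by convention. \<open>fourier_translate\<close>
  therefore holds for every function.\<close>

lemma lborel_integral_translate:
  fixes f :: "'a::euclidean_space \<Rightarrow> 'b::{banach, second_countable_topology}"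
  shows "(\<integral>x. f (x + a) \<partial>lborel) = (\<integral>x. f x \<partial>lborel)"
    and "integrable lborel (\<lambda>x. f (x + a)) \<longleftrightarrow> integrable lborel f"
proof -
  have "(\<lambda>x. x + a) = (+) a" by (auto simp: add.commute)
  then have d: "distr lborel borel (\<lambda>x. x + a) = (lborel :: 'a measure)"
    by (simp add: lborel_distr_plus)
  have m: "f \<in> borel_measurable borel" if "(\<lambda>x. f (x + a)) \<in> borel_measurable borel"
  proof -
    have "(\<lambda>x. (\<lambda>x. f (x + a)) (x - a)) \<in> borel_measurable borel"
      by (rule measurable_compose[OF _ that]) simp
    then show ?thesis by simp
  qed
  have e: "integrable lborel (\<lambda>x. f (x + a)) \<longleftrightarrow> integrable lborel f" if "f \<in> borel_measurable borel"
    using that integrable_distr_eq[of "\<lambda>x. x + a" lborel borel f] by (simp add: d)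
  show i: "integrable lborel (\<lambda>x. f (x + a)) \<longleftrightarrow> integrable lborel f"
  proof
    assume *: "integrable lborel (\<lambda>x. f (x + a))"
    then have "(\<lambda>x. f (x + a)) \<in> borel_measurable borel"
      using borel_measurable_integrable by fastforce
    with * show "integrable lborel f" using e m by blast
  next
    assume *: "integrable lborel f"
    then have "f \<in> borel_measurable borel" using borel_measurable_integrable by fastforce
    with * show "integrable lborel (\<lambda>x. f (x + a))" using e by blast
  qed
  show "(\<integral>x. f (x + a) \<partial>lborel) = (\<integral>x. f x \<partial>lborel)"
  proof (cases "integrable lborel f")
    case True
    then have "f \<in> borel_measurable borel" by auto
    then have "(\<integral>x. f (x + a) \<partial>lborel) = integral\<^sup>L (distr lborel borel (\<lambda>x. x + a)) f"
      by (subst integral_distr) auto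
    then show ?thesis using d by simp
  next
    case False
    then show ?thesis using i by (simp add: not_integrable_integral_eq)
  qed
qed

lemma schwartz_translate_bound:
  fixes f :: "'a::euclidean_space \<Rightarrow> complex"
  assumes "schwartz f"
  obtains C where "C > 0"
    "\<And>x y. norm (f (x + y)) \<le> C * (1 + norm y) ^ k / (1 + norm x) ^ k"
  using rapidly_decreasing_translate_le[OF schwartz_rapidly_decreasing[OF assms]] by blast

section \<open>Rules for the Fourier transform: linearity, translation, differentiation\<close>

lemma fourier_integrable:
  assumes "integrable lborel f"
  shows "integrable lborel (\<lambda>x. cis (- 2 * pi * (x \<bullet> \<xi>)) * f x)"
  by (rule Bochner_Integration.integrable_bound[OF assms]) (use assms in \<open>auto simp: norm_mult cis_conv_exp\<close>)

lemma norm_fourier_le: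
  shows "norm (fourier f \<xi>) \<le> (\<integral>x. norm (f x) \<partial>lborel)"
  unfolding fourier_def
  by (rule order_trans[OF integral_norm_bound]) (simp add: norm_mult)

lemma fourier_add:
  assumes "integrable lborel f" "integrable lborel g"
  shows "fourier (\<lambda>x. f x + g x) \<xi> = fourier f \<xi> + fourier g \<xi>"
  unfolding fourier_def
  using fourier_integrable[OF assms(1)] fourier_integrable[OF assms(2)] by (simp add: distrib_left)

lemma fourier_cmult: "fourier (\<lambda>x. c * f x) \<xi> = c * fourier f \<xi>"
proof -
  have "fourier (\<lambda>x. c * f x) \<xi> = (\<integral>x. c * (cis (- 2 * pi * (x \<bullet> \<xi>)) * f x) \<partial>lborel)"
    unfolding fourier_def by (simp add: mult_ac)
  then show ?thesis by (simp add: fourier_def)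
qed

lemma fourier_translate: "fourier (\<lambda>x. f (x - a)) \<xi> = cis (- 2 * pi * (a \<bullet> \<xi>)) * fourier f \<xi>"
proof -
  have "fourier (\<lambda>x. f (x - a)) \<xi> = (\<integral>x. cis (- 2 * pi * ((x + a) \<bullet> \<xi>)) * f x \<partial>lborel)"
    unfolding fourier_def
    by (subst lborel_integral_translate(1)[of _ a, symmetric]) simp
  also have "\<dots> = (\<integral>x. cis (- 2 * pi * (a \<bullet> \<xi>)) * (cis (- 2 * pi * (x \<bullet> \<xi>)) * f x) \<partial>lborel)"
  proof -
    have "cis (- 2 * pi * ((x + a) \<bullet> \<xi>)) = cis (- 2 * pi * (a \<bullet> \<xi>)) * cis (- 2 * pi * (x \<bullet> \<xi>))" for x
      by (simp add: inner_add_left cis_mult algebra_simps)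
    then show ?thesis by (simp add: mult.assoc)
  qed
  finally show ?thesis by (simp add: fourier_def)
qed

text \<open>Both sides are the derivative at \<open>t = 0\<close> of the Fourier transform of \<open>x \<mapsto> f (x + t b)\<close>, which
  avoids integration by parts.\<close>

lemma fourier_dpartial:
  fixes f :: "'a::euclidean_space \<Rightarrow> complex"
  assumes f: "schwartz f" and b: "b \<in> Basis"
  shows "fourier (dpartial b f) \<xi> = 2 * pi * \<i> * (\<xi> \<bullet> b) * fourier f \<xi>"
proof -
  let ?e = "\<lambda>x. cis (- 2 * pi * (x \<bullet> \<xi>))"
  let ?k = "DIM('a) + 2"
  obtain C where C: "C > 0"
    "\<And>x y. norm (dpartial b f (x + y)) \<le> C * (1 + norm y) ^ ?k / (1 + norm x) ^ ?k"
    using schwartz_translate_bound[OF schwartz_dpartial[OF f b]] by blast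
  have nb: "norm b = 1" using b by simp
  have "((\<lambda>t. \<integral>x. ?e x * f (x + t *\<^sub>R b) \<partial>lborel) has_derivative
      (\<lambda>v. \<integral>x. ?e x * (v *\<^sub>R dpartial b f (x + 0 *\<^sub>R b)) \<partial>lborel)) (at (0::real))"
  \<comment> \<open>For \<open>t\<close> in the unit ball the shift by \<open>t\<close> times a unit
    vector costs at most a factor 2 in the weight, hence the power of 2 in the majorant.\<close>
  proof (rule has_derivative_integral[of "ball 0 1" _ _ _ _ "\<lambda>x. C * 2 ^ ?k * (1 / (1 + norm x) ^ ?k)"])
    show "integrable lborel (\<lambda>x. ?e x * f (x + t *\<^sub>R b))" for t
      by (intro fourier_integrable) (simp add: lborel_integral_translate schwartz_integrable f)
    show "((\<lambda>t. ?e x * f (x + t *\<^sub>R b)) has_derivative (\<lambda>v. ?e x * (v *\<^sub>R dpartial b f (x + t *\<^sub>R b)))) (at t)" for x t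
    proof (rule has_derivative_mult_right)
      have 1: "((\<lambda>t. x + t *\<^sub>R b) has_derivative (\<lambda>v. v *\<^sub>R b)) (at t)"
        by (auto intro!: derivative_eq_intros)
      have 2: "(f has_derivative frechet_derivative f (at (x + t *\<^sub>R b))) (at (x + t *\<^sub>R b))"
        using schwartz_differentiable[OF f] frechet_derivative_works by blast
      have "linear (frechet_derivative f (at (x + t *\<^sub>R b)))" using 2 by (rule has_derivative_linear)
      then show "((\<lambda>t. f (x + t *\<^sub>R b)) has_derivative (\<lambda>v. v *\<^sub>R dpartial b f (x + t *\<^sub>R b))) (at t)"
        using has_derivative_compose[OF 1 2] by (simp add: linear_scale)
    qed
    show "norm (?e x * (v *\<^sub>R dpartial b f (x + t *\<^sub>R b))) \<le> C * 2 ^ ?k * (1 / (1 + norm x) ^ ?k) * norm v"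
      if "t \<in> ball 0 1" for t v :: real and x
    proof -
      have "norm (dpartial b f (x + t *\<^sub>R b)) \<le> C * (1 + norm (t *\<^sub>R b)) ^ ?k / (1 + norm x) ^ ?k" by (rule C)
      also have "\<dots> \<le> C * 2 ^ ?k / (1 + norm x) ^ ?k"
        using that nb C(1) by (intro divide_right_mono mult_left_mono power_mono) auto
      finally have "norm (dpartial b f (x + t *\<^sub>R b)) * norm v \<le> C * 2 ^ ?k / (1 + norm x) ^ ?k * norm v"
        by (rule mult_right_mono) simp
      then show ?thesis by (simp only: norm_mult norm_cis norm_scaleR mult.commute mult_1_left real_norm_def times_divide_eq_right mult_1_right)
    qed
    show "(\<lambda>x. ?e x * (v *\<^sub>R dpartial b f (x + 0 *\<^sub>R b))) \<in> borel_measurable lborel" for v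
      using schwartz_borel_measurable[OF schwartz_dpartial[OF f b]]
      by (simp add: cis_conv_exp)
    show "integrable lborel (\<lambda>x::'a. C * 2 ^ ?k * (1 / (1 + norm x) ^ ?k))"
      by (intro integrable_mult_right integrable_inverse_one_plus_norm_power) simp
  qed auto
  moreover have "(\<integral>x. ?e x * f (x + t *\<^sub>R b) \<partial>lborel) = cis (2 * pi * t * (b \<bullet> \<xi>)) * fourier f \<xi>" for t
    using fourier_translate[of f "- t *\<^sub>R b" \<xi>] by (simp add: fourier_def mult_ac)
  ultimately have "((\<lambda>t. cis (2 * pi * t * (b \<bullet> \<xi>)) * fourier f \<xi>) has_derivative
      (\<lambda>v. v *\<^sub>R fourier (dpartial b f) \<xi>)) (at 0)"
    by (simp add: fourier_def)
  then have "((\<lambda>t. cis (2 * pi * t * (b \<bullet> \<xi>)) * fourier f \<xi>) has_vector_derivative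
      fourier (dpartial b f) \<xi>) (at 0)"
    by (simp add: has_vector_derivative_def)
  moreover have "((\<lambda>t. cis (2 * pi * t * (b \<bullet> \<xi>)) * fourier f \<xi>) has_vector_derivative
      2 * pi * \<i> * (\<xi> \<bullet> b) * fourier f \<xi>) (at 0)"
  proof (rule has_vector_derivative_mult_left)
    let ?c = "2 * pi * \<i> * (\<xi> \<bullet> b)"
    have "((\<lambda>z. exp (?c * z)) has_field_derivative ?c) (at (of_real 0))"
      by (auto intro!: derivative_eq_intros)
    from has_vector_derivative_real_field[OF this]
    show "((\<lambda>t. cis (2 * pi * t * (b \<bullet> \<xi>))) has_vector_derivative ?c) (at 0)"
      by (simp add: cis_conv_exp mult_ac inner_commute)
  qed
  ultimately show ?thesis by (rule vector_derivative_unique_at)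
qed

lemma fourier_partials_replicate:
  fixes f :: "'a::euclidean_space \<Rightarrow> complex"
  assumes f: "schwartz f" and b: "b \<in> Basis"
  shows "fourier (partials (replicate N b) f) \<xi> = (2 * pi * \<i> * (\<xi> \<bullet> b)) ^ N * fourier f \<xi>"
proof (induction N)
  case (Suc N)
  have "schwartz (partials (replicate N b) f)"
    using f b by (intro schwartz_partials) auto
  from fourier_dpartial[OF this b] Suc show ?case by simp
qed simp

section \<open>Gaussians and Fourier inversion\<close>

text \<open>The weight of order DIM + 2 turns a sup bound into an L^1 bound, and powers of \<xi> are
  bought by repeated differentiation in one coordinate direction. The estimate is linear in
  \<open>A\<close>: for a fixed function it gives decay of the transform, and for differences
  \<open>F j - f\<close> it gives convergence.\<close>

lemma fourier_weight_bound:
  fixes f :: "'a::euclidean_space \<Rightarrow> complex"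
  assumes f: "schwartz f"
    and A0: "\<And>x. (1 + norm x) ^ (DIM('a) + 2) * norm (f x) \<le> A"
    and AN: "\<And>x b. b \<in> Basis \<Longrightarrow> (1 + norm x) ^ (DIM('a) + 2) * norm (partials (replicate N b) f x) \<le> A"
  shows "(1 + norm \<xi>) ^ N * norm (fourier f \<xi>)
     \<le> 2 ^ N * (1 + real DIM('a) ^ N) * (\<integral>x. 1 / (1 + norm x) ^ (DIM('a) + 2) \<partial>(lborel :: 'a measure)) * A"
proof -
  let ?k = "DIM('a) + 2" and ?n = "real DIM('a)"
  let ?I = "\<integral>x. 1 / (1 + norm x) ^ ?k \<partial>(lborel :: 'a measure)"
  have I: "integrable lborel (\<lambda>x::'a. 1 / (1 + norm x) ^ ?k)"
    by (rule integrable_inverse_one_plus_norm_power) simp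
  have L: "norm (fourier g \<xi>) \<le> ?I * A"
    if g: "schwartz g" and gA: "\<And>x. (1 + norm x) ^ ?k * norm (g x) \<le> A" for g :: "'a \<Rightarrow> complex"
  proof -
    have "norm (fourier g \<xi>) \<le> (\<integral>x. norm (g x) \<partial>lborel)" by (rule norm_fourier_le)
    also have "\<dots> \<le> (\<integral>x. 1 / (1 + norm x) ^ ?k * A \<partial>(lborel :: 'a measure))"
    proof (rule Bochner_Integration.integral_mono)
      show "norm (g x) \<le> 1 / (1 + norm x) ^ ?k * A" for x
        using gA[of x] zero_less_power[of "1 + norm x" ?k]
        by (simp add: pos_le_divide_eq mult_ac add_pos_nonneg del: power_Suc power_add add_2_eq_Suc')
      show "integrable lborel (\<lambda>x. norm (g x))" using schwartz_integrable[OF g] by simp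
      show "integrable lborel (\<lambda>x::'a. 1 / (1 + norm x) ^ ?k * A)" by (rule integrable_mult_left[OF I])
    qed
    also have "\<dots> = ?I * A" by (rule integral_mult_left_zero)
    finally show ?thesis .
  qed
  have IA: "0 \<le> ?I * A" using L[OF f A0] norm_ge_zero order_trans by blast
  \<comment> \<open>The norm is at most the sum of the absolute coordinates, so some coordinate is
    at least the fraction 1 / DIM of it.\<close>
  obtain b :: 'a where b: "b \<in> Basis" "norm \<xi> \<le> ?n * \<bar>\<xi> \<bullet> b\<bar>"
  proof -
    have "\<exists>b\<in>Basis. norm \<xi> \<le> ?n * \<bar>\<xi> \<bullet> b\<bar>"
    proof (rule ccontr)
      assume "\<not> ?thesis"
      then have "(\<Sum>b\<in>Basis. ?n * \<bar>\<xi> \<bullet> b\<bar>) < (\<Sum>b\<in>(Basis :: 'a set). norm \<xi>)"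
        by (intro sum_strict_mono) auto
      then have "?n * (\<Sum>b\<in>Basis. \<bar>\<xi> \<bullet> b\<bar>) < ?n * norm \<xi>"
        by (simp add: sum_distrib_left)
      then show False using norm_le_l1[of \<xi>] by simp
    qed
    then show ?thesis using that by blast
  qed
  have "norm \<xi> ^ N * norm (fourier f \<xi>) \<le> (?n * \<bar>\<xi> \<bullet> b\<bar>) ^ N * norm (fourier f \<xi>)"
    using b by (intro mult_right_mono power_mono) auto
  \<comment> \<open>The factor 2 pi >= 1 is inserted so that the power becomes exactly the
    multiplier of an \<open>N\<close>-fold derivative.\<close>
  also have "\<dots> \<le> (?n * (2 * pi * \<bar>\<xi> \<bullet> b\<bar>)) ^ N * norm (fourier f \<xi>)"
  proof (intro mult_right_mono power_mono mult_left_mono)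
    have "1 \<le> 2 * pi" using pi_gt3 by simp
    then show "\<bar>\<xi> \<bullet> b\<bar> \<le> 2 * pi * \<bar>\<xi> \<bullet> b\<bar>" using mult_right_mono[of 1 "2 * pi" "\<bar>\<xi> \<bullet> b\<bar>"] by simp
  qed auto
  also have "\<dots> = ?n ^ N * norm (fourier (partials (replicate N b) f) \<xi>)"
    unfolding fourier_partials_replicate[OF f b(1)]
    by (simp add: norm_mult norm_power power_mult_distrib)
  also have "\<dots> \<le> ?n ^ N * (?I * A)"
  proof (rule mult_left_mono)
    show "norm (fourier (partials (replicate N b) f) \<xi>) \<le> ?I * A"
      by (rule L) (use AN b f in \<open>auto intro!: schwartz_partials\<close>)
  qed simp
  finally have 1: "norm \<xi> ^ N * norm (fourier f \<xi>) \<le> ?n ^ N * (?I * A)" .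
  have "(1 + norm \<xi>) ^ N * norm (fourier f \<xi>) \<le> 2 ^ N * (1 + norm \<xi> ^ N) * norm (fourier f \<xi>)"
    by (intro mult_right_mono one_plus_power_le) auto
  also have "\<dots> = 2 ^ N * (norm (fourier f \<xi>) + norm \<xi> ^ N * norm (fourier f \<xi>))"
    by (simp add: algebra_simps)
  also have "\<dots> \<le> 2 ^ N * (?I * A + ?n ^ N * (?I * A))"
    by (intro mult_left_mono add_mono L f A0 1) auto
  finally show ?thesis by (simp add: algebra_simps)
qed

lemma rapidly_decreasing_fourier:
  fixes f :: "'a::euclidean_space \<Rightarrow> complex"
  assumes f: "schwartz f"
  shows "rapidly_decreasing (fourier f)"
proof (rule rapidly_decreasingI)
  fix N
  let ?k = "DIM('a) + 2"
  obtain A0 where A0: "A0 > 0" "\<And>x. (1 + norm x) ^ ?k * norm (f x) \<le> A0"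
    using rapidly_decreasingD[OF schwartz_rapidly_decreasing[OF f]] by blast
  have "\<forall>b\<in>Basis. \<exists>A>0. \<forall>x. (1 + norm x) ^ ?k * norm (partials (replicate N b) f x) \<le> A"
  proof
    fix b :: 'a assume "b \<in> Basis"
    then have "schwartz (partials (replicate N b) f)" by (intro schwartz_partials f) auto
    then show "\<exists>A>0. \<forall>x. (1 + norm x) ^ ?k * norm (partials (replicate N b) f x) \<le> A"
      using rapidly_decreasingD[OF schwartz_rapidly_decreasing] by meson
  qed
  then obtain A where A: "\<And>b. b \<in> Basis \<Longrightarrow> A b > 0"
    "\<And>b x. b \<in> Basis \<Longrightarrow> (1 + norm x) ^ ?k * norm (partials (replicate N b) f x) \<le> A b"
    by metis
  let ?A = "A0 + (\<Sum>b\<in>Basis. A b)"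
  have s: "0 \<le> (\<Sum>b\<in>Basis. A b)" using A(1) by (intro sum_nonneg) (auto simp: less_imp_le)
  have A_le: "A b \<le> ?A" if "b \<in> Basis" for b
    using member_le_sum[of b Basis A] A(1) A0(1) that by (auto simp: less_imp_le intro: add_increasing)
  have *: "(1 + norm \<xi>) ^ N * norm (fourier f \<xi>)
     \<le> 2 ^ N * (1 + real DIM('a) ^ N) * (\<integral>x. 1 / (1 + norm x) ^ ?k \<partial>(lborel :: 'a measure)) * ?A" for \<xi>
  proof (rule fourier_weight_bound[OF f])
    show "(1 + norm x) ^ ?k * norm (f x) \<le> ?A" for x using A0(2)[of x] s by linarith
    show "(1 + norm x) ^ ?k * norm (partials (replicate N b) f x) \<le> ?A" if "b \<in> Basis" for x b
      using A(2)[OF that, of x] A_le[OF that] by linarith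
  qed
  have "norm \<xi> ^ N * norm (fourier f \<xi>) \<le> (1 + norm \<xi>) ^ N * norm (fourier f \<xi>)" for \<xi>
    by (intro mult_right_mono power_mono) auto
  with * show "\<exists>C. \<forall>\<xi>. norm \<xi> ^ N * norm (fourier f \<xi>) \<le> C" by (meson order_trans)
qed

lemma fourier_borel_measurable:
  assumes "f \<in> borel_measurable borel"
  shows "fourier f \<in> borel_measurable borel"
proof -
  have "(\<lambda>\<xi>. \<integral>x. cis (- 2 * pi * (x \<bullet> \<xi>)) * f x \<partial>lborel) \<in> borel_measurable borel"
    using assms unfolding cis_conv_exp
    by (intro sigma_finite_measure.borel_measurable_lebesgue_integral) (auto intro: sigma_finite_lborel)
  then show ?thesis by (simp add: fourier_def[abs_def])
qed

lemma fourier_schwartz_integrable: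
  fixes f :: "'a::euclidean_space \<Rightarrow> complex"
  assumes "schwartz f"
  shows "integrable lborel (fourier f)"
proof -
  have m: "fourier f \<in> borel_measurable borel"
    by (intro fourier_borel_measurable schwartz_borel_measurable assms)
  have "integrable lborel (\<lambda>x. (1 + norm x) ^ 0 * norm (fourier f x))"
    by (intro rapidly_decreasing_integrable rapidly_decreasing_fourier assms m)
  then show ?thesis using m by (simp add: integrable_norm_iff)
qed

lemma schwartz_diff:
  assumes "schwartz f" "schwartz g"
  shows "schwartz (\<lambda>x. f x - g x)"
    and "bs \<in> lists Basis \<Longrightarrow> partials bs (\<lambda>x. f x - g x) = (\<lambda>x. partials bs f x - partials bs g x)"
  using schwartz_add[OF assms(1) schwartz_cmult(1)[OF assms(2), of "-1"]]
    schwartz_cmult(2)[OF assms(2), of _ "-1"] by auto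

lemma schwartz_tendsto_weight:
  fixes F :: "nat \<Rightarrow> 'a::euclidean_space \<Rightarrow> complex"
  assumes F: "schwartz_tendsto F f" and bs: "bs \<in> lists Basis" and e: "\<epsilon> > 0"
  shows "\<forall>\<^sub>F j in sequentially. \<forall>x. (1 + norm x) ^ k * norm (partials bs (F j) x - partials bs f x) \<le> \<epsilon>"
proof -
  \<comment> \<open>The factor 2^k compensates \<open>one_plus_power_le\<close>, and the remaining 2
    splits the error between the weights of orders 0 and \<open>k\<close>.\<close>
  have U: "\<forall>\<^sub>F j in sequentially. \<forall>x\<in>UNIV. dist (norm x ^ i *\<^sub>R partials bs (F j) x) (norm x ^ i *\<^sub>R partials bs f x) < \<epsilon> / (2 ^ k * 2)" for i
    using F bs e unfolding schwartz_tendsto_def uniform_limit_iff by (meson divide_pos_pos mult_pos_pos zero_less_numeral zero_less_power)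
  show ?thesis
    using U[of 0] U[of k]
  proof eventually_elim
    case (elim j)
    show ?case
    proof
      fix x
      let ?d = "norm (partials bs (F j) x - partials bs f x)"
      have 0: "norm x ^ 0 * ?d < \<epsilon> / (2 ^ k * 2)" and 1: "norm x ^ k * ?d < \<epsilon> / (2 ^ k * 2)"
        using elim by (auto simp: dist_norm simp flip: scaleR_diff_right)
      have "(1 + norm x) ^ k * ?d \<le> 2 ^ k * (1 + norm x ^ k) * ?d"
        by (intro mult_right_mono one_plus_power_le) auto
      also have "\<dots> = 2 ^ k * (norm x ^ 0 * ?d + norm x ^ k * ?d)" by (simp add: algebra_simps)
      also have "\<dots> \<le> 2 ^ k * (\<epsilon> / (2 ^ k * 2) + \<epsilon> / (2 ^ k * 2))"
        using 0 1 by (intro mult_left_mono add_mono) auto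
      also have "\<dots> = \<epsilon>" by simp
      finally show "(1 + norm x) ^ k * ?d \<le> \<epsilon>" .
    qed
  qed
qed

text \<open>\<open>fourier_weight_bound\<close> for \<open>F j - f\<close> involves only the
  difference itself and its finitely many pure \<open>N\<close>-fold coordinate derivatives, each of
  which is eventually small in the weighted sup norm.\<close>

lemma fourier_schwartz_tendsto:
  fixes F :: "nat \<Rightarrow> 'a::euclidean_space \<Rightarrow> complex"
  assumes F: "schwartz_tendsto F f" and e: "\<epsilon> > 0"
  shows "\<forall>\<^sub>F j in sequentially. \<forall>\<xi>. (1 + norm \<xi>) ^ N * norm (fourier (F j) \<xi> - fourier f \<xi>) \<le> \<epsilon>"
proof -
  let ?k = "DIM('a) + 2"
  have Fj: "schwartz (F j)" and f: "schwartz f" for j using F by (auto simp: schwartz_tendsto_def)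
  define c where "c = 2 ^ N * (1 + real DIM('a) ^ N) * (\<integral>x. 1 / (1 + norm x) ^ ?k \<partial>(lborel :: 'a measure))"
  have c: "c \<ge> 0" unfolding c_def by (intro mult_nonneg_nonneg Bochner_Integration.integral_nonneg) auto
  define A where "A = \<epsilon> / (c + 1)"
  have A: "A > 0" "c * A \<le> \<epsilon>" using c e by (auto simp: A_def field_simps)
  have ev0: "\<forall>\<^sub>F j in sequentially. \<forall>x. (1 + norm x) ^ ?k * norm (partials [] (F j) x - partials [] f x) \<le> A"
    by (rule schwartz_tendsto_weight[OF F _ A(1)]) simp
  have evN: "\<forall>\<^sub>F j in sequentially. \<forall>b\<in>Basis. \<forall>x. (1 + norm x) ^ ?k * norm (partials (replicate N b) (F j) x - partials (replicate N b) f x) \<le> A"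
  proof (rule eventually_ball_finite, simp, rule ballI)
    fix b :: 'a assume "b \<in> Basis"
    then show "\<forall>\<^sub>F j in sequentially. \<forall>x. (1 + norm x) ^ ?k * norm (partials (replicate N b) (F j) x - partials (replicate N b) f x) \<le> A"
      by (intro schwartz_tendsto_weight[OF F _ A(1)]) auto
  qed
  show ?thesis using ev0 evN
  proof eventually_elim
    case (elim j)
    show ?case
    proof
      fix \<xi>
      have d: "fourier (F j) \<xi> - fourier f \<xi> = fourier (\<lambda>x. F j x - f x) \<xi>"
        using fourier_add[OF schwartz_integrable[OF Fj] schwartz_integrable[OF schwartz_cmult(1)[OF f, of "-1"]], of j \<xi>]
          fourier_cmult[of "-1" f \<xi>] by simp
      have "(1 + norm \<xi>) ^ N * norm (fourier (\<lambda>x. F j x - f x) \<xi>) \<le> c * A"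
        unfolding c_def
      proof (rule fourier_weight_bound[OF schwartz_diff(1)[OF Fj f]])
        show "(1 + norm x) ^ ?k * norm (F j x - f x) \<le> A" for x using elim by simp
        fix x b :: 'a assume b: "b \<in> Basis"
        then have "replicate N b \<in> lists Basis" by auto
        then show "(1 + norm x) ^ ?k * norm (partials (replicate N b) (\<lambda>x. F j x - f x) x) \<le> A"
          using elim b by (simp add: schwartz_diff(2)[OF Fj f])
      qed
      then show "(1 + norm \<xi>) ^ N * norm (fourier (F j) \<xi> - fourier f \<xi>) \<le> \<epsilon>"
        using A d by simp
    qed
  qed
qed

section \<open>The Gaussian of integral 1 that is its own Fourier transform\<close>

definition gauss :: "'a::euclidean_space \<Rightarrow> real" where
  "gauss x = exp (- pi * (norm x)\<^sup>2)"

lemma gauss_pos: "0 < gauss x" and gauss_le_1: "gauss x \<le> 1"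
  by (auto simp: gauss_def)

lemma gauss_nonneg [simp]: "0 \<le> gauss x"
  by (simp add: gauss_def)

lemma abs_gauss [simp]: "\<bar>gauss x\<bar> = gauss x"
  by (simp add: gauss_def)

lemma gauss_borel_measurable [measurable]: "gauss \<in> borel_measurable borel"
  unfolding gauss_def[abs_def] by measurable

lemma gauss_minus [simp]: "gauss (- x) = gauss x"
  by (simp add: gauss_def)

lemma gauss_prod: "gauss x = (\<Prod>b\<in>Basis. gauss (x \<bullet> b))"
proof -
  have "(norm x)\<^sup>2 = (\<Sum>b\<in>Basis. (x \<bullet> b)\<^sup>2)"
    unfolding power2_norm_eq_inner by (subst euclidean_inner) (simp add: power2_eq_square)
  then have "gauss x = exp (\<Sum>b\<in>Basis. - pi * (x \<bullet> b)\<^sup>2)"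
    by (simp add: gauss_def sum_distrib_left)
  then show ?thesis by (subst (asm) exp_sum) (auto simp: gauss_def)
qed

text \<open>Stretching by sqrt(2 pi) turns the standard normal density into a multiple of exp(-pi
  x^2), and its known characteristic function into the transform claimed here.\<close>

lemma gauss_real:
  shows "integrable lborel (gauss :: real \<Rightarrow> real)"
    and "(\<integral>x. cis (2 * pi * (x * \<xi>)) * complex_of_real (gauss x) \<partial>lborel) = complex_of_real (gauss (\<xi>::real))"
proof -
  let ?s = "sqrt (2 * pi)"
  have s: "?s > 0" "?s * ?s = 2 * pi" by auto
  have d: "std_normal_density (?s * x) = gauss x / ?s" for x
    using s by (simp add: std_normal_density_def gauss_def power_mult_distrib)
  have "integrable lborel std_normal_density" by (rule integrable_normal_density) simp
  from lborel_integrable_real_affine[OF this, of ?s 0]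
  have "integrable lborel (\<lambda>x::real. gauss x / ?s)" using s by (simp add: d)
  from integrable_mult_left[OF this, of ?s] s show "integrable lborel (gauss :: real \<Rightarrow> real)" by simp
  have "complex_of_real (gauss \<xi>) = char std_normal_distribution (?s * \<xi>)"
    by (simp add: char_std_normal_distribution gauss_def power_mult_distrib)
  also have "\<dots> = (\<integral>x. std_normal_density x *\<^sub>R iexp (?s * \<xi> * x) \<partial>lborel)"
    unfolding char_def by (subst integral_density) (auto intro: normal_density_nonneg)
  also have "\<dots> = ?s *\<^sub>R (\<integral>x. std_normal_density (?s * x) *\<^sub>R iexp (?s * \<xi> * (?s * x)) \<partial>lborel)"
    using s by (subst lborel_integral_real_affine[of ?s _ 0]) auto
  also have "\<dots> = (\<integral>x. ?s *\<^sub>R (std_normal_density (?s * x) *\<^sub>R iexp (?s * \<xi> * (?s * x))) \<partial>lborel)"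
    by (rule integral_scaleR_right[symmetric])
  also have "\<dots> = (\<integral>x. cis (2 * pi * (x * \<xi>)) * complex_of_real (gauss x) \<partial>lborel)"
  proof (rule Bochner_Integration.integral_cong[OF refl])
    fix x
    have eq: "?s * \<xi> * (?s * x) = 2 * pi * (x * \<xi>)"
      using s(2) by (metis mult.assoc mult.commute)
    show "?s *\<^sub>R (std_normal_density (?s * x) *\<^sub>R iexp (?s * \<xi> * (?s * x))) = cis (2 * pi * (x * \<xi>)) * complex_of_real (gauss x)"
      using s(1) unfolding d eq by (simp add: cis_conv_exp scaleR_conv_of_real mult.commute)
  qed
  finally show "(\<integral>x. cis (2 * pi * (x * \<xi>)) * complex_of_real (gauss x) \<partial>lborel) = complex_of_real (gauss \<xi>)" by simp
qed

text \<open>Gaussian and character both factor over the coordinates, and Lebesgue measure is the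
  image of a product measure, so the line suffices.\<close>

lemma
  shows gauss_integrable: "integrable lborel (gauss :: 'a::euclidean_space \<Rightarrow> real)"
    and gauss_fourier: "(\<integral>x. cis (2 * pi * (x \<bullet> \<xi>)) * complex_of_real (gauss x) \<partial>lborel) = complex_of_real (gauss (\<xi>::'a))"
proof -
  interpret P: product_sigma_finite "\<lambda>_::'a. lborel :: real measure"
    by standard
  let ?T = "\<lambda>f. \<Sum>b\<in>Basis. f b *\<^sub>R (b::'a)"
  let ?P = "\<Pi>\<^sub>M b\<in>(Basis::'a set). (lborel::real measure)"
  have T[measurable]: "?T \<in> ?P \<rightarrow>\<^sub>M borel" by measurable
  have inner: "?T f \<bullet> b = f b" if "b \<in> Basis" for f and b :: 'a
    using that by (simp add: inner_sum_left inner_Basis if_distrib sum.delta cong: if_cong)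
  have g: "gauss (?T f) = (\<Prod>b\<in>Basis. gauss (f b))" for f
    by (subst gauss_prod) (simp add: inner)
  have "integrable ?P (\<lambda>f. \<Prod>b\<in>Basis. gauss (f b))"
    by (rule P.product_integrable_prod) (auto intro: gauss_real)
  then have "integrable (distr ?P borel ?T) gauss"
    by (subst integrable_distr_eq) (auto simp: g)
  then show "integrable lborel (gauss :: 'a \<Rightarrow> real)" using lborel_eq[where 'a='a] by metis
  have gr: "integrable lborel (\<lambda>x. cis (2 * pi * (x * c)) * complex_of_real (gauss x))" for c
    by (rule Bochner_Integration.integrable_bound[OF gauss_real(1)]) (auto simp: norm_mult cis_conv_exp less_imp_le[OF gauss_pos])
  have ci: "cis (\<Sum>b\<in>I. h b) = (\<Prod>b\<in>I. cis (h b))" if "finite I" for I :: "'a set" and h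
    using that by (simp add: cis_conv_exp sum_distrib_left exp_sum)
  have e: "cis (2 * pi * (?T f \<bullet> \<xi>)) = (\<Prod>b\<in>Basis. cis (2 * pi * (f b * (\<xi> \<bullet> b))))" for f
    by (subst ci[symmetric]) (simp_all add: inner_sum_left inner_commute[of \<xi>] sum_distrib_left)
  have "(\<integral>x. cis (2 * pi * (x \<bullet> \<xi>)) * complex_of_real (gauss x) \<partial>lborel)
      = (\<integral>x. cis (2 * pi * (x \<bullet> \<xi>)) * complex_of_real (gauss x) \<partial>(distr ?P borel ?T))"
    using lborel_eq[where 'a='a] by metis
  also have "\<dots> = (\<integral>f. cis (2 * pi * (?T f \<bullet> \<xi>)) * complex_of_real (gauss (?T f)) \<partial>?P)"
    by (subst integral_distr) (auto simp: cis_conv_exp)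
  also have "\<dots> = (\<integral>f. (\<Prod>b\<in>Basis. cis (2 * pi * (f b * (\<xi> \<bullet> b))) * complex_of_real (gauss (f b))) \<partial>?P)"
    by (simp add: e g prod.distrib)
  also have "\<dots> = (\<Prod>b\<in>Basis. complex_of_real (gauss (\<xi> \<bullet> b)))"
    by (subst P.product_integral_prod) (simp_all add: gr gauss_real(2))
  also have "\<dots> = complex_of_real (gauss \<xi>)" by (subst (2) gauss_prod) simp
  finally show "(\<integral>x. cis (2 * pi * (x \<bullet> \<xi>)) * complex_of_real (gauss x) \<partial>lborel) = complex_of_real (gauss \<xi>)" .
qed

lemma gauss_integral: "(\<integral>x. gauss x \<partial>(lborel :: 'a::euclidean_space measure)) = 1"
proof -
  have "complex_of_real (\<integral>x. gauss x \<partial>(lborel :: 'a measure)) = complex_of_real (gauss (0::'a))"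
    using gauss_fourier[of "0::'a"] by simp
  then show ?thesis by (simp only: of_real_eq_iff) (simp add: gauss_def)
qed

lemma lborel_integral_affine:
  fixes f :: "'a::euclidean_space \<Rightarrow> complex"
  assumes [measurable]: "f \<in> borel_measurable borel" and c: "c \<noteq> 0"
  shows "(\<integral>x. f x \<partial>lborel) = \<bar>c\<bar> ^ DIM('a) *\<^sub>R (\<integral>x. f (t + c *\<^sub>R x) \<partial>lborel)"
proof -
  have "(\<integral>x. f x \<partial>lborel) = (\<integral>x. f x \<partial>(density (distr lborel borel (\<lambda>x. t + c *\<^sub>R x)) (\<lambda>_. ennreal (\<bar>c\<bar>^DIM('a)))))"
    using lborel_affine[of c t] c by simp
  also have "\<dots> = (\<integral>x. \<bar>c\<bar>^DIM('a) *\<^sub>R f x \<partial>(distr lborel borel (\<lambda>x. t + c *\<^sub>R x)))"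
    by (subst integral_density) auto
  also have "\<dots> = (\<integral>x. \<bar>c\<bar>^DIM('a) *\<^sub>R f (t + c *\<^sub>R x) \<partial>lborel)"
    using c by (subst integral_distr) auto
  finally show ?thesis by simp
qed

lemma lborel_integrable_affine:
  fixes f :: "'a::euclidean_space \<Rightarrow> 'b::{banach, second_countable_topology}"
  assumes f: "integrable lborel f" and c: "c > 0"
  shows "integrable lborel (\<lambda>x. f (t + c *\<^sub>R x))"
proof -
  have [measurable]: "f \<in> borel_measurable borel" using f by auto
  have "integrable (density (distr lborel borel (\<lambda>x. t + c *\<^sub>R x)) (\<lambda>_. ennreal (\<bar>c\<bar>^DIM('a)))) f"
    using lborel_affine[of c t] f c by simp
  then have "integrable (distr lborel borel (\<lambda>x. t + c *\<^sub>R x)) (\<lambda>x. \<bar>c\<bar>^DIM('a) *\<^sub>R f x)"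
    by (subst (asm) integrable_density) auto
  then have "integrable lborel (\<lambda>x. \<bar>c\<bar>^DIM('a) *\<^sub>R f (t + c *\<^sub>R x))"
    by (subst (asm) integrable_distr_eq) auto
  then have "integrable lborel (\<lambda>x. (1 / \<bar>c\<bar>^DIM('a)) *\<^sub>R (\<bar>c\<bar>^DIM('a) *\<^sub>R f (t + c *\<^sub>R x)))"
    by (rule integrable_scaleR_right)
  then show ?thesis using c by simp
qed

text \<open>A wide Gaussian in \<open>a\<close> becomes a Gaussian of width \<delta> and mass 1 in
  \<open>z\<close>: the approximate identity of the Fubini argument below.\<close>

lemma gauss_kernel:
  fixes z :: "'a::euclidean_space"
  assumes d: "\<delta> > 0"
  shows "(\<integral>a. cis (2 * pi * (a \<bullet> z)) * complex_of_real (gauss (\<delta> *\<^sub>R a)) \<partial>lborel)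
    = complex_of_real (gauss (z /\<^sub>R \<delta>) / \<delta> ^ DIM('a))"
proof -
  have "complex_of_real (gauss (z /\<^sub>R \<delta>)) = (\<integral>x. cis (2 * pi * (x \<bullet> (z /\<^sub>R \<delta>))) * complex_of_real (gauss x) \<partial>lborel)"
    by (rule gauss_fourier[symmetric])
  also have "\<dots> = \<bar>\<delta>\<bar> ^ DIM('a) *\<^sub>R (\<integral>a. cis (2 * pi * ((0 + \<delta> *\<^sub>R a) \<bullet> (z /\<^sub>R \<delta>))) * complex_of_real (gauss (0 + \<delta> *\<^sub>R a)) \<partial>lborel)"
    by (rule lborel_integral_affine) (use d in \<open>auto simp: cis_conv_exp\<close>)
  finally show ?thesis using d by (simp add: field_simps scaleR_conv_of_real)
qed

lemma
  fixes f :: "'x \<Rightarrow> complex" and g :: "'y \<Rightarrow> complex"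
  assumes M: "sigma_finite_measure M1" "sigma_finite_measure M2"
    and f: "integrable M1 f" and g: "integrable M2 g"
  shows integrable_pair_mult: "integrable (M1 \<Otimes>\<^sub>M M2) (\<lambda>(x,y). f x * g y)"
    and integral_pair_mult: "(\<integral>(x,y). f x * g y \<partial>(M1 \<Otimes>\<^sub>M M2)) = (\<integral>x. f x \<partial>M1) * (\<integral>y. g y \<partial>M2)"
proof -
  interpret pair_sigma_finite M1 M2 using M by (simp add: pair_sigma_finite_def)
  have [measurable]: "f \<in> borel_measurable M1" "g \<in> borel_measurable M2" using f g by auto
  show i: "integrable (M1 \<Otimes>\<^sub>M M2) (\<lambda>(x,y). f x * g y)"
    by (rule Fubini_integrable) (use f g in \<open>auto simp: norm_mult\<close>)
  show "(\<integral>(x,y). f x * g y \<partial>(M1 \<Otimes>\<^sub>M M2)) = (\<integral>x. f x \<partial>M1) * (\<integral>y. g y \<partial>M2)"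
    using integral_fst'[OF i] by simp
qed

lemma gauss_scale_tendsto: "(\<lambda>j. gauss ((1 / real (Suc j)) *\<^sub>R a)) \<longlonglongrightarrow> 1"
proof -
  have "(\<lambda>j. exp (- pi * (1 / real (Suc j) * norm a)\<^sup>2)) \<longlonglongrightarrow> exp (- pi * (0 * norm a)\<^sup>2)"
    by (intro tendsto_intros LIMSEQ_Suc lim_const_over_n)
  then show ?thesis by (simp add: gauss_def)
qed

text \<open>With the scale placed inside \<open>H\<close>, the majorant \<open>B * gauss u\<close>
  is the same for all \<open>j\<close>. Continuity is asked at the single point \<open>p\<close>
  because the symbols inserted later may jump on the axes.\<close>

lemma gauss_approximate_identity:
  fixes H :: "'a::euclidean_space \<Rightarrow> complex"
  assumes [measurable]: "H \<in> borel_measurable borel" and B: "\<And>z. norm (H z) \<le> B" and c: "isCont H p"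
  shows "(\<lambda>j. \<integral>u. H (p + (1 / real (Suc j)) *\<^sub>R u) * complex_of_real (gauss u) \<partial>lborel) \<longlonglongrightarrow> H p"
proof -
  have "(\<lambda>j. \<integral>u. H (p + (1 / real (Suc j)) *\<^sub>R u) * complex_of_real (gauss u) \<partial>lborel)
      \<longlonglongrightarrow> (\<integral>u. H p * complex_of_real (gauss u) \<partial>(lborel :: 'a measure))"
  proof (rule integral_dominated_convergence[where w="\<lambda>u. B * gauss u"])
    show "AE u in lborel. (\<lambda>j. H (p + (1 / real (Suc j)) *\<^sub>R u) * complex_of_real (gauss u)) \<longlonglongrightarrow> H p * complex_of_real (gauss u)"
    proof (rule AE_I2)
      fix u
      have "(\<lambda>j. p + (1 / real (Suc j)) *\<^sub>R u) \<longlonglongrightarrow> p + 0 *\<^sub>R u"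
        by (intro tendsto_intros LIMSEQ_Suc lim_const_over_n)
      then have "(\<lambda>j. H (p + (1 / real (Suc j)) *\<^sub>R u)) \<longlonglongrightarrow> H p"
        using isCont_tendsto_compose[OF c] by simp
      then show "(\<lambda>j. H (p + (1 / real (Suc j)) *\<^sub>R u) * complex_of_real (gauss u)) \<longlonglongrightarrow> H p * complex_of_real (gauss u)"
        by (rule tendsto_mult_right)
    qed
    show "integrable lborel (\<lambda>u::'a. B * gauss u)" by (intro integrable_mult_right gauss_integrable)
    show "AE u in lborel. norm (H (p + (1 / real (Suc j)) *\<^sub>R u) * complex_of_real (gauss u)) \<le> B * gauss u" for j
      using B by (intro AE_I2) (auto simp: norm_mult intro!: mult_right_mono)
  qed measurable
  also have "(\<integral>u. H p * complex_of_real (gauss u) \<partial>(lborel :: 'a measure)) = H p * complex_of_real (\<integral>u. gauss u \<partial>(lborel :: 'a measure))"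
    by simp
  finally show ?thesis by (simp add: gauss_integral)
qed

text \<open>A Gaussian factor in \<open>a\<close> makes Fubini applicable. As it widens to the constant 1, its Fourier
  transform becomes an approximate identity acting on \<open>H\<close>.\<close>

lemma integral_characters_mult:
  fixes M :: "'x measure" and p :: "'x \<Rightarrow> 'a::euclidean_space" and w :: "'x \<Rightarrow> complex" and H :: "'a \<Rightarrow> complex"
  defines "\<psi> \<equiv> \<lambda>a. \<integral>x. w x * cis (- 2 * pi * (a \<bullet> p x)) \<partial>M"
    and "\<kappa> \<equiv> \<lambda>a. \<integral>z. H z * cis (2 * pi * (a \<bullet> z)) \<partial>lborel"
  assumes M: "sigma_finite_measure M" and w: "integrable M w" and p[measurable]: "p \<in> borel_measurable M"
    and H: "integrable lborel H" and B: "\<And>z. norm (H z) \<le> B"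
    and cont: "AE x in M. isCont H (p x)"
    and int: "integrable lborel (\<lambda>a. \<psi> a * \<kappa> a)"
  shows "(\<integral>a. \<psi> a * \<kappa> a \<partial>lborel) = (\<integral>x. w x * H (p x) \<partial>M)"
proof -
  define J where "J j = (\<integral>a. \<psi> a * \<kappa> a * complex_of_real (gauss ((1 / real (Suc j)) *\<^sub>R a)) \<partial>lborel)" for j
  have Hm[measurable]: "H \<in> borel_measurable borel" and wm[measurable]: "w \<in> borel_measurable M" using H w by auto
  have lim1: "J \<longlonglongrightarrow> (\<integral>a. \<psi> a * \<kappa> a \<partial>lborel)"
    unfolding J_def
  proof (rule integral_dominated_convergence[where w="\<lambda>a. norm (\<psi> a * \<kappa> a)"])
    have [measurable]: "(\<lambda>a. \<psi> a * \<kappa> a) \<in> borel_measurable borel" using int by auto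
    show "(\<lambda>a. \<psi> a * \<kappa> a) \<in> borel_measurable lborel" by simp
    show "(\<lambda>a. \<psi> a * \<kappa> a * complex_of_real (gauss ((1 / real (Suc j)) *\<^sub>R a))) \<in> borel_measurable lborel" for j
      by measurable
    show "AE a in lborel. (\<lambda>j. \<psi> a * \<kappa> a * complex_of_real (gauss ((1 / real (Suc j)) *\<^sub>R a))) \<longlonglongrightarrow> \<psi> a * \<kappa> a"
    proof (rule AE_I2)
      fix a
      have "(\<lambda>j. \<psi> a * \<kappa> a * complex_of_real (gauss ((1 / real (Suc j)) *\<^sub>R a))) \<longlonglongrightarrow> \<psi> a * \<kappa> a * complex_of_real 1"
        by (intro tendsto_mult_left tendsto_of_real gauss_scale_tendsto)
      then show "(\<lambda>j. \<psi> a * \<kappa> a * complex_of_real (gauss ((1 / real (Suc j)) *\<^sub>R a))) \<longlonglongrightarrow> \<psi> a * \<kappa> a" by simp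
    qed
    show "AE a in lborel. norm (\<psi> a * \<kappa> a * complex_of_real (gauss ((1 / real (Suc j)) *\<^sub>R a))) \<le> norm (\<psi> a * \<kappa> a)" for j
    proof (rule AE_I2)
      fix a :: 'a
      have "norm (\<psi> a * \<kappa> a) * gauss ((1 / real (Suc j)) *\<^sub>R a) \<le> norm (\<psi> a * \<kappa> a) * 1"
        by (intro mult_left_mono gauss_le_1) simp
      then show "norm (\<psi> a * \<kappa> a * complex_of_real (gauss ((1 / real (Suc j)) *\<^sub>R a))) \<le> norm (\<psi> a * \<kappa> a)"
        using gauss_pos[of "(1 / real (Suc j)) *\<^sub>R a"] by (simp add: norm_mult)
    qed
  qed (use int in simp)
  \<comment> \<open>With the Gaussian factor present, \<open>a\<close> can be integrated out first;
    \<open>gauss_kernel\<close> then leaves a Gaussian centred at \<open>p x\<close>, and z = p x +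
    d u brings it to the form of \<open>gauss_approximate_identity\<close>.\<close>
  have J: "J j = (\<integral>x. w x * (\<integral>u. H (p x + (1 / real (Suc j)) *\<^sub>R u) * complex_of_real (gauss u) \<partial>lborel) \<partial>M)" for j
  proof -
    define d where "d = 1 / real (Suc j)"
    have d: "d > 0" by (simp add: d_def)
    interpret Q: pair_sigma_finite M "lborel :: 'a measure"
      using M sigma_finite_lborel by (simp add: pair_sigma_finite_def)
    have sQ: "sigma_finite_measure (M \<Otimes>\<^sub>M (lborel :: 'a measure))" by (rule Q.P.sigma_finite_measure_axioms)
    interpret R: pair_sigma_finite "lborel :: 'a measure" "M \<Otimes>\<^sub>M (lborel :: 'a measure)"
      using sQ sigma_finite_lborel by (simp add: pair_sigma_finite_def)
    let ?e = "\<lambda>a x z. cis (2 * pi * (a \<bullet> (z - p x)))"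
    let ?g = "\<lambda>a. complex_of_real (gauss (d *\<^sub>R a))"
    have wc: "integrable M (\<lambda>x. w x * cis (- 2 * pi * (a \<bullet> p x)))" for a
      by (rule Bochner_Integration.integrable_bound[OF w]) (auto simp: norm_mult cis_conv_exp)
    have Hc: "integrable lborel (\<lambda>z. H z * cis (2 * pi * (a \<bullet> z)))" for a
      by (rule Bochner_Integration.integrable_bound[OF H]) (auto simp: norm_mult cis_conv_exp)
    have 1: "\<psi> a * \<kappa> a = (\<integral>(x,z). w x * H z * ?e a x z \<partial>(M \<Otimes>\<^sub>M lborel))" for a
    proof -
      have "\<psi> a * \<kappa> a = (\<integral>(x,z). (w x * cis (- 2 * pi * (a \<bullet> p x))) * (H z * cis (2 * pi * (a \<bullet> z))) \<partial>(M \<Otimes>\<^sub>M lborel))"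
        unfolding \<psi>_def \<kappa>_def
        by (rule integral_pair_mult[OF M sigma_finite_lborel wc Hc, symmetric])
      also have "\<dots> = (\<integral>(x,z). w x * H z * ?e a x z \<partial>(M \<Otimes>\<^sub>M lborel))"
      proof -
        have "?e a x z = cis (- 2 * pi * (a \<bullet> p x)) * cis (2 * pi * (a \<bullet> z))" for x z
          by (simp add: cis_mult inner_diff_right algebra_simps)
        then show ?thesis by (simp add: mult_ac)
      qed
      finally show ?thesis .
    qed
    have gi: "integrable lborel ?g"
      using integrable_of_real[OF lborel_integrable_affine[OF gauss_integrable d, of 0]] by simp
    have "integrable (lborel \<Otimes>\<^sub>M (M \<Otimes>\<^sub>M lborel)) (\<lambda>(a, q). ?g a * (case q of (x, z) \<Rightarrow> w x * H z))"
      by (rule integrable_pair_mult[OF sigma_finite_lborel sQ gi integrable_pair_mult[OF M sigma_finite_lborel w H]])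
    then have Fi: "integrable (lborel \<Otimes>\<^sub>M (M \<Otimes>\<^sub>M lborel)) (\<lambda>(a, q). (case q of (x, z) \<Rightarrow> w x * H z * ?e a x z * ?g a))"
      by (rule Bochner_Integration.integrable_bound) (auto simp: norm_mult cis_conv_exp split: prod.splits)
    have "J j = (\<integral>a. (\<integral>q. (case q of (x, z) \<Rightarrow> w x * H z * ?e a x z * ?g a) \<partial>(M \<Otimes>\<^sub>M lborel)) \<partial>lborel)"
      unfolding J_def 1 d_def[symmetric]
      by (simp only: case_prod_unfold integral_mult_left_zero)
    also have "\<dots> = (\<integral>q. (\<integral>a. (case q of (x, z) \<Rightarrow> w x * H z * ?e a x z * ?g a) \<partial>lborel) \<partial>(M \<Otimes>\<^sub>M lborel))"
      by (rule R.Fubini_integral[OF Fi, symmetric])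
    also have eq: "(\<lambda>q. \<integral>a. (case q of (x, z) \<Rightarrow> w x * H z * ?e a x z * ?g a) \<partial>lborel) =
        (\<lambda>(x, z). w x * (H z * complex_of_real (gauss ((z - p x) /\<^sub>R d) / d ^ DIM('a))))"
      by (auto simp: fun_eq_iff mult.assoc gauss_kernel[OF d, unfolded mult.assoc])
    also have "(\<integral>q. (case q of (x, z) \<Rightarrow> w x * (H z * complex_of_real (gauss ((z - p x) /\<^sub>R d) / d ^ DIM('a)))) \<partial>(M \<Otimes>\<^sub>M lborel))
       = (\<integral>x. \<integral>z. w x * (H z * complex_of_real (gauss ((z - p x) /\<^sub>R d) / d ^ DIM('a))) \<partial>lborel \<partial>M)"
      using Q.integral_fst'[OF R.integrable_snd[OF Fi, unfolded eq]] by simp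
    also have "\<dots> = (\<integral>x. w x * (\<integral>u. H (p x + d *\<^sub>R u) * complex_of_real (gauss u) \<partial>lborel) \<partial>M)"
    proof (rule Bochner_Integration.integral_cong[OF refl])
      fix x
      have "(\<integral>z. H z * complex_of_real (gauss ((z - p x) /\<^sub>R d) / d ^ DIM('a)) \<partial>lborel)
        = \<bar>d\<bar> ^ DIM('a) *\<^sub>R (\<integral>u. H (p x + d *\<^sub>R u) * complex_of_real (gauss ((p x + d *\<^sub>R u - p x) /\<^sub>R d) / d ^ DIM('a)) \<partial>lborel)"
        by (rule lborel_integral_affine) (use d in auto)
      also have "\<dots> = (\<integral>u. H (p x + d *\<^sub>R u) * complex_of_real (gauss u) \<partial>lborel)"
        using d by (subst integral_scaleR_right[symmetric]) (simp add: scaleR_conv_of_real)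
      finally show "(\<integral>z. w x * (H z * complex_of_real (gauss ((z - p x) /\<^sub>R d) / d ^ DIM('a))) \<partial>lborel) = w x * (\<integral>u. H (p x + d *\<^sub>R u) * complex_of_real (gauss u) \<partial>lborel)"
        by (simp only: integral_mult_right_zero)
    qed
    finally show ?thesis unfolding d_def .
  qed
  have "(\<lambda>j. \<integral>x. w x * (\<integral>u. H (p x + (1 / real (Suc j)) *\<^sub>R u) * complex_of_real (gauss u) \<partial>lborel) \<partial>M)
      \<longlonglongrightarrow> (\<integral>x. w x * H (p x) \<partial>M)"
  proof (rule integral_dominated_convergence[where w="\<lambda>x. norm (w x) * B"])
    show "(\<lambda>x. w x * H (p x)) \<in> borel_measurable M" by measurable
    show "(\<lambda>x. w x * (\<integral>u. H (p x + (1 / real (Suc j)) *\<^sub>R u) * complex_of_real (gauss u) \<partial>lborel)) \<in> borel_measurable M" for j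
      by measurable
    show "integrable M (\<lambda>x. norm (w x) * B)" using w by simp
    show "AE x in M. (\<lambda>j. w x * (\<integral>u. H (p x + (1 / real (Suc j)) *\<^sub>R u) * complex_of_real (gauss u) \<partial>lborel)) \<longlonglongrightarrow> w x * H (p x)"
      using cont
    proof eventually_elim
      case (elim x)
      show ?case by (intro tendsto_mult_left gauss_approximate_identity[OF Hm B elim])
    qed
    show "AE x in M. norm (w x * (\<integral>u. H (p x + (1 / real (Suc j)) *\<^sub>R u) * complex_of_real (gauss u) \<partial>lborel)) \<le> norm (w x) * B" for j
    proof (rule AE_I2)
      fix x
      have "norm (\<integral>u. H (p x + (1 / real (Suc j)) *\<^sub>R u) * complex_of_real (gauss u) \<partial>lborel) \<le> (\<integral>u. B * gauss u \<partial>(lborel :: 'a measure))"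
      proof (rule Bochner_Integration.integral_norm_bound_integral)
        show "integrable lborel (\<lambda>u::'a. B * gauss u)" by (intro integrable_mult_right gauss_integrable)
        then show "integrable lborel (\<lambda>u. H (p x + (1 / real (Suc j)) *\<^sub>R u) * complex_of_real (gauss u))"
          by (rule Bochner_Integration.integrable_bound)
             (measurable, use B in \<open>auto simp: norm_mult abs_mult intro!: AE_I2 mult_right_mono intro: order_trans[OF _ abs_ge_self]\<close>)
        show "norm (H (p x + (1 / real (Suc j)) *\<^sub>R u) * complex_of_real (gauss u)) \<le> B * gauss u" for u
          using B by (auto simp: norm_mult intro!: mult_right_mono)
      qed
      then show "norm (w x * (\<integral>u. H (p x + (1 / real (Suc j)) *\<^sub>R u) * complex_of_real (gauss u) \<partial>lborel)) \<le> norm (w x) * B"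
        by (simp add: norm_mult gauss_integral mult_left_mono)
    qed
  qed
  then have "J \<longlonglongrightarrow> (\<integral>x. w x * H (p x) \<partial>M)" by (simp only: J[symmetric])
  with lim1 show ?thesis by (rule LIMSEQ_unique)
qed

text \<open>\<open>integral_characters_mult\<close> for a point mass: with weight 1 at frequency
  \<open>x\<close>, one factor is a single character, the other is the transform of \<open>f\<close>
  at \<open>- a\<close>, and the right-hand side is a point value of \<open>f\<close>.\<close>

theorem fourier_inversion:
  fixes f :: "'a::euclidean_space \<Rightarrow> complex"
  assumes f: "schwartz f"
  shows "(\<integral>\<xi>. fourier f \<xi> * cis (2 * pi * (x \<bullet> \<xi>)) \<partial>lborel) = f x"
proof -
  let ?M = "count_space (UNIV :: unit set)"
  obtain B where B: "\<And>x. (1 + norm x) ^ 0 * norm (f x) \<le> B"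
    using rapidly_decreasingD[OF schwartz_rapidly_decreasing[OF f]] by blast
  have fm: "fourier f \<in> borel_measurable borel"
    by (intro fourier_borel_measurable schwartz_borel_measurable f)
  have neg: "(\<integral>\<xi>. g \<xi> \<partial>lborel) = (\<integral>\<xi>. g (- \<xi>) \<partial>lborel)"
    if "g \<in> borel_measurable borel" for g :: "'a \<Rightarrow> complex"
    using lborel_integral_affine[OF that, of "-1" 0] by simp
  have fi: "(\<integral>y. f y * cis (2 * pi * (a \<bullet> y)) \<partial>lborel) = fourier f (- a)" for a
    by (simp add: fourier_def mult.commute inner_commute)
  have i: "integrable lborel (\<lambda>a. cis (- (2 * pi * (a \<bullet> x))) * fourier f (- a))"
  proof (rule Bochner_Integration.integrable_bound)
    have "integrable lborel (\<lambda>a. norm (fourier f (- a)))"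
      using rapidly_decreasing_integrable[of "\<lambda>a. fourier f (- a)" 0] rapidly_decreasing_fourier[OF f] fm
      by (auto simp: rapidly_decreasing_def) (metis norm_minus_cancel)
    then show "integrable lborel (\<lambda>a. norm (fourier f (- a)))" .
    show "(\<lambda>a. cis (- (2 * pi * (a \<bullet> x))) * fourier f (- a)) \<in> borel_measurable lborel"
      using fm by (simp add: cis_conv_exp)
  qed (auto simp: norm_mult)
  have "(\<integral>a. (\<integral>u. 1 * cis (- 2 * pi * (a \<bullet> x)) \<partial>?M) * (\<integral>y. f y * cis (2 * pi * (a \<bullet> y)) \<partial>lborel) \<partial>lborel)
      = (\<integral>u. 1 * f x \<partial>?M)"
  proof (rule integral_characters_mult)
    show "sigma_finite_measure ?M" by (simp add: sigma_finite_measure_count_space)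
    show "integrable ?M (\<lambda>u. 1 :: complex)" by (simp add: integrable_count_space)
    show "integrable lborel f" by (rule schwartz_integrable[OF f])
    show "norm (f z) \<le> B" for z using B[of z] by simp
    show "AE u in ?M. isCont f x"
      using schwartz_continuous_on[OF f] by (simp add: continuous_on_eq_continuous_at)
    show "integrable lborel (\<lambda>a. (\<integral>u. 1 * cis (- 2 * pi * (a \<bullet> x)) \<partial>?M) * (\<integral>y. f y * cis (2 * pi * (a \<bullet> y)) \<partial>lborel))"
      unfolding fi using i by (simp add: lebesgue_integral_count_space_finite)
  qed auto
  then have "f x = (\<integral>a. cis (- (2 * pi * (a \<bullet> x))) * fourier f (- a) \<partial>lborel)"
    unfolding fi by (simp add: lebesgue_integral_count_space_finite)
  also have "\<dots> = (\<integral>\<xi>. fourier f \<xi> * cis (2 * pi * (x \<bullet> \<xi>)) \<partial>lborel)"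
    by (subst (2) neg) (use fm in \<open>auto simp: cis_conv_exp mult.commute inner_commute\<close>)
  finally show ?thesis by simp
qed

section \<open>Convolutions and tempered distributions\<close>

lemma schwartz_derivative_bound:
  fixes f :: "'a::euclidean_space \<Rightarrow> complex"
  assumes f: "schwartz f"
  obtains C where "C > 0" "\<And>x v. norm (frechet_derivative f (at x) v) \<le> C / (1 + norm x) ^ k * norm v"
proof -
  have "\<forall>b\<in>Basis. \<exists>C>0. \<forall>x. norm (dpartial b f x) \<le> C / (1 + norm x) ^ k"
  proof
    fix b :: 'a assume "b \<in> Basis"
    then obtain C where "C > 0" "\<And>x. norm (dpartial b f x) \<le> C / (1 + norm x) ^ k"
      using rapidly_decreasing_le[OF schwartz_rapidly_decreasing[OF schwartz_dpartial[OF f]], of b k] by blast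
    then show "\<exists>C>0. \<forall>x. norm (dpartial b f x) \<le> C / (1 + norm x) ^ k" by blast
  qed
  then obtain C where C: "\<And>b. b \<in> Basis \<Longrightarrow> C b > 0"
    "\<And>b x. b \<in> Basis \<Longrightarrow> norm (dpartial b f x) \<le> C b / (1 + norm x) ^ k" by metis
  have "norm (frechet_derivative f (at x) v) \<le> (\<Sum>b\<in>Basis. C b) / (1 + norm x) ^ k * norm v" for x v
  proof -
    have "frechet_derivative f (at x) v = (\<Sum>b\<in>Basis. (v \<bullet> b) *\<^sub>R dpartial b f x)"
      using fun_cong[OF frechet_derivative_at[OF schwartz_has_derivative[OF f, of x]], of v] by simp
    also have "norm \<dots> \<le> (\<Sum>b\<in>Basis. norm v * (C b / (1 + norm x) ^ k))"
    proof (rule order_trans[OF norm_sum sum_mono])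
      fix b :: 'a assume b: "b \<in> Basis"
      show "norm ((v \<bullet> b) *\<^sub>R dpartial b f x) \<le> norm v * (C b / (1 + norm x) ^ k)"
        unfolding norm_scaleR by (intro mult_mono C(2) b) (auto simp: Basis_le_norm[OF b])
    qed
    also have "\<dots> = (\<Sum>b\<in>Basis. C b) / (1 + norm x) ^ k * norm v"
      by (simp add: sum_distrib_left sum_divide_distrib mult.commute flip: sum_distrib_right)
    finally show ?thesis .
  qed
  moreover have "(\<Sum>b\<in>Basis. C b) > 0" using C(1) by (intro sum_pos) auto
  ultimately show ?thesis using that by blast
qed

text \<open>The mean value inequality on the segment from \<open>x - a - h\<close> to
  \<open>x - a\<close>, with the decay transferred from the intermediate point to \<open>x\<close>
  by Peetre's inequality. The estimate is uniform in \<open>x\<close>, small with \<open>h\<close>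
  and polynomial in \<open>a\<close>, so it can be integrated against a Schwartz function of
  \<open>a\<close>; it controls translations, the discretized convolution and the
  mollification.\<close>

lemma schwartz_difference_bound:
  fixes f :: "'a::euclidean_space \<Rightarrow> complex"
  assumes f: "schwartz f"
  obtains C where "C > 0" "\<And>x a h. (1 + norm x) ^ k * norm (f (x - a - h) - f (x - a))
     \<le> C * norm h * ((1 + norm a) * (1 + norm h)) ^ k"
proof -
  obtain C where C: "C > 0" "\<And>x v. norm (frechet_derivative f (at x) v) \<le> C / (1 + norm x) ^ k * norm v"
    using schwartz_derivative_bound[OF f] by blast
  have "(1 + norm x) ^ k * norm (f (x - a - h) - f (x - a))
     \<le> C * norm h * ((1 + norm a) * (1 + norm h)) ^ k" for x a h
  proof -
    let ?p = "((1 + norm a) * (1 + norm h)) ^ k" and ?x = "(1 + norm x) ^ k"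
    have x: "0 < ?x" by (simp add: add_pos_nonneg)
    have "norm (f (x - a - h) - f (x - a)) \<le> C * ?p / ?x * norm ((x - a - h) - (x - a))"
    proof (rule differentiable_bound[of "closed_segment (x - a - h) (x - a)" f "\<lambda>z. frechet_derivative f (at z)"])
      show "(f has_derivative frechet_derivative f (at z)) (at z within closed_segment (x - a - h) (x - a))" for z
        using schwartz_differentiable[OF f] frechet_derivative_works has_derivative_at_withinI by blast
      fix z assume "z \<in> closed_segment (x - a - h) (x - a)"
      then obtain t where t: "0 \<le> t" "t \<le> 1" "z = (1 - t) *\<^sub>R (x - a - h) + t *\<^sub>R (x - a)"
        by (auto simp: closed_segment_def)
      have xz: "x = z + (a + (1 - t) *\<^sub>R h)" using t(3) by (simp add: algebra_simps)
      have "1 + norm x \<le> (1 + norm z) * (1 + norm (a + (1 - t) *\<^sub>R h))"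
      proof -
        define w where "w = a + (1 - t) *\<^sub>R h"
        have "x - w = z" using xz by (simp add: w_def)
        then show ?thesis using one_plus_norm_le[of x "- w"] by (simp only: w_def[symmetric] norm_minus_cancel diff_conv_add_uminus[symmetric])
      qed
      also have "\<dots> \<le> (1 + norm z) * ((1 + norm a) * (1 + norm h))"
      proof (rule mult_left_mono)
        have "norm (a + (1 - t) *\<^sub>R h) \<le> norm a + (1 - t) * norm h"
          using norm_triangle_ineq[of a "(1 - t) *\<^sub>R h"] t by simp
        also have "\<dots> \<le> norm a + norm h" using t mult_right_mono[of "1 - t" 1 "norm h"] by simp
        finally have "norm (a + (1 - t) *\<^sub>R h) \<le> norm a + norm h" .
        moreover have "(1 + norm a) * (1 + norm h) = 1 + norm a + norm h + norm a * norm h"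
          by (simp add: algebra_simps)
        moreover have "0 \<le> norm a * norm h" by simp
        ultimately show "1 + norm (a + (1 - t) *\<^sub>R h) \<le> (1 + norm a) * (1 + norm h)" by linarith
      qed simp
      finally have "?x \<le> ((1 + norm z) * ((1 + norm a) * (1 + norm h))) ^ k"
        by (intro power_mono) auto
      then have zx: "?x \<le> (1 + norm z) ^ k * ?p" by (simp add: power_mult_distrib)
      have zp: "0 < (1 + norm z) ^ k" by (simp add: add_pos_nonneg)
      have "C / (1 + norm z) ^ k \<le> C * ?p / ?x"
        using mult_left_mono[OF zx, of C] C(1) x zp by (simp add: field_simps)
      then have "norm (frechet_derivative f (at z) v) \<le> C * ?p / ?x * norm v" for v
        using C(2)[of z v] mult_right_mono[of "C / (1 + norm z) ^ k" "C * ?p / ?x" "norm v"] by auto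
      then show "onorm (frechet_derivative f (at z)) \<le> C * ?p / ?x" by (rule onorm_le)
    qed auto
    then show ?thesis using x by (simp add: pos_le_divide_eq mult_ac)
  qed
  then show ?thesis using C(1) that by blast
qed

section \<open>Convolution of Schwartz functions\<close>

definition conv :: "('a::euclidean_space \<Rightarrow> complex) \<Rightarrow> ('a \<Rightarrow> complex) \<Rightarrow> 'a \<Rightarrow> complex" where
  "conv f g x = (\<integral>a. f a * g (x - a) \<partial>lborel)"

lemma schwartz_mult_translate_integrable:
  fixes f g :: "'a::euclidean_space \<Rightarrow> complex"
  assumes f: "integrable lborel f" and g: "schwartz g"
  shows "integrable lborel (\<lambda>a. f a * g (x - a))"
proof -
  have [measurable]: "f \<in> borel_measurable borel" "g \<in> borel_measurable borel" using f g by auto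
  obtain C where C: "C > 0" "\<And>x. norm (g x) \<le> C / (1 + norm x) ^ 0"
    using rapidly_decreasing_le[OF schwartz_rapidly_decreasing[OF g]] by blast
  have "integrable lborel (\<lambda>a. C *\<^sub>R f a)" using f by simp
  then show ?thesis
    by (rule Bochner_Integration.integrable_bound)
       (use C in \<open>auto simp: norm_mult mult.commute[of C] intro!: AE_I2 mult_left_mono\<close>)
qed

text \<open>The first factor is fixed and all derivatives fall on the second, so the convolutions of
  \<open>f\<close> with arbitrary Schwartz functions form a class to which
  \<open>schwartz_coinduct\<close> applies. Decay follows by splitting the weight in
  \<open>x\<close> between \<open>a\<close> and \<open>x - a\<close>.\<close>

lemma
  fixes f g :: "'a::euclidean_space \<Rightarrow> complex"
  assumes f: "schwartz f" and g: "schwartz g"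
  shows schwartz_conv: "schwartz (conv f g)"
    and partials_conv: "bs \<in> lists Basis \<Longrightarrow> partials bs (conv f g) = conv f (partials bs g)"
proof -
  have fi: "integrable lborel f" and [measurable]: "f \<in> borel_measurable borel"
    using f by (auto intro: schwartz_integrable)
  have D: "(conv f g has_derivative (\<lambda>v. \<integral>a. f a * frechet_derivative g (at (x - a)) v \<partial>lborel)) (at x)"
    if g: "schwartz g" for g :: "'a \<Rightarrow> complex" and x
  proof -
    obtain C where C: "C > 0" "\<And>x v. norm (frechet_derivative g (at x) v) \<le> C / (1 + norm x) ^ 0 * norm v"
      using schwartz_derivative_bound[OF g] by blast
    show ?thesis
      unfolding conv_def[abs_def]
    proof (rule has_derivative_integral[of UNIV _ _ _ _ "\<lambda>a. norm (f a) * C"])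
      show "integrable lborel (\<lambda>a. f a * g (x - a))" for x
        by (rule schwartz_mult_translate_integrable[OF fi g])
      show "((\<lambda>x. f a * g (x - a)) has_derivative (\<lambda>v. f a * frechet_derivative g (at (x - a)) v)) (at x)" for x a
      proof (rule has_derivative_mult_right)
        have 1: "((\<lambda>x. x - a) has_derivative (\<lambda>v. v)) (at x)" by (auto intro!: derivative_eq_intros)
        show "((\<lambda>x. g (x - a)) has_derivative frechet_derivative g (at (x - a))) (at x)"
          using has_derivative_compose[OF 1, of g] schwartz_differentiable[OF g] frechet_derivative_works by blast
      qed
      show "norm (f a * frechet_derivative g (at (x - a)) v) \<le> norm (f a) * C * norm v" for x a v
        using mult_left_mono[OF C(2)[of "x - a" v], of "norm (f a)"] by (simp add: norm_mult mult_ac)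
      show "integrable lborel (\<lambda>a. norm (f a) * C)" using fi by simp
      show "(\<lambda>a. f a * frechet_derivative g (at (x - a)) v) \<in> borel_measurable lborel" for v
      proof -
        have e: "frechet_derivative g (at z) v = (\<Sum>b\<in>Basis. (v \<bullet> b) *\<^sub>R dpartial b g z)" for z
          using fun_cong[OF frechet_derivative_at[OF schwartz_has_derivative[OF g, of z]], of v] by simp
        have "(\<lambda>z. frechet_derivative g (at z) v) \<in> borel_measurable borel"
          unfolding e by (intro borel_measurable_sum borel_measurable_scaleR borel_measurable_const schwartz_borel_measurable schwartz_dpartial g)
        from measurable_compose[OF _ this, of "\<lambda>a. x - a" borel]
        have "(\<lambda>a. frechet_derivative g (at (x - a)) v) \<in> borel_measurable borel" by measurable
        then show ?thesis by simp
      qed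
    qed auto
  qed
  let ?X = "\<lambda>h. \<exists>g. schwartz g \<and> h = conv f g"
  have dec: "rapidly_decreasing (conv f g)" if g: "schwartz g" for g
  proof (rule rapidly_decreasingI)
    fix k
    obtain C where C: "C > 0" "\<And>x y. norm (g (x + y)) \<le> C * (1 + norm y) ^ k / (1 + norm x) ^ k"
      using schwartz_translate_bound[OF g] by blast
    have "norm x ^ k * norm (conv f g x) \<le> (\<integral>a. (1 + norm a) ^ k * norm (f a) * C \<partial>lborel)" for x
    proof -
      have p: "1 + norm x \<noteq> 0" using norm_ge_zero[of x] by linarith
      have "norm x ^ k * norm (conv f g x) = norm (\<integral>a. norm x ^ k *\<^sub>R (f a * g (x - a)) \<partial>lborel)"
        by (simp add: conv_def)
      also have "\<dots> \<le> (\<integral>a. (1 + norm a) ^ k * norm (f a) * C \<partial>lborel)"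
      proof (rule Bochner_Integration.integral_norm_bound_integral)
        show "integrable lborel (\<lambda>a. norm x ^ k *\<^sub>R (f a * g (x - a)))"
          by (intro integrable_scaleR_right schwartz_mult_translate_integrable[OF fi g])
        show "integrable lborel (\<lambda>a. (1 + norm a) ^ k * norm (f a) * C)"
          by (intro integrable_mult_left schwartz_integrable_weight f)
        fix a
        have "norm (norm x ^ k *\<^sub>R (f a * g (x - a))) \<le> (1 + norm x) ^ k * (norm (f a) * (C * (1 + norm a) ^ k / (1 + norm x) ^ k))"
          unfolding norm_scaleR norm_mult
        proof (intro mult_mono)
          show "\<bar>norm x ^ k\<bar> \<le> (1 + norm x) ^ k" by (auto intro: power_mono)
          show "norm (g (x - a)) \<le> C * (1 + norm a) ^ k / (1 + norm x) ^ k" using C(2)[of x "- a"] by simp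
        qed auto
        also have "\<dots> = (1 + norm a) ^ k * norm (f a) * C" using p by simp
        finally show "norm (norm x ^ k *\<^sub>R (f a * g (x - a))) \<le> (1 + norm a) ^ k * norm (f a) * C" .
      qed
      finally show ?thesis .
    qed
    then show "\<exists>C. \<forall>x. norm x ^ k * norm (conv f g x) \<le> C" by blast
  qed
  show "schwartz (conv f g)"
  proof (rule schwartz_coinduct(1)[of ?X])
    show "?X (conv f g)" using g by blast
    show "\<exists>D. (\<forall>x. (h has_derivative D x) (at x)) \<and> (\<forall>b\<in>Basis. ?X (\<lambda>x. D x b))" if X: "?X h" for h
    proof -
      obtain g where g: "schwartz g" "h = conv f g" using X by blast
      show ?thesis unfolding g(2)
        using D[OF g(1)] schwartz_dpartial[OF g(1)]
        by (intro exI[of _ "\<lambda>x v. \<integral>a. f a * frechet_derivative g (at (x - a)) v \<partial>lborel"] conjI allI ballI)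
           (auto simp: conv_def[abs_def])
    qed
    show "rapidly_decreasing h" if X: "?X h" for h using X dec by blast
  qed
  show "bs \<in> lists Basis \<Longrightarrow> partials bs (conv f g) = conv f (partials bs g)"
  proof (induction bs)
    case (Cons b bs)
    then have "schwartz (partials bs g)" using g by (intro schwartz_partials) auto
    then have "frechet_derivative (conv f (partials bs g)) (at x) b = conv f (partials (b # bs) g) x" for x
      using fun_cong[OF frechet_derivative_at[OF D], of "partials bs g" x b]
      by (simp only: conv_def partials.simps)
    then show ?case using Cons by auto
  qed simp
qed

lemma conv_commute:
  assumes "f \<in> borel_measurable borel" "g \<in> borel_measurable borel"
  shows "conv f g = conv g f"
proof
  fix x
  have "conv f g x = (\<integral>a. f (x + - 1 *\<^sub>R a) * g (x - (x + - 1 *\<^sub>R a)) \<partial>lborel)"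
    unfolding conv_def using assms by (subst lborel_integral_affine[of _ "-1" x]) auto
  then show "conv f g x = conv g f x" by (simp add: conv_def mult.commute)
qed

lemma schwartz_tendstoI:
  assumes "\<And>j. schwartz (F j)" "schwartz f"
    and "\<And>k bs. bs \<in> lists Basis \<Longrightarrow> \<exists>e. e \<longlonglongrightarrow> 0 \<and>
      (\<forall>j x. (1 + norm x) ^ k * norm (partials bs (F j) x - partials bs f x) \<le> e j)"
  shows "schwartz_tendsto F f"
  unfolding schwartz_tendsto_def
proof (intro conjI allI ballI)
  fix k and bs :: "'a list" assume "bs \<in> lists Basis"
  then obtain e where e: "e \<longlonglongrightarrow> (0::real)"
    "\<And>j x. (1 + norm x) ^ k * norm (partials bs (F j) x - partials bs f x) \<le> e j"
    using assms(3) by blast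
  show "uniform_limit UNIV (\<lambda>j x. norm x ^ k *\<^sub>R partials bs (F j) x) (\<lambda>x. norm x ^ k *\<^sub>R partials bs f x) sequentially"
    unfolding uniform_limit_iff
  proof (intro allI impI)
    fix \<epsilon> :: real assume "\<epsilon> > 0"
    with e(1) have "\<forall>\<^sub>F j in sequentially. e j < \<epsilon>" by (rule order_tendstoD)
    then show "\<forall>\<^sub>F j in sequentially. \<forall>x\<in>UNIV. dist (norm x ^ k *\<^sub>R partials bs (F j) x) (norm x ^ k *\<^sub>R partials bs f x) < \<epsilon>"
    proof eventually_elim
      case (elim j)
      have "dist (norm x ^ k *\<^sub>R partials bs (F j) x) (norm x ^ k *\<^sub>R partials bs f x) < \<epsilon>" for x
      proof -
        have "dist (norm x ^ k *\<^sub>R partials bs (F j) x) (norm x ^ k *\<^sub>R partials bs f x)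
          = norm x ^ k * norm (partials bs (F j) x - partials bs f x)"
          by (simp add: dist_norm flip: scaleR_diff_right)
        also have "\<dots> \<le> (1 + norm x) ^ k * norm (partials bs (F j) x - partials bs f x)"
          by (intro mult_right_mono power_mono) auto
        finally show ?thesis using e(2)[of x j] elim by linarith
      qed
      then show ?case by blast
    qed
  qed
qed (use assms in auto)

lemma schwartz_translate_tendsto:
  fixes g :: "'a::euclidean_space \<Rightarrow> complex"
  assumes g: "schwartz g" and s: "s \<longlonglongrightarrow> a"
  shows "schwartz_tendsto (\<lambda>j x. g (x - s j)) (\<lambda>x. g (x - a))"
proof (rule schwartz_tendstoI)
  fix k and bs :: "'a list" assume bs: "bs \<in> lists Basis"
  obtain C where C: "C > 0" "\<And>x a h. (1 + norm x) ^ k * norm (partials bs g (x - a - h) - partials bs g (x - a))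
     \<le> C * norm h * ((1 + norm a) * (1 + norm h)) ^ k"
    using schwartz_difference_bound[OF schwartz_partials[OF g bs]] by blast
  show "\<exists>e. e \<longlonglongrightarrow> 0 \<and> (\<forall>j x. (1 + norm x) ^ k * norm (partials bs (\<lambda>x. g (x - s j)) x - partials bs (\<lambda>x. g (x - a)) x) \<le> e j)"
  proof (intro exI conjI allI)
    have "(\<lambda>j. C * norm (s j - a) * ((1 + norm a) * (1 + norm (s j - a))) ^ k)
      \<longlonglongrightarrow> C * norm (a - a) * ((1 + norm a) * (1 + norm (a - a))) ^ k"
      by (intro tendsto_intros s)
    then show "(\<lambda>j. C * norm (s j - a) * ((1 + norm a) * (1 + norm (s j - a))) ^ k) \<longlonglongrightarrow> 0" by simp
    show "(1 + norm x) ^ k * norm (partials bs (\<lambda>x. g (x - s j)) x - partials bs (\<lambda>x. g (x - a)) x)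
        \<le> C * norm (s j - a) * ((1 + norm a) * (1 + norm (s j - a))) ^ k" for j x
      using C(2)[of x a "s j - a"] by (simp add: schwartz_translate(2)[OF g bs])
  qed
qed (use g schwartz_translate(1) in auto)

section \<open>Tempered distributions evaluated on convolutions\<close>

lemma tempered_sum:
  assumes u: "tempered_distribution u" and I: "finite I" and f: "\<And>i. i \<in> I \<Longrightarrow> schwartz (f i)"
  shows "u (\<lambda>x. \<Sum>i\<in>I. c i * f i x) = (\<Sum>i\<in>I. c i * u (f i))"
  using I f
proof (induction I rule: finite_induct)
  case empty
  have "u (\<lambda>x. 0 * (\<lambda>x. 0) x) = 0 * u (\<lambda>x. 0)"
    using u schwartz_zero unfolding tempered_distribution_def by blast
  then show ?case by simp
next
  case (insert i I)
  have 1: "schwartz (\<lambda>x. c i * f i x)" "schwartz (\<lambda>x. \<Sum>i\<in>I. c i * f i x)"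
    using insert by (auto intro!: schwartz_sum(1) schwartz_cmult(1))
  have "u (\<lambda>x. c i * f i x + (\<Sum>i\<in>I. c i * f i x)) = u (\<lambda>x. c i * f i x) + u (\<lambda>x. \<Sum>i\<in>I. c i * f i x)"
    using u 1 unfolding tempered_distribution_def by blast
  moreover have "u (\<lambda>x. c i * f i x) = c i * u (f i)"
    using u insert unfolding tempered_distribution_def by blast
  ultimately show ?case using insert by simp
qed

text \<open>Only the translation of \<open>g\<close> is discretized: replacing \<open>a\<close> by simple functions
  converging to it turns \<open>conv f g\<close> into finite sums of translates of \<open>g\<close>.\<close>

lemma tempered_conv:
  fixes f g :: "'a::euclidean_space \<Rightarrow> complex"
  assumes u: "tempered_distribution u" and f: "schwartz f" and g: "schwartz g"
    and bound: "\<And>a. norm (u (\<lambda>x. g (x - a))) \<le> B"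
  shows "u (conv f g) = (\<integral>a. f a * u (\<lambda>x. g (x - a)) \<partial>lborel)"
proof -
  have fi: "integrable lborel f" and [measurable]: "f \<in> borel_measurable borel"
    using f by (auto intro: schwartz_integrable)
  define \<kappa> where "\<kappa> a = u (\<lambda>x. g (x - a))" for a
  have "(\<lambda>x::'a. x) \<in> borel_measurable lborel" by simp
  \<comment> \<open>Besides convergence, the growth bound
    \<open>norm (s i x) \<le> 2 * norm x\<close> matters: it keeps the error polynomial in the
    argument, hence integrable against \<open>f\<close>.\<close>
  from borel_measurable_implies_sequence_metric[OF this, of 0]
  obtain s :: "nat \<Rightarrow> 'a \<Rightarrow> 'a" where s: "\<And>i. simple_function lborel (s i)"
    "\<And>x. (\<lambda>i. s i x) \<longlonglongrightarrow> x" "\<And>i x. norm (s i x) \<le> 2 * norm x"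
    by auto
  have [measurable]: "s i \<in> borel_measurable borel" for i
    using borel_measurable_simple_function[OF s(1)] by simp
  \<comment> \<open>The mass that \<open>f\<close> places on the level set where the translation is
    replaced by \<open>c\<close>; it is the coefficient of the translate by \<open>c\<close> in the
    finite sum.\<close>
  define q where "q i c = (\<integral>a. indicator (s i -` {c}) a *\<^sub>R f a \<partial>lborel)" for i c
  have fin: "finite (range (s i))" for i using simple_functionD(1)[OF s(1), of i] by simp
  have ind: "integrable lborel (\<lambda>a. indicator (s i -` {c}) a *\<^sub>R f a)" for i c
    by (rule integrable_mult_indicator[OF _ fi]) (use simple_functionD(2)[OF s(1), of i "{c}"] in simp)
  have key: "(\<integral>a. f a * h (s i a) \<partial>lborel) = (\<Sum>c\<in>range (s i). q i c * h c)"
    and key_int: "integrable lborel (\<lambda>a. f a * h (s i a))" for h :: "'a \<Rightarrow> complex" and i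
  proof -
    have e: "f a * h (s i a) = (\<Sum>c\<in>range (s i). (indicator (s i -` {c}) a *\<^sub>R f a) * h c)" for a
    proof -
      have "(\<Sum>c\<in>range (s i). (indicator (s i -` {c}) a *\<^sub>R f a) * h c)
        = (\<Sum>c\<in>range (s i). if c = s i a then f a * h c else 0)"
        by (intro sum.cong) (auto simp: indicator_def)
      then show ?thesis using fin by simp
    qed
    show "integrable lborel (\<lambda>a. f a * h (s i a))"
      unfolding e by (intro Bochner_Integration.integrable_sum integrable_mult_left ind)
    show "(\<integral>a. f a * h (s i a) \<partial>lborel) = (\<Sum>c\<in>range (s i). q i c * h c)"
    proof -
      have "(\<integral>a. (\<Sum>c\<in>range (s i). (indicator (s i -` {c}) a *\<^sub>R f a) * h c) \<partial>lborel)
        = (\<Sum>c\<in>range (s i). \<integral>a. (indicator (s i -` {c}) a *\<^sub>R f a) * h c \<partial>lborel)"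
        by (rule Bochner_Integration.integral_sum) (intro integrable_mult_left ind)
      then show ?thesis by (simp only: e q_def integral_mult_left_zero)
    qed
  qed
  define w where "w i x = (\<Sum>c\<in>range (s i). q i c * g (x - c))" for i x
  have w_schwartz: "schwartz (w i)" for i
    unfolding w_def[abs_def] by (intro schwartz_sum(1) fin schwartz_cmult(1) schwartz_translate(1) g)
  have w_partials: "partials bs (w i) x = (\<integral>a. f a * partials bs g (x - s i a) \<partial>lborel)"
    if bs: "bs \<in> lists Basis" for bs i x
  proof -
    have "partials bs (w i) x = (\<Sum>c\<in>range (s i). partials bs (\<lambda>x. q i c * g (x - c)) x)"
      unfolding w_def[abs_def]
      by (subst schwartz_sum(2)[OF fin _ bs]) (auto intro!: schwartz_cmult(1) schwartz_translate(1) g)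
    also have "\<dots> = (\<Sum>c\<in>range (s i). q i c * partials bs g (x - c))"
      by (simp add: schwartz_cmult(2)[OF schwartz_translate(1)[OF g] bs] schwartz_translate(2)[OF g bs])
    finally show ?thesis using key[where h="\<lambda>c. partials bs g (x - c)"] by simp
  qed
  have "schwartz_tendsto w (conv f g)"
  proof (rule schwartz_tendstoI)
    fix k and bs :: "'a list" assume bs: "bs \<in> lists Basis"
    obtain C where C: "C > 0" "\<And>x a h. (1 + norm x) ^ k * norm (partials bs g (x - a - h) - partials bs g (x - a))
       \<le> C * norm h * ((1 + norm a) * (1 + norm h)) ^ k"
      using schwartz_difference_bound[OF schwartz_partials[OF g bs]] by blast
    \<comment> \<open>\<open>E\<close> is the error of \<open>schwartz_difference_bound\<close> for
      the increment \<open>s i a - a\<close>, and \<open>W\<close> is its majorant. As the increment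
      is at most 3 |a|, the linear factor contributes 3 (1 + |a|) and the power contributes 3^k (1 +
      |a|)^(2k).\<close>
    define E where "E i a = norm (f a) * (C * norm (s i a - a) * ((1 + norm a) * (1 + norm (s i a - a))) ^ k)" for i a
    define W where "W a = 3 ^ Suc k * C * ((1 + norm a) ^ Suc (2 * k) * norm (f a))" for a
    have Em: "E i \<in> borel_measurable lborel" for i unfolding E_def by measurable
    have Wi: "integrable lborel W"
      unfolding W_def by (intro integrable_mult_right schwartz_integrable_weight f)
    have EW: "norm (E i a) \<le> W a" for i a
    proof -
      have n: "norm (s i a - a) \<le> 3 * norm a"
        using norm_triangle_ineq4[of "s i a" a] s(3)[of i a] by linarith
      have "norm (E i a) = norm (f a) * (C * norm (s i a - a) * ((1 + norm a) * (1 + norm (s i a - a))) ^ k)"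
        using C(1) by (simp add: E_def abs_mult)
      also have "\<dots> \<le> norm (f a) * (C * (3 * (1 + norm a)) * ((1 + norm a) * (3 * (1 + norm a))) ^ k)"
        using n C(1) by (intro mult_left_mono mult_mono power_mono) auto
      also have "\<dots> = W a"
      proof -
        define t where "t = 1 + norm a"
        show ?thesis
          unfolding W_def t_def[symmetric] by (simp add: power_mult_distrib power_mult power2_eq_square mult_ac)
      qed
      finally show ?thesis .
    qed
    have Ei: "integrable lborel (E i)" for i
      by (rule Bochner_Integration.integrable_bound[OF Wi Em]) (use EW in \<open>auto intro!: AE_I2 intro: order_trans[OF _ abs_ge_self]\<close>)
    have "(\<lambda>i. \<integral>a. E i a \<partial>lborel) \<longlonglongrightarrow> (\<integral>a. 0 \<partial>(lborel :: 'a measure))"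
    proof (rule integral_dominated_convergence[OF _ Em Wi])
      show "AE a in lborel. (\<lambda>i. E i a) \<longlonglongrightarrow> 0"
      proof (rule AE_I2)
        fix a
        have "(\<lambda>i. E i a) \<longlonglongrightarrow> norm (f a) * (C * norm (a - a) * ((1 + norm a) * (1 + norm (a - a))) ^ k)"
          unfolding E_def by (intro tendsto_intros s(2))
        then show "(\<lambda>i. E i a) \<longlonglongrightarrow> 0" by simp
      qed
    qed (use EW in auto)
    then have lim: "(\<lambda>i. \<integral>a. E i a \<partial>lborel) \<longlonglongrightarrow> 0" by simp
    have "(1 + norm x) ^ k * norm (partials bs (w i) x - partials bs (conv f g) x) \<le> (\<integral>a. E i a \<partial>lborel)" for i x
    proof -
      let ?g = "partials bs g"
      have gi: "integrable lborel (\<lambda>a. f a * ?g (x - a))"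
        by (rule schwartz_mult_translate_integrable[OF fi schwartz_partials[OF g bs]])
      have si: "integrable lborel (\<lambda>a. f a * ?g (x - s i a))" by (rule key_int)
      have "partials bs (w i) x - partials bs (conv f g) x = (\<integral>a. f a * ?g (x - s i a) - f a * ?g (x - a) \<partial>lborel)"
        unfolding w_partials[OF bs] partials_conv[OF f g bs] conv_def
        by (rule Bochner_Integration.integral_diff[OF si gi, symmetric])
      then have "(1 + norm x) ^ k * norm (partials bs (w i) x - partials bs (conv f g) x)
         = norm (\<integral>a. (1 + norm x) ^ k *\<^sub>R (f a * ?g (x - s i a) - f a * ?g (x - a)) \<partial>lborel)"
        by simp
      also have "\<dots> \<le> (\<integral>a. E i a \<partial>lborel)"
      proof (rule Bochner_Integration.integral_norm_bound_integral[OF _ Ei])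
        show "integrable lborel (\<lambda>a. (1 + norm x) ^ k *\<^sub>R (f a * ?g (x - s i a) - f a * ?g (x - a)))"
          by (intro integrable_scaleR_right Bochner_Integration.integrable_diff si gi)
        fix a
        have "norm ((1 + norm x) ^ k *\<^sub>R (f a * ?g (x - s i a) - f a * ?g (x - a)))
           = norm (f a) * ((1 + norm x) ^ k * norm (?g (x - a - (s i a - a)) - ?g (x - a)))"
          by (simp add: norm_mult flip: right_diff_distrib)
        also have "\<dots> \<le> E i a"
          unfolding E_def by (intro mult_left_mono C) simp
        finally show "norm ((1 + norm x) ^ k *\<^sub>R (f a * ?g (x - s i a) - f a * ?g (x - a))) \<le> E i a" .
      qed
      finally show ?thesis .
    qed
    with lim show "\<exists>e. e \<longlonglongrightarrow> 0 \<and> (\<forall>j x. (1 + norm x) ^ k * norm (partials bs (w j) x - partials bs (conv f g) x) \<le> e j)"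
      by blast
  qed (use w_schwartz schwartz_conv[OF f g] in auto)
  then have "(\<lambda>i. u (w i)) \<longlonglongrightarrow> u (conv f g)"
    using u unfolding tempered_distribution_def by blast
  moreover have "u (w i) = (\<integral>a. f a * \<kappa> (s i a) \<partial>lborel)" for i
    unfolding w_def[abs_def] key[where h=\<kappa>] unfolding \<kappa>_def
    by (rule tempered_sum[OF u fin schwartz_translate(1)[OF g]])
  moreover have "(\<lambda>i. \<integral>a. f a * \<kappa> (s i a) \<partial>lborel) \<longlonglongrightarrow> (\<integral>a. f a * \<kappa> a \<partial>lborel)"
  proof (rule integral_dominated_convergence[where w="\<lambda>a. norm (f a) * B"])
    have lim: "(\<lambda>i. \<kappa> (s i a)) \<longlonglongrightarrow> \<kappa> a" for a
      using u schwartz_translate_tendsto[OF g s(2)[of a]] unfolding \<kappa>_def tempered_distribution_def by blast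
    have km: "(\<lambda>a. \<kappa> (s i a)) \<in> borel_measurable lborel" for i
      by (rule borel_measurable_simple_function[OF simple_function_compose1[OF s(1)]])
    \<comment> \<open>Sequential continuity of \<open>u\<close> makes \<open>\<kappa>\<close> the
      pointwise limit of its compositions with the simple functions \<open>s i\<close>.\<close>
    have [measurable]: "\<kappa> \<in> borel_measurable lborel"
      by (rule borel_measurable_LIMSEQ_metric[OF km lim])
    show "(\<lambda>a. f a * \<kappa> a) \<in> borel_measurable lborel" by measurable
    show "(\<lambda>a. f a * \<kappa> (s i a)) \<in> borel_measurable lborel" for i
      by (intro borel_measurable_times km) simp
    show "integrable lborel (\<lambda>a. norm (f a) * B)" using fi by simp
    show "AE a in lborel. (\<lambda>i. f a * \<kappa> (s i a)) \<longlonglongrightarrow> f a * \<kappa> a"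
      by (intro AE_I2 tendsto_mult_left lim)
    show "AE a in lborel. norm (f a * \<kappa> (s i a)) \<le> norm (f a) * B" for i
      using bound by (intro AE_I2) (auto simp: norm_mult \<kappa>_def intro!: mult_left_mono)
  qed
  ultimately show ?thesis unfolding \<kappa>_def using LIMSEQ_unique by simp
qed

text \<open>Since \<open>G j\<close> has integral 1, the error is an average of
  \<open>f (x - a) - f x\<close>, which \<open>schwartz_difference_bound\<close> at centre 0 bounds
  by a multiple of |a| (1 + |a|)^k. Vanishing of these weighted moments therefore gives convergence
  in every seminorm.\<close>

lemma conv_mollifier_tendsto:
  fixes f :: "'a::euclidean_space \<Rightarrow> complex"
  assumes f: "schwartz f" and G: "\<And>j. schwartz (G j)" and one: "\<And>j. (\<integral>a. G j a \<partial>lborel) = 1"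
    and moment: "\<And>k. (\<lambda>j. \<integral>a. norm (G j a) * (norm a * (1 + norm a) ^ k) \<partial>lborel) \<longlonglongrightarrow> 0"
  shows "schwartz_tendsto (\<lambda>j. conv f (G j)) f"
proof (rule schwartz_tendstoI)
  fix k and bs :: "'a list" assume bs: "bs \<in> lists Basis"
  let ?f = "partials bs f"
  have f': "schwartz ?f" by (rule schwartz_partials[OF f bs])
  obtain C where C: "C > 0" "\<And>x a h. (1 + norm x) ^ k * norm (?f (x - a - h) - ?f (x - a))
     \<le> C * norm h * ((1 + norm a) * (1 + norm h)) ^ k"
    using schwartz_difference_bound[OF f'] by blast
  let ?e = "\<lambda>j. C * (\<integral>a. norm (G j a) * (norm a * (1 + norm a) ^ k) \<partial>lborel)"
  have "(1 + norm x) ^ k * norm (partials bs (conv f (G j)) x - ?f x) \<le> ?e j" for j x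
  proof -
    have Gi: "integrable lborel (G j)" by (rule schwartz_integrable[OF G])
    then have Gi2: "integrable lborel (\<lambda>a. G j a * ?f x)" by simp
    have Gi1: "integrable lborel (\<lambda>a. G j a * ?f (x - a))" by (rule schwartz_mult_translate_integrable[OF Gi f'])
    \<comment> \<open>The factors are exchanged so that derivatives fall on the fixed
      \<open>f\<close> and not on the concentrating \<open>G j\<close>.\<close>
    have "conv f (G j) = conv (G j) f"
      by (intro conv_commute schwartz_borel_measurable f G)
    then have "partials bs (conv f (G j)) x - ?f x = (\<integral>a. G j a * ?f (x - a) \<partial>lborel) - (\<integral>a. G j a * ?f x \<partial>lborel)"
      using one[of j] by (simp add: partials_conv[OF G f bs] conv_def)
    also have "\<dots> = (\<integral>a. G j a * ?f (x - a) - G j a * ?f x \<partial>lborel)"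
      by (rule Bochner_Integration.integral_diff[OF Gi1 Gi2, symmetric])
    finally have "(1 + norm x) ^ k * norm (partials bs (conv f (G j)) x - ?f x)
       = norm (\<integral>a. (1 + norm x) ^ k *\<^sub>R (G j a * ?f (x - a) - G j a * ?f x) \<partial>lborel)" by simp
    also have "\<dots> \<le> (\<integral>a. C * (norm (G j a) * (norm a * (1 + norm a) ^ k)) \<partial>lborel)"
    proof (rule Bochner_Integration.integral_norm_bound_integral)
      show "integrable lborel (\<lambda>a. (1 + norm x) ^ k *\<^sub>R (G j a * ?f (x - a) - G j a * ?f x))"
        by (intro integrable_scaleR_right Bochner_Integration.integrable_diff Gi1 Gi2)
      have "integrable lborel (\<lambda>a. norm (G j a) * (norm a * (1 + norm a) ^ k))"
      proof (rule Bochner_Integration.integrable_bound[OF schwartz_integrable_weight[OF G, of "Suc k"]])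
        show "(\<lambda>a. norm (G j a) * (norm a * (1 + norm a) ^ k)) \<in> borel_measurable lborel"
          using schwartz_borel_measurable[OF G[of j]] by simp
      qed (auto intro!: AE_I2 mult_left_mono mult_right_mono simp: mult.commute[of "norm (G j _)"])
      then show "integrable lborel (\<lambda>a. C * (norm (G j a) * (norm a * (1 + norm a) ^ k)))" by simp
      fix a
      have "norm ((1 + norm x) ^ k *\<^sub>R (G j a * ?f (x - a) - G j a * ?f x))
        = norm (G j a) * ((1 + norm x) ^ k * norm (?f (x - 0 - a) - ?f (x - 0)))"
        by (simp add: norm_mult flip: right_diff_distrib)
      also have "\<dots> \<le> norm (G j a) * (C * norm a * ((1 + norm (0::'a)) * (1 + norm a)) ^ k)"
        by (intro mult_left_mono C) simp
      finally show "norm ((1 + norm x) ^ k *\<^sub>R (G j a * ?f (x - a) - G j a * ?f x)) \<le> C * (norm (G j a) * (norm a * (1 + norm a) ^ k))"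
        by (simp add: mult_ac)
    qed
    finally show ?thesis by simp
  qed
  moreover have "?e \<longlonglongrightarrow> 0" using tendsto_mult_right_zero[OF moment] .
  ultimately show "\<exists>e. e \<longlonglongrightarrow> 0 \<and> (\<forall>j x. (1 + norm x) ^ k * norm (partials bs (conv f (G j)) x - ?f x) \<le> e j)"
    by blast
qed (use f G schwartz_conv in auto)

section \<open>Polynomials times Gaussians\<close>

inductive polynomial_fun :: "('a::euclidean_space \<Rightarrow> complex) \<Rightarrow> bool" where
  const: "polynomial_fun (\<lambda>x. c)"
| inner: "polynomial_fun (\<lambda>x. complex_of_real (x \<bullet> v))"
| add: "polynomial_fun f \<Longrightarrow> polynomial_fun g \<Longrightarrow> polynomial_fun (\<lambda>x. f x + g x)"
| mult: "polynomial_fun f \<Longrightarrow> polynomial_fun g \<Longrightarrow> polynomial_fun (\<lambda>x. f x * g x)"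

lemma polynomial_fun_derivative:
  assumes "polynomial_fun f"
  shows "\<exists>D. (\<forall>x. (f has_derivative D x) (at x)) \<and> (\<forall>h. polynomial_fun (\<lambda>x. D x h))"
  using assms
proof induction
  case (const c)
  show ?case by (rule exI[of _ "\<lambda>x h. 0"]) (auto intro: polynomial_fun.const)
next
  case (inner v)
  show ?case
    by (rule exI[of _ "\<lambda>x h. complex_of_real (h \<bullet> v)"])
       (auto intro!: polynomial_fun.const derivative_eq_intros)
next
  case (add f g)
  then obtain D E where "\<And>x. (f has_derivative D x) (at x)" "\<And>h. polynomial_fun (\<lambda>x. D x h)"
    "\<And>x. (g has_derivative E x) (at x)" "\<And>h. polynomial_fun (\<lambda>x. E x h)" by blast
  then show ?case
    by (intro exI[of _ "\<lambda>x h. D x h + E x h"]) (auto intro!: polynomial_fun.add has_derivative_add)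
next
  case (mult f g)
  then obtain D E where "\<And>x. (f has_derivative D x) (at x)" "\<And>h. polynomial_fun (\<lambda>x. D x h)"
    "\<And>x. (g has_derivative E x) (at x)" "\<And>h. polynomial_fun (\<lambda>x. E x h)" by blast
  with mult.hyps show ?case
    by (intro exI[of _ "\<lambda>x h. f x * E x h + D x h * g x"])
       (auto intro!: polynomial_fun.add polynomial_fun.mult has_derivative_mult)
qed

lemma polynomial_fun_bound:
  assumes "polynomial_fun f"
  shows "\<exists>C n. C \<ge> 0 \<and> (\<forall>x. norm (f x) \<le> C * (1 + norm x) ^ n)"
  using assms
proof induction
  case (const c)
  show ?case by (rule exI[of _ "norm c"], rule exI[of _ 0]) auto
next
  case (inner v)
  have "norm (complex_of_real (x \<bullet> v)) \<le> norm v * (1 + norm x) ^ 1" for x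
  proof -
    have "norm (complex_of_real (x \<bullet> v)) \<le> norm x * norm v" by (simp add: Cauchy_Schwarz_ineq2)
    then show ?thesis by (simp add: algebra_simps add_increasing)
  qed
  then show ?case using norm_ge_zero by blast
next
  case (add f g)
  then obtain C n D m where *: "C \<ge> 0" "\<And>x. norm (f x) \<le> C * (1 + norm x) ^ n"
     "D \<ge> 0" "\<And>x. norm (g x) \<le> D * (1 + norm x) ^ m" by blast
  have "norm (f x + g x) \<le> (C + D) * (1 + norm x) ^ (n + m)" for x
  proof -
    have "norm (f x + g x) \<le> C * (1 + norm x) ^ n + D * (1 + norm x) ^ m"
      using norm_triangle_ineq[of "f x" "g x"] *(2)[of x] *(4)[of x] by linarith
    also have "\<dots> \<le> C * (1 + norm x) ^ (n + m) + D * (1 + norm x) ^ (n + m)"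
      using * by (intro add_mono mult_left_mono power_increasing) auto
    finally show ?thesis by (simp add: distrib_right)
  qed
  then show ?case using * by (intro exI[of _ "C + D"] exI[of _ "n + m"]) auto
next
  case (mult f g)
  then obtain C n D m where *: "C \<ge> 0" "\<And>x. norm (f x) \<le> C * (1 + norm x) ^ n"
     "D \<ge> 0" "\<And>x. norm (g x) \<le> D * (1 + norm x) ^ m" by blast
  have "norm (f x * g x) \<le> (C * D) * (1 + norm x) ^ (n + m)" for x
  proof -
    have "norm (f x * g x) \<le> (C * (1 + norm x) ^ n) * (D * (1 + norm x) ^ m)"
      unfolding norm_mult using * by (intro mult_mono) auto
    then show ?thesis by (simp add: power_add mult_ac)
  qed
  then show ?case using * by (intro exI[of _ "C * D"] exI[of _ "n + m"]) auto
qed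

text \<open>Products of a polynomial with the exponential form a derivative-stable class. The
  rank-one term in \<open>v\<close> and the modulation in \<open>q\<close> cover the two quadratic
  forms met later, with \<open>v\<close> equal to (1, -1) on the kernel side and (1, 1) on the
  Fourier side, together with their characters.\<close>

lemma schwartz_gaussian:
  fixes v q :: "'a::euclidean_space"
  assumes \<alpha>: "\<alpha> > 0" and \<beta>: "\<beta> \<ge> 0"
  shows "schwartz (\<lambda>x. complex_of_real (exp (- (\<alpha> * (norm x)\<^sup>2 + \<beta> * (x \<bullet> v)\<^sup>2))) * cis (x \<bullet> q))"
proof -
  define L where "L x = complex_of_real (- (\<alpha> * (x \<bullet> x) + \<beta> * (x \<bullet> v)\<^sup>2)) + \<i> * complex_of_real (x \<bullet> q)" for x
  define L' where "L' x h = complex_of_real (- 2 * \<alpha> * (x \<bullet> h) - 2 * \<beta> * (h \<bullet> v) * (x \<bullet> v)) + \<i> * complex_of_real (h \<bullet> q)" for x h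
  have L: "(L has_derivative L' x) (at x)" for x
    unfolding L_def[abs_def] L'_def[abs_def]
    by (auto intro!: derivative_eq_intros simp: fun_eq_iff inner_commute algebra_simps)
  have L': "polynomial_fun (\<lambda>x. L' x h)" for h
  proof -
    have "(\<lambda>x. L' x h) = (\<lambda>x. (complex_of_real (- 2 * \<alpha>) * complex_of_real (x \<bullet> h)
       + complex_of_real (- 2 * \<beta> * (h \<bullet> v)) * complex_of_real (x \<bullet> v)) + \<i> * complex_of_real (h \<bullet> q))"
      by (simp add: L'_def fun_eq_iff)
    then show ?thesis
      by (simp only:) (intro polynomial_fun.intros)
  qed
  have eq: "complex_of_real (exp (- (\<alpha> * (norm x)\<^sup>2 + \<beta> * (x \<bullet> v)\<^sup>2))) * cis (x \<bullet> q) = exp (L x)" for x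
    unfolding L_def exp_add cis_conv_exp power2_norm_eq_inner exp_of_real ..
  have nL: "norm (exp (L x)) \<le> exp (- \<alpha> * (norm x)\<^sup>2)" for x
    using \<beta> by (simp add: L_def power2_norm_eq_inner)
  let ?X = "\<lambda>h. \<exists>P. polynomial_fun P \<and> h = (\<lambda>x. P x * exp (L x))"
  have "schwartz (\<lambda>x. exp (L x))"
  proof (rule schwartz_coinduct(1)[of ?X])
    show "?X (\<lambda>x. exp (L x))"
      by (rule exI[of _ "\<lambda>x. 1"]) (auto intro: polynomial_fun.const)
    show "\<exists>D. (\<forall>x. (h has_derivative D x) (at x)) \<and> (\<forall>b\<in>Basis. ?X (\<lambda>x. D x b))" if X: "?X h" for h
    proof -
      obtain P where P: "polynomial_fun P" "h = (\<lambda>x. P x * exp (L x))" using X by blast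
      obtain D where D: "\<And>x. (P has_derivative D x) (at x)" "\<And>h. polynomial_fun (\<lambda>x. D x h)"
        using polynomial_fun_derivative[OF P(1)] by blast
      show ?thesis unfolding P(2)
      proof (intro exI[of _ "\<lambda>x h. (D x h + P x * L' x h) * exp (L x)"] conjI allI ballI)
        show "((\<lambda>x. P x * exp (L x)) has_derivative (\<lambda>h. (D x h + P x * L' x h) * exp (L x))) (at x)" for x
        proof -
          have "((\<lambda>x. exp (L x)) has_derivative (\<lambda>h. exp (L x) * L' x h)) (at x)"
            using has_derivative_compose[OF L, of exp "\<lambda>y. exp (L x) * y"] DERIV_exp[of "L x"]
            by (simp add: has_field_derivative_def)
          from has_derivative_mult[OF D(1) this] show ?thesis by (simp add: algebra_simps)
        qed
        show "?X (\<lambda>x. (D x b + P x * L' x b) * exp (L x))" for b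
          by (intro exI[of _ "\<lambda>x. D x b + P x * L' x b"] conjI refl polynomial_fun.add polynomial_fun.mult D P L')
      qed
    qed
    show "rapidly_decreasing h" if X: "?X h" for h
    proof (rule rapidly_decreasingI)
      fix k
      obtain P where P: "polynomial_fun P" "h = (\<lambda>x. P x * exp (L x))" using X by blast
      obtain C n where C: "C \<ge> 0" "\<And>x. norm (P x) \<le> C * (1 + norm x) ^ n"
        using polynomial_fun_bound[OF P(1)] by blast
      let ?N = "real (k + n)"
      \<comment> \<open>After 1 + t <= exp t the quantity to bound is exp(N t - \<alpha> t^2); the
        constant is its maximum, attained at t = N / (2 \<alpha>).\<close>
      have "norm x ^ k * norm (h x) \<le> C * exp (?N\<^sup>2 / (4 * \<alpha>))" for x
      proof -
        let ?t = "norm x"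
        have "norm x ^ k * norm (h x) \<le> (1 + ?t) ^ k * ((C * (1 + ?t) ^ n) * exp (- \<alpha> * ?t\<^sup>2))"
          unfolding P(2) norm_mult using C nL by (intro mult_mono power_mono) auto
        also have "\<dots> = C * ((1 + ?t) ^ (k + n) * exp (- \<alpha> * ?t\<^sup>2))"
          by (simp add: power_add mult_ac)
        also have "\<dots> \<le> C * (exp ?t ^ (k + n) * exp (- \<alpha> * ?t\<^sup>2))"
          using C(1) exp_ge_add_one_self[of ?t] by (intro mult_left_mono mult_right_mono power_mono) auto
        also have "\<dots> = C * exp (?N * ?t - \<alpha> * ?t\<^sup>2)"
          by (simp add: exp_of_nat_mult[symmetric] exp_add[symmetric] exp_diff exp_minus field_simps)
        also have "\<dots> \<le> C * exp (?N\<^sup>2 / (4 * \<alpha>))"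
        proof -
          have "0 \<le> (?N - 2 * \<alpha> * ?t)\<^sup>2" by simp
          then have "(?N * ?t - \<alpha> * ?t\<^sup>2) * (4 * \<alpha>) \<le> ?N\<^sup>2"
            by (simp add: power2_eq_square algebra_simps)
          then have "?N * ?t - \<alpha> * ?t\<^sup>2 \<le> ?N\<^sup>2 / (4 * \<alpha>)" using \<alpha> by (simp add: pos_le_divide_eq)
          then show ?thesis using C(1) by (intro mult_left_mono) auto
        qed
        finally show ?thesis .
      qed
      then show "\<exists>C. \<forall>x. norm x ^ k * norm (h x) \<le> C" by blast
    qed
  qed
  then show ?thesis by (simp only: eq)
qed

section \<open>Kernels with a bounded symbol\<close>

text \<open>The factor \<open>l\<close> keeps the integral equal to 1, so the transform is the
  Gaussian of width \<open>l\<close>, which tends to 1 pointwise as \<open>l\<close> grows.\<close>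

definition dilated_gauss :: "real \<Rightarrow> real \<Rightarrow> complex" where
  "dilated_gauss l x = complex_of_real (l * gauss (l * x))"

lemma schwartz_dilated_gauss:
  assumes "l > 0"
  shows "schwartz (dilated_gauss l)"
proof -
  have "dilated_gauss l = (\<lambda>x. complex_of_real l * (complex_of_real (exp (- (pi * l\<^sup>2 * (norm x)\<^sup>2 + 0 * (x \<bullet> 0)\<^sup>2))) * cis (x \<bullet> 0)))"
    by (auto simp: dilated_gauss_def gauss_def fun_eq_iff power_mult_distrib)
  then show ?thesis using assms by (simp only:) (intro schwartz_cmult(1) schwartz_gaussian, auto)
qed

lemma fourier_dilated_gauss:
  assumes "l > 0"
  shows "fourier (dilated_gauss l) \<xi> = complex_of_real (gauss (\<xi> / l))"
proof -
  have "fourier (dilated_gauss l) \<xi> = (\<integral>x. complex_of_real l * (cis (2 * pi * (x \<bullet> (- \<xi>))) * complex_of_real (gauss (l *\<^sub>R x))) \<partial>lborel)"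
    by (simp add: fourier_def dilated_gauss_def mult_ac)
  also have "\<dots> = complex_of_real l * complex_of_real (gauss ((- \<xi>) /\<^sub>R l) / l ^ DIM(real))"
    by (subst integral_mult_right_zero) (simp only: gauss_kernel[OF assms])
  also have "\<dots> = complex_of_real (gauss (\<xi> / l))"
    using assms gauss_minus[of "\<xi> / l"] by (simp add: divide_inverse mult.commute)
  finally show ?thesis .
qed

lemma integral_gauss_affine:
  assumes "c > 0"
  shows "(\<integral>x. gauss (c * (x - t)) \<partial>lborel) = 1 / (c :: real)"
    and "integrable lborel (\<lambda>x. gauss (c * (x - t)))"
proof -
  have "(\<integral>x. gauss (x::real) \<partial>lborel) = \<bar>c\<bar> *\<^sub>R (\<integral>x. gauss (- (c * t) + c * x) \<partial>lborel)"
    using assms by (intro lborel_integral_real_affine) auto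
  moreover have "- (c * t) + c * x = c * (x - t)" for x by (simp add: algebra_simps)
  ultimately show "(\<integral>x. gauss (c * (x - t)) \<partial>lborel) = 1 / c"
    using assms by (simp add: gauss_integral field_simps)
  show "integrable lborel (\<lambda>x. gauss (c * (x - t)))"
    using lborel_integrable_real_affine[OF gauss_integrable, of c "- (c * t)"] assms by (simp add: algebra_simps)
qed

text \<open>The function on which \<open>bilinear_operator K\<close> evaluates \<open>K\<close> when its three arguments are the same
  Gaussian; translating two of the arguments translates it.\<close>

definition mollifier :: "real \<Rightarrow> real \<times> real \<Rightarrow> complex" where
  "mollifier l = (\<lambda>(y, z). \<integral>x. dilated_gauss l (x - y) * dilated_gauss l (x - z) * dilated_gauss l x \<partial>lborel)"

text \<open>Completing the square in \<open>x\<close>: (x-y)^2 + (x-z)^2 + x^2 equals 3 (x -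
  (y+z)/3)^2 plus (y^2 + z^2 + (y-z)^2) / 3. The integral over \<open>x\<close> contributes 1 /
  (sqrt 3 * l).\<close>

lemma mollifier_eq:
  assumes l: "l > 0"
  shows "mollifier l p = complex_of_real (l\<^sup>2 / sqrt 3) *
    (complex_of_real (exp (- (pi * l\<^sup>2 / 3 * (norm p)\<^sup>2 + pi * l\<^sup>2 / 3 * (p \<bullet> (1, -1))\<^sup>2))) * cis (p \<bullet> 0))"
proof (cases p)
  case (Pair y z)
  let ?E = "exp (- (pi * l\<^sup>2 / 3 * (norm (y, z))\<^sup>2 + pi * l\<^sup>2 / 3 * ((y, z) \<bullet> (1, -1))\<^sup>2))"
  have e: "dilated_gauss l (x - y) * dilated_gauss l (x - z) * dilated_gauss l x
    = complex_of_real (l ^ 3 * ?E * gauss (sqrt 3 * l * (x - (y + z) / 3)))" for x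
  proof -
    have "- pi * (l * (x - y))\<^sup>2 + - pi * (l * (x - z))\<^sup>2 + - pi * (l * x)\<^sup>2
      = - (pi * l\<^sup>2 / 3 * (norm (y, z))\<^sup>2 + pi * l\<^sup>2 / 3 * ((y, z) \<bullet> (1, -1))\<^sup>2) + - pi * (sqrt 3 * l * (x - (y + z) / 3))\<^sup>2"
      by (simp add: norm_Pair inner_Pair power_mult_distrib) (simp add: power2_eq_square field_simps)
    then have "gauss (l * (x - y)) * gauss (l * (x - z)) * gauss (l * x) = ?E * gauss (sqrt 3 * l * (x - (y + z) / 3))"
      by (simp only: gauss_def real_norm_def power2_abs exp_add[symmetric])
    then show ?thesis
      unfolding dilated_gauss_def of_real_mult[symmetric] of_real_eq_iff
      by (simp add: power3_eq_cube)
  qed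
  have "mollifier l p = complex_of_real (\<integral>x. l ^ 3 * ?E * gauss (sqrt 3 * l * (x - (y + z) / 3)) \<partial>lborel)"
    unfolding mollifier_def Pair prod.case e by (rule integral_complex_of_real)
  also have "\<dots> = complex_of_real (l ^ 3 * ?E * (1 / (sqrt 3 * l)))"
    using l by (subst integral_mult_right_zero) (subst integral_gauss_affine, auto)
  also have "\<dots> = complex_of_real (l\<^sup>2 / sqrt 3) * complex_of_real ?E"
    using l by (simp add: power3_eq_cube power2_eq_square)
  finally show ?thesis by (simp add: Pair zero_prod_def)
qed

lemma schwartz_mollifier:
  assumes l: "l > 0"
  shows "schwartz (mollifier l)"
proof -
  have "mollifier l = (\<lambda>p. complex_of_real (l\<^sup>2 / sqrt 3) *
    (complex_of_real (exp (- (pi * l\<^sup>2 / 3 * (norm p)\<^sup>2 + pi * l\<^sup>2 / 3 * (p \<bullet> (1, -1))\<^sup>2))) * cis (p \<bullet> 0)))"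
    by (rule ext, rule mollifier_eq[OF l])
  then show ?thesis using l by (simp only:) (intro schwartz_cmult(1) schwartz_gaussian, auto)
qed

lemma mollifier_scale: "l > 0 \<Longrightarrow> mollifier l p = complex_of_real (l\<^sup>2) * mollifier 1 (l *\<^sub>R p)"
  by (simp add: mollifier_eq power_mult_distrib)

lemma mollifier_integral:
  assumes l: "l > 0"
  shows "(\<integral>p. mollifier l p \<partial>lborel) = 1"
proof -
  have m1: "(\<integral>p. mollifier 1 p \<partial>lborel) = 1"
  proof -
    have i: "integrable (lborel \<Otimes>\<^sub>M lborel) (mollifier 1)"
      using schwartz_integrable[OF schwartz_mollifier[of 1]] by (simp add: lborel_prod)
    \<comment> \<open>A second completion of the square, now in \<open>z\<close>: (y^2 + z^2 +
      (y-z)^2) / 3 = y^2 / 2 + (2/3) (z - y/2)^2, which makes the double integral iterated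
      Gaussian.\<close>
    have e: "mollifier 1 (y, z) = complex_of_real (1 / sqrt 3 * gauss (1 / sqrt 2 * (y - 0)) * gauss (sqrt (2 / 3) * (z - y / 2)))" for y z
    proof -
      have "- (pi / 3 * (norm (y, z))\<^sup>2 + pi / 3 * ((y, z) \<bullet> (1, -1))\<^sup>2)
        = - pi * (1 / sqrt 2 * (y - 0))\<^sup>2 + - pi * (sqrt (2 / 3) * (z - y / 2))\<^sup>2"
        by (simp add: norm_Pair inner_Pair power_mult_distrib real_sqrt_divide power_divide) (simp add: power2_eq_square field_simps)
      then have "exp (- (pi / 3 * (norm (y, z))\<^sup>2 + pi / 3 * ((y, z) \<bullet> (1, -1))\<^sup>2)) = gauss (1 / sqrt 2 * (y - 0)) * gauss (sqrt (2 / 3) * (z - y / 2))"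
        by (simp only: gauss_def real_norm_def power2_abs exp_add[symmetric])
      then show ?thesis by (simp add: mollifier_eq zero_prod_def)
    qed
    have "(\<integral>p. mollifier 1 p \<partial>lborel) = (\<integral>y. \<integral>z. mollifier 1 (y, z) \<partial>lborel \<partial>lborel)"
      using lborel_pair.integral_fst'[OF i] by (simp add: lborel_prod)
    also have "\<dots> = (\<integral>y. complex_of_real (1 / sqrt 3 * gauss (1 / sqrt 2 * (y - 0)) * (1 / sqrt (2 / 3))) \<partial>lborel)"
    proof (rule Bochner_Integration.integral_cong[OF refl])
      fix y
      have "(\<integral>z. mollifier 1 (y, z) \<partial>lborel) = complex_of_real (\<integral>z. 1 / sqrt 3 * gauss (1 / sqrt 2 * (y - 0)) * gauss (sqrt (2 / 3) * (z - y / 2)) \<partial>lborel)"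
        unfolding e by (rule integral_complex_of_real)
      also have "\<dots> = complex_of_real (1 / sqrt 3 * gauss (1 / sqrt 2 * (y - 0)) * (1 / sqrt (2 / 3)))"
        by (subst integral_mult_right_zero) (subst integral_gauss_affine, auto)
      finally show "(\<integral>z. mollifier 1 (y, z) \<partial>lborel) = complex_of_real (1 / sqrt 3 * gauss (1 / sqrt 2 * (y - 0)) * (1 / sqrt (2 / 3)))" .
    qed
    also have "\<dots> = complex_of_real (\<integral>y. 1 / sqrt 3 * gauss (1 / sqrt 2 * (y - 0)) * (1 / sqrt (2 / 3)) \<partial>lborel)"
      by (rule integral_complex_of_real)
    also have "\<dots> = complex_of_real (1 / sqrt 3 * (1 / (1 / sqrt 2)) * (1 / sqrt (2 / 3)))"
      by (subst integral_mult_left_zero, subst integral_mult_right_zero) (subst integral_gauss_affine, auto)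
    also have "\<dots> = 1" by (simp add: real_sqrt_divide)
    finally show ?thesis .
  qed
  have "(\<integral>p. mollifier 1 p \<partial>lborel) = \<bar>l\<bar> ^ DIM(real \<times> real) *\<^sub>R (\<integral>p. mollifier 1 (0 + l *\<^sub>R p) \<partial>lborel)"
    by (rule lborel_integral_affine) (use l schwartz_borel_measurable[OF schwartz_mollifier[of 1]] in auto)
  also have "\<dots> = (\<integral>p. mollifier l p \<partial>lborel)"
    using l by (subst mollifier_scale[OF l]) (simp add: scaleR_conv_of_real power2_eq_square)
  finally show ?thesis using m1 by simp
qed

text \<open>Rescaling reduces every \<open>l\<close> to \<open>mollifier 1\<close>; the factor |a|
  becomes |a| / l and supplies the decay, while the remaining weight only decreases.\<close>

lemma mollifier_moment:
  "(\<lambda>j. \<integral>a. norm (mollifier (real (Suc j)) a) * (norm a * (1 + norm a) ^ k) \<partial>lborel) \<longlonglongrightarrow> 0"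
proof (rule tendsto_sandwich[OF _ _ tendsto_const])
  let ?I = "\<integral>a. (1 + norm a) ^ Suc k * norm (mollifier 1 a) \<partial>lborel"
  have i: "integrable lborel (\<lambda>a. (1 + norm a) ^ Suc k * norm (mollifier 1 a))"
    by (intro schwartz_integrable_weight schwartz_mollifier) simp
  show "(\<lambda>j. ?I / real (Suc j)) \<longlonglongrightarrow> 0"
    by (intro LIMSEQ_Suc lim_const_over_n)
  show "\<forall>\<^sub>F j in sequentially. 0 \<le> (\<integral>a. norm (mollifier (real (Suc j)) a) * (norm a * (1 + norm a) ^ k) \<partial>lborel)"
    by (intro always_eventually allI Bochner_Integration.integral_nonneg) auto
  have "(\<integral>a. norm (mollifier (real (Suc j)) a) * (norm a * (1 + norm a) ^ k) \<partial>lborel) \<le> ?I / real (Suc j)" for j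
  proof -
    let ?l = "real (Suc j)"
    have [measurable]: "mollifier 1 \<in> borel_measurable borel" "mollifier ?l \<in> borel_measurable borel"
      by (auto intro!: schwartz_borel_measurable schwartz_mollifier)
    \<comment> \<open>The real integrand is embedded in the complex numbers because
      \<open>lborel_integral_affine\<close> is stated for complex functions.\<close>
    let ?F = "\<lambda>a. complex_of_real (norm (mollifier 1 a) * (norm (a /\<^sub>R ?l) * (1 + norm (a /\<^sub>R ?l)) ^ k))"
    have "(\<integral>a. ?F a \<partial>lborel) = \<bar>?l\<bar> ^ DIM(real \<times> real) *\<^sub>R (\<integral>a. ?F (0 + ?l *\<^sub>R a) \<partial>lborel)"
      by (rule lborel_integral_affine) auto
    also have "\<dots> = (\<integral>a. complex_of_real (norm (mollifier ?l a) * (norm a * (1 + norm a) ^ k)) \<partial>lborel)"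
      unfolding integral_scaleR_right[symmetric]
      by (intro Bochner_Integration.integral_cong refl)
         (simp add: mollifier_scale[of ?l] norm_mult scaleR_conv_of_real power2_eq_square norm_power del: of_nat_Suc)
    finally have "(\<integral>a. norm (mollifier ?l a) * (norm a * (1 + norm a) ^ k) \<partial>lborel)
      = (\<integral>a. norm (mollifier 1 a) * (norm (a /\<^sub>R ?l) * (1 + norm (a /\<^sub>R ?l)) ^ k) \<partial>lborel)"
      unfolding integral_complex_of_real of_real_eq_iff by simp
    also have "\<dots> \<le> (\<integral>a. (1 + norm a) ^ Suc k * norm (mollifier 1 a) * (1 / ?l) \<partial>lborel)"
    proof (rule integral_mono_AE')
      show "integrable lborel (\<lambda>a. (1 + norm a) ^ Suc k * norm (mollifier 1 a) * (1 / ?l))"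
        by (rule integrable_mult_left[OF i])
      have "norm (a /\<^sub>R ?l) * (1 + norm (a /\<^sub>R ?l)) ^ k \<le> (1 + norm a) * (1 / ?l) * (1 + norm a) ^ k" for a :: "real \<times> real"
      proof (rule mult_mono)
        show "norm (a /\<^sub>R ?l) \<le> (1 + norm a) * (1 / ?l)" by (simp add: field_simps)
        have "norm (a /\<^sub>R ?l) \<le> norm a" by (simp add: field_simps mult_left_le)
        then show "(1 + norm (a /\<^sub>R ?l)) ^ k \<le> (1 + norm a) ^ k" by (intro power_mono) auto
      qed auto
      then have "norm (mollifier 1 a) * (norm (a /\<^sub>R ?l) * (1 + norm (a /\<^sub>R ?l)) ^ k) \<le> norm (mollifier 1 a) * ((1 + norm a) * (1 / ?l) * (1 + norm a) ^ k)" for a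
        by (intro mult_left_mono) auto
      then show "AE a in lborel. norm (mollifier 1 a) * (norm (a /\<^sub>R ?l) * (1 + norm (a /\<^sub>R ?l)) ^ k) \<le> (1 + norm a) ^ Suc k * norm (mollifier 1 a) * (1 / ?l)"
        by (intro AE_I2) (simp add: mult_ac)
    qed auto
    also have "\<dots> = ?I / ?l" by (subst integral_mult_left_zero) simp
    finally show ?thesis .
  qed
  then show "\<forall>\<^sub>F j in sequentially. (\<integral>a. norm (mollifier (real (Suc j)) a) * (norm a * (1 + norm a) ^ k) \<partial>lborel) \<le> ?I / real (Suc j)"
    by (intro always_eventually allI)
qed

text \<open>The product of the Fourier transforms of the three Gaussians behind
  \<open>mollifier l\<close>, with the evenness of the last one absorbing the sign of \<xi> +
  \<eta>. Mollifying the kernel side multiplies the symbol by this factor.\<close>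

definition damping :: "real \<Rightarrow> real \<times> real \<Rightarrow> real" where
  "damping l = (\<lambda>(\<xi>, \<eta>). gauss (\<xi> / l) * gauss (\<eta> / l) * gauss ((\<xi> + \<eta>) / l))"

lemma damping_eq:
  "damping l \<zeta> = exp (- (pi / l\<^sup>2 * (norm \<zeta>)\<^sup>2 + pi / l\<^sup>2 * (\<zeta> \<bullet> (1, 1))\<^sup>2))"
proof (cases \<zeta>)
  case (Pair \<xi> \<eta>)
  have "- pi * (\<xi> / l)\<^sup>2 + - pi * (\<eta> / l)\<^sup>2 + - pi * ((\<xi> + \<eta>) / l)\<^sup>2
    = - (pi / l\<^sup>2 * (norm \<zeta>)\<^sup>2 + pi / l\<^sup>2 * (\<zeta> \<bullet> (1, 1))\<^sup>2)"
    by (simp add: Pair norm_Pair inner_Pair power_divide) (simp add: distrib_left add_divide_distrib)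
  then show ?thesis
    by (simp only: damping_def Pair prod.case gauss_def real_norm_def power2_abs exp_add[symmetric])
qed

lemma damping_nonneg: "0 \<le> damping l \<zeta>"
  by (simp add: damping_eq)

lemma damping_le_1: "damping l \<zeta> \<le> 1"
proof -
  have "0 \<le> pi / l\<^sup>2 * (norm \<zeta>)\<^sup>2 + pi / l\<^sup>2 * (\<zeta> \<bullet> (1, 1))\<^sup>2"
    by (intro add_nonneg_nonneg mult_nonneg_nonneg) auto
  then show ?thesis by (simp only: damping_eq exp_le_one_iff neg_le_0_iff_le)
qed

lemma damping_borel_measurable [measurable]: "damping l \<in> borel_measurable borel"
proof -
  have "damping l = (\<lambda>\<zeta>. exp (- (pi / l\<^sup>2 * (norm \<zeta>)\<^sup>2 + pi / l\<^sup>2 * (\<zeta> \<bullet> (1, 1))\<^sup>2)))"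
    by (rule ext, rule damping_eq)
  then show ?thesis by (simp only:) measurable
qed

lemma damping_isCont: "isCont (damping l) \<zeta>"
proof -
  have "damping l = (\<lambda>\<zeta>. exp (- (pi / l\<^sup>2 * (norm \<zeta>)\<^sup>2 + pi / l\<^sup>2 * (\<zeta> \<bullet> (1, 1))\<^sup>2)))"
    by (rule ext, rule damping_eq)
  then show ?thesis by (simp only:) (intro continuous_intros)
qed

lemma damping_tendsto: "(\<lambda>j. damping (real (Suc j)) \<zeta>) \<longlonglongrightarrow> 1"
proof -
  have "(\<lambda>j. exp (- (pi * (1 / real (Suc j))\<^sup>2 * (norm \<zeta>)\<^sup>2 + pi * (1 / real (Suc j))\<^sup>2 * (\<zeta> \<bullet> (1, 1))\<^sup>2)))
    \<longlonglongrightarrow> exp (- (pi * 0\<^sup>2 * (norm \<zeta>)\<^sup>2 + pi * 0\<^sup>2 * (\<zeta> \<bullet> (1, 1))\<^sup>2))"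
    by (intro tendsto_intros LIMSEQ_Suc lim_const_over_n)
  then show ?thesis by (simp add: damping_eq power_divide)
qed

text \<open>This is the product of transforms belonging to the translated Gaussians; being a
  Schwartz function, it may be paired with the symbol.\<close>

lemma schwartz_damping:
  assumes "l > 0"
  shows "schwartz (\<lambda>\<zeta>. complex_of_real (damping l \<zeta>) * cis (2 * pi * (a \<bullet> \<zeta>)))"
proof -
  have "(\<lambda>\<zeta>. complex_of_real (damping l \<zeta>) * cis (2 * pi * (a \<bullet> \<zeta>)))
    = (\<lambda>\<zeta>. complex_of_real (exp (- (pi / l\<^sup>2 * (norm \<zeta>)\<^sup>2 + pi / l\<^sup>2 * (\<zeta> \<bullet> (1, 1))\<^sup>2))) * cis (\<zeta> \<bullet> ((2 * pi) *\<^sub>R a)))"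
    by (simp add: damping_eq inner_commute)
  then show ?thesis using assms by (simp only:) (intro schwartz_gaussian, auto)
qed

text \<open>Shifting the first two Gaussians by \<open>- a1\<close> and \<open>- a2\<close> moves
  the mollifier to \<open>a\<close> on the kernel side and multiplies the product of transforms by a
  character on the Fourier side. The premise \<open>symbol\<close> is limited to triples whose
  product of transforms is Schwartz, since the representation of the symbol speaks of test functions
  only.\<close>

lemma mollifier_pairing:
  assumes l: "l > 0"
    and symbol: "\<And>f g h. \<lbrakk>schwartz f; schwartz g; schwartz h;
        schwartz (\<lambda>(\<xi>,\<eta>). fourier f \<xi> * fourier g \<eta> * fourier h (- (\<xi> + \<eta>)))\<rbrakk> \<Longrightarrow>
      bilinear_operator K f g h = (\<integral>(\<xi>,\<eta>). m (\<xi>,\<eta>) * (fourier f \<xi> * fourier g \<eta> * fourier h (- (\<xi> + \<eta>))) \<partial>lborel)"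
  shows "K (\<lambda>p. mollifier l (p - a))
    = (\<integral>\<zeta>. m \<zeta> * complex_of_real (damping l \<zeta>) * cis (2 * pi * (a \<bullet> \<zeta>)) \<partial>lborel)"
proof -
  obtain a1 a2 where a: "a = (a1, a2)" by (cases a)
  define f where "f x = dilated_gauss l (x - (- a1))" for x
  define g where "g x = dilated_gauss l (x - (- a2))" for x
  have S: "schwartz f" "schwartz g" "schwartz (dilated_gauss l)"
    unfolding f_def[abs_def] g_def[abs_def]
    by (intro schwartz_translate(1) schwartz_dilated_gauss l)+
  have W: "fourier f \<xi> * fourier g \<eta> * fourier (dilated_gauss l) (- (\<xi> + \<eta>))
    = complex_of_real (damping l (\<xi>, \<eta>)) * cis (2 * pi * (a \<bullet> (\<xi>, \<eta>)))" for \<xi> \<eta>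
  proof -
    have "gauss (- (\<xi> + \<eta>) / l) = gauss ((\<xi> + \<eta>) / l)"
      using gauss_minus[of "(\<xi> + \<eta>) / l"] by (simp only: minus_divide_left)
    moreover have "cis (2 * pi * (a \<bullet> (\<xi>, \<eta>))) = cis (- 2 * pi * ((- a1) \<bullet> \<xi>)) * cis (- 2 * pi * ((- a2) \<bullet> \<eta>))"
      by (simp add: a inner_Pair cis_mult distrib_left)
    ultimately show ?thesis
      unfolding f_def[abs_def] g_def[abs_def] fourier_translate fourier_dilated_gauss[OF l]
      by (simp add: damping_def)
  qed
  have "bilinear_operator K f g (dilated_gauss l) = (\<integral>(\<xi>,\<eta>). m (\<xi>,\<eta>) * (fourier f \<xi> * fourier g \<eta> * fourier (dilated_gauss l) (- (\<xi> + \<eta>))) \<partial>lborel)"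
    using schwartz_damping[OF l, of a] by (intro symbol S) (simp only: W case_prod_unfold prod.collapse)
  also have "\<dots> = (\<integral>\<zeta>. m \<zeta> * complex_of_real (damping l \<zeta>) * cis (2 * pi * (a \<bullet> \<zeta>)) \<partial>lborel)"
    unfolding W by (simp add: case_prod_unfold mult.assoc)
  also have "bilinear_operator K f g (dilated_gauss l) = K (\<lambda>p. mollifier l (p - a))"
    unfolding bilinear_operator_def
    by (rule arg_cong[where f=K]) (simp add: fun_eq_iff f_def g_def mollifier_def a algebra_simps)
  finally show ?thesis .
qed

text \<open>\<open>\<psi>\<close> is the Fourier transform of the image under \<open>p\<close> of a
  complex measure, which may be singular in R^2; this generality accommodates directions and
  frequencies as one parameter. For each mollifier, \<open>tempered_conv\<close> reduces
  \<open>K\<close> to an integral over translates, where the damped symbol makes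
  \<open>integral_characters_mult\<close> applicable.\<close>

theorem tempered_pairing_characters:
  fixes K :: "(real \<times> real \<Rightarrow> complex) \<Rightarrow> complex" and M :: "'x measure" and w :: "'x \<Rightarrow> complex"
    and p :: "'x \<Rightarrow> real \<times> real"
  defines "\<psi> \<equiv> \<lambda>a. \<integral>x. w x * cis (- 2 * pi * (a \<bullet> p x)) \<partial>M"
  assumes K: "tempered_distribution K"
    and symbol: "\<And>f g h. \<lbrakk>schwartz f; schwartz g; schwartz h;
        schwartz (\<lambda>(\<xi>,\<eta>). fourier f \<xi> * fourier g \<eta> * fourier h (- (\<xi> + \<eta>)))\<rbrakk> \<Longrightarrow>
      bilinear_operator K f g h = (\<integral>(\<xi>,\<eta>). m (\<xi>,\<eta>) * (fourier f \<xi> * fourier g \<eta> * fourier h (- (\<xi> + \<eta>))) \<partial>lborel)"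
    and m[measurable]: "m \<in> borel_measurable borel" and B: "\<And>\<zeta>. norm (m \<zeta>) \<le> B"
    and M: "sigma_finite_measure M" and w: "integrable M w" and p[measurable]: "p \<in> borel_measurable M"
    and cont: "AE x in M. isCont m (p x)"
    and \<psi>: "schwartz \<psi>"
  shows "K \<psi> = (\<integral>x. w x * m (p x) \<partial>M)"
proof -
  let ?l = "\<lambda>j. real (Suc j)"
  \<comment> \<open>The symbol is merely bounded; damping makes it integrable while preserving the
    bound \<open>B\<close> and the points of continuity.\<close>
  define H where "H j \<zeta> = m \<zeta> * complex_of_real (damping (?l j) \<zeta>)" for j \<zeta>
  have Hi: "integrable lborel (H j)" for j
  proof -
    have "integrable lborel (\<lambda>\<zeta>. B * norm (complex_of_real (damping (?l j) \<zeta>) * cis (2 * pi * (0 \<bullet> \<zeta>))))"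
      using schwartz_integrable[OF schwartz_damping[of "?l j" 0]] by (intro integrable_mult_right integrable_norm) simp
    then show ?thesis
      unfolding H_def by (rule Bochner_Integration.integrable_bound)
        (measurable, use B damping_nonneg in \<open>auto simp: norm_mult abs_mult intro!: AE_I2 mult_right_mono intro: order_trans[OF _ abs_ge_self]\<close>)
  qed
  have HB: "norm (H j \<zeta>) \<le> B" for j \<zeta>
  proof -
    have "norm (H j \<zeta>) \<le> B * 1"
      unfolding H_def norm_mult using damping_nonneg[of "?l j" \<zeta>] damping_le_1[of "?l j" \<zeta>] B[of \<zeta>]
      by (intro mult_mono) (auto intro: order_trans[OF norm_ge_zero])
    then show ?thesis by simp
  qed
  have pair: "K (\<lambda>x. mollifier (?l j) (x - a)) = (\<integral>\<zeta>. H j \<zeta> * cis (2 * pi * (a \<bullet> \<zeta>)) \<partial>lborel)" for j a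
    unfolding H_def by (rule mollifier_pairing[OF _ symbol]) auto
  have pair_bound: "norm (K (\<lambda>x. mollifier (?l j) (x - a))) \<le> (\<integral>\<zeta>. norm (H j \<zeta>) \<partial>lborel)" for j a
    unfolding pair by (rule order_trans[OF integral_norm_bound]) (simp add: norm_mult)
  have "K (conv \<psi> (mollifier (?l j))) = (\<integral>x. w x * H j (p x) \<partial>M)" for j
  proof -
    have [measurable]: "H j \<in> borel_measurable borel" unfolding H_def by measurable
    have [measurable]: "\<psi> \<in> borel_measurable borel" using \<psi> by auto
    have "K (conv \<psi> (mollifier (?l j))) = (\<integral>a. \<psi> a * K (\<lambda>x. mollifier (?l j) (x - a)) \<partial>lborel)"
      by (rule tempered_conv[OF K \<psi> schwartz_mollifier pair_bound]) simp
    also have "\<dots> = (\<integral>x. w x * H j (p x) \<partial>M)"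
      unfolding pair unfolding \<psi>_def
    proof (rule integral_characters_mult[OF M w p Hi HB])
      show "AE x in M. isCont (H j) (p x)"
        using cont unfolding H_def
      proof eventually_elim
        case (elim x)
        then show ?case by (intro continuous_intros damping_isCont)
      qed
      have "integrable lborel (\<lambda>a. norm (\<psi> a) * (\<integral>\<zeta>. norm (H j \<zeta>) \<partial>lborel))"
        using schwartz_integrable[OF \<psi>] by simp
      then have "integrable lborel (\<lambda>a. \<psi> a * (\<integral>\<zeta>. H j \<zeta> * cis (2 * pi * (a \<bullet> \<zeta>)) \<partial>lborel))"
      proof (rule Bochner_Integration.integrable_bound)
        have "(\<lambda>a. \<integral>\<zeta>. H j \<zeta> * cis (2 * pi * (a \<bullet> \<zeta>)) \<partial>lborel) \<in> borel_measurable borel"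
          unfolding cis_conv_exp by (intro sigma_finite_measure.borel_measurable_lebesgue_integral) (auto intro: sigma_finite_lborel)
        then show "(\<lambda>a. \<psi> a * (\<integral>\<zeta>. H j \<zeta> * cis (2 * pi * (a \<bullet> \<zeta>)) \<partial>lborel)) \<in> borel_measurable lborel" by simp
        show "AE a in lborel. norm (\<psi> a * (\<integral>\<zeta>. H j \<zeta> * cis (2 * pi * (a \<bullet> \<zeta>)) \<partial>lborel)) \<le> norm (norm (\<psi> a) * (\<integral>\<zeta>. norm (H j \<zeta>) \<partial>lborel))"
          using pair_bound[of j] unfolding pair
          by (intro AE_I2) (simp add: norm_mult mult_left_mono)
      qed
      then show "integrable lborel (\<lambda>a. (\<integral>x. w x * cis (- 2 * pi * (a \<bullet> p x)) \<partial>M) * (\<integral>\<zeta>. H j \<zeta> * cis (2 * pi * (a \<bullet> \<zeta>)) \<partial>lborel))"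
        unfolding \<psi>_def .
    qed
    finally show ?thesis .
  qed
  moreover have "(\<lambda>j. K (conv \<psi> (mollifier (?l j)))) \<longlonglongrightarrow> K \<psi>"
  proof -
    have "schwartz_tendsto (\<lambda>j. conv \<psi> (mollifier (?l j))) \<psi>"
      by (rule conv_mollifier_tendsto[OF \<psi>]) (auto intro!: schwartz_mollifier mollifier_integral mollifier_moment simp del: of_nat_Suc)
    then show ?thesis using K unfolding tempered_distribution_def by blast
  qed
  moreover have "(\<lambda>j. \<integral>x. w x * H j (p x) \<partial>M) \<longlonglongrightarrow> (\<integral>x. w x * m (p x) \<partial>M)"
  proof (rule integral_dominated_convergence[where w="\<lambda>x. norm (w x) * B"])
    have [measurable]: "w \<in> borel_measurable M" using w by auto
    show "(\<lambda>x. w x * m (p x)) \<in> borel_measurable M" by measurable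
    show "(\<lambda>x. w x * H j (p x)) \<in> borel_measurable M" for j unfolding H_def by measurable
    show "integrable M (\<lambda>x. norm (w x) * B)" using w by simp
    show "AE x in M. (\<lambda>j. w x * H j (p x)) \<longlonglongrightarrow> w x * m (p x)"
    proof (rule AE_I2)
      fix x
      have "(\<lambda>j. w x * H j (p x)) \<longlonglongrightarrow> w x * (m (p x) * complex_of_real 1)"
        unfolding H_def by (intro tendsto_mult_left tendsto_of_real damping_tendsto)
      then show "(\<lambda>j. w x * H j (p x)) \<longlonglongrightarrow> w x * m (p x)" by simp
    qed
    show "AE x in M. norm (w x * H j (p x)) \<le> norm (w x) * B" for j
      by (intro AE_I2) (simp only: norm_mult, intro mult_left_mono HB norm_ge_zero)
  qed
  ultimately show ?thesis using LIMSEQ_unique by simp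
qed

section \<open>The sphere and integrals over slices\<close>

lemma sets_sphere_measure [simp, measurable_cong]: "sets sphere_measure = sets borel"
  and space_sphere_measure [simp]: "space sphere_measure = UNIV"
  by (auto simp: sphere_measure_def)

lemma sgn_borel_measurable: "(sgn :: 'a::euclidean_space \<Rightarrow> 'a) \<in> borel_measurable borel"
proof -
  have "(\<lambda>x::'a. x /\<^sub>R norm x) \<in> borel_measurable borel" by measurable
  moreover have "(sgn :: 'a \<Rightarrow> 'a) = (\<lambda>x. x /\<^sub>R norm x)" by (auto simp: sgn_div_norm)
  ultimately show ?thesis by metis
qed

lemma sphere_density_borel_measurable:
  "(\<lambda>x::'a::euclidean_space. ennreal (real DIM('a)) * indicator (ball 0 1) x) \<in> borel_measurable borel"
  by (intro borel_measurable_times_ennreal borel_measurable_const borel_measurable_indicator) simp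

lemma finite_sphere_measure: "finite_measure (sphere_measure :: 'a::euclidean_space measure)"
proof -
  let ?h = "\<lambda>x::'a. ennreal (real DIM('a)) * indicator (ball 0 1) x"
  have "finite_measure (density lborel ?h)"
  proof (rule finite_measureI)
    have "emeasure (density lborel ?h) (space (density lborel ?h)) = (\<integral>\<^sup>+x. ?h x \<partial>lborel)"
      using sphere_density_borel_measurable by (subst emeasure_density) auto
    also have "\<dots> = ennreal (real DIM('a)) * emeasure lborel (ball (0::'a) 1)"
      by (rule nn_integral_cmult_indicator) simp
    also have "\<dots> < \<infinity>"
      using emeasure_bounded_finite[of "ball (0::'a) 1"] by (auto simp: ennreal_mult_less_top)
    finally show "emeasure (density lborel ?h) (space (density lborel ?h)) \<noteq> \<infinity>" by simp
  qed
  then show ?thesis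
    unfolding sphere_measure_def
    by (rule finite_measure.finite_measure_distr) (use sgn_borel_measurable in simp)
qed

lemma AE_sphere_measureI:
  assumes "AE x in lborel. P (sgn x)" "{x. P x} \<in> sets borel"
  shows "AE x in (sphere_measure :: 'a::euclidean_space measure). P x"
  unfolding sphere_measure_def
proof (subst AE_distr_iff)
  show "sgn \<in> (density lborel (\<lambda>x::'a. ennreal (real DIM('a)) * indicator (ball 0 1) x)) \<rightarrow>\<^sub>M borel"
    using sgn_borel_measurable by simp
  show "AE x in density lborel (\<lambda>x::'a. ennreal (real DIM('a)) * indicator (ball 0 1) x). P (sgn x)"
    using assms(1) sphere_density_borel_measurable by (subst AE_density) auto
qed (use assms in simp)

text \<open>The measure lives on the whole space, and \<open>sgn 0 = 0\<close> is not a unit vector;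
  only the null set {0} is sent there.\<close>

lemma AE_sphere_norm: "AE x in (sphere_measure :: 'a::euclidean_space measure). norm x = 1"
proof (rule AE_sphere_measureI)
  show "AE x in (lborel :: 'a measure). norm (sgn x) = 1"
    using AE_lborel_singleton[of "0::'a"] by eventually_elim (simp add: norm_sgn)
qed measurable

lemma AE_inner_nonzero:
  assumes "v \<noteq> (0::'a::euclidean_space)"
  shows "AE x in lborel. v \<bullet> x \<noteq> 0"
proof -
  have "negligible {x. v \<bullet> x = 0}" using assms by (intro negligible_hyperplane) auto
  then have "{x. v \<bullet> x = 0} \<in> null_sets (completion lborel)" by (simp add: negligible_iff_null_sets)
  then have "AE x in completion lborel. \<not> v \<bullet> x = 0" by (auto intro!: AE_I'[of "{x. v \<bullet> x = 0}"])
  then show ?thesis by (subst (asm) AE_completion_iff) auto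
qed

text \<open>A translation and reflection invariant measure is determined by its value on one set; here
  the ball, which orthogonal maps preserve.\<close>

lemma nn_integral_lborel_orthogonal:
  fixes T :: "real^'n \<Rightarrow> real^'n"
  assumes T: "orthogonal_transformation T" and [measurable]: "f \<in> borel_measurable borel"
  shows "(\<integral>\<^sup>+x. f (T x) \<partial>lborel) = (\<integral>\<^sup>+x. f x \<partial>lborel)"
proof -
  have lin: "linear T" using T by (rule orthogonal_transformation_linear)
  have Tm[measurable]: "T \<in> borel_measurable borel"
    by (intro borel_measurable_continuous_onI linear_continuous_on linear_conv_bounded_linear[THEN iffD1] lin)
  obtain S where S: "\<And>x. T (S x) = x"
    using orthogonal_transformation_bij[OF T] by (metis bij_inv_eq_iff)
  have tr: "(\<integral>\<^sup>+x. h (x + a) \<partial>lborel) = (\<integral>\<^sup>+x. h x \<partial>lborel)"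
    if "h \<in> borel_measurable borel" for h :: "real^'n \<Rightarrow> ennreal" and a
  proof -
    have "(\<integral>\<^sup>+x. h x \<partial>(distr lborel borel ((+) a))) = (\<integral>\<^sup>+x. h (a + x) \<partial>lborel)"
      using that by (subst nn_integral_distr) auto
    then show ?thesis by (simp add: lborel_distr_plus add.commute)
  qed
  have neg: "(\<integral>\<^sup>+x. h (- x) \<partial>lborel) = (\<integral>\<^sup>+x. h x \<partial>lborel)"
    if "h \<in> borel_measurable borel" for h :: "real^'n \<Rightarrow> ennreal"
  proof -
    have "(\<integral>\<^sup>+x. h x \<partial>lborel) = (\<integral>\<^sup>+x. h x \<partial>(density (distr lborel borel (\<lambda>x. 0 + (- 1) *\<^sub>R x)) (\<lambda>_. ennreal (\<bar>-1\<bar>^DIM(real^'n)))))"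
      by (subst lborel_affine[of "-1" 0]) auto
    also have "\<dots> = (\<integral>\<^sup>+x. h (- x) \<partial>lborel)"
      using that by (subst nn_integral_density, simp, simp, subst nn_integral_distr) auto
    finally show ?thesis by simp
  qed
  define g where "g = (indicator (ball 0 1) :: real^'n \<Rightarrow> ennreal)"
  have [measurable]: "g \<in> borel_measurable borel" unfolding g_def by (intro borel_measurable_indicator) simp
  have gT: "g (T x) = g x" for x
    by (simp add: g_def indicator_def orthogonal_transformation_norm[OF T])
  have gT': "(\<integral>\<^sup>+x. g (y - T x) \<partial>lborel) = (\<integral>\<^sup>+x. g x \<partial>lborel)" for y
  proof -
    have "y - T x = T (- (x + - S y))" for x
      using S[of y] by (simp add: linear_diff[OF lin] linear_add[OF lin] linear_neg[OF lin])
    then have "(\<integral>\<^sup>+x. g (y - T x) \<partial>lborel) = (\<integral>\<^sup>+x. g (- (x + - S y)) \<partial>lborel)" by (simp only: gT)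
    also have "\<dots> = (\<integral>\<^sup>+x. g (- x) \<partial>lborel)" by (rule tr) measurable
    also have "\<dots> = (\<integral>\<^sup>+x. g x \<partial>lborel)" by (rule neg) measurable
    finally show ?thesis .
  qed
  have fT: "(\<integral>\<^sup>+x. f (T x + y) \<partial>lborel) = (\<integral>\<^sup>+x. f (T x) \<partial>lborel)" for y
  proof -
    have "T x + y = T (x + S y)" for x using S[of y] by (simp add: linear_add[OF lin])
    then have "(\<integral>\<^sup>+x. f (T x + y) \<partial>lborel) = (\<integral>\<^sup>+x. f (T (x + S y)) \<partial>lborel)" by simp
    also have "\<dots> = (\<integral>\<^sup>+x. f (T x) \<partial>lborel)" by (rule tr) measurable
    finally show ?thesis .
  qed
  let ?G = "\<integral>\<^sup>+x. g x \<partial>lborel"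
  \<comment> \<open>The double integral of f(T x + y) g(y) is evaluated in both orders. Translation
    invariance isolates f composed with T in one order and f in the other; the common factor is the
    volume of the ball, positive and finite, hence cancellable.\<close>
  have "(\<integral>\<^sup>+x. f (T x) \<partial>lborel) * ?G = (\<integral>\<^sup>+y. (\<integral>\<^sup>+x. f (T x + y) * g y \<partial>lborel) \<partial>lborel)"
    by (simp add: nn_integral_multc fT nn_integral_cmult)
  also have "\<dots> = (\<integral>\<^sup>+x. (\<integral>\<^sup>+y. f (T x + y) * g y \<partial>lborel) \<partial>lborel)"
    by (rule lborel_pair.Fubini') measurable
  also have "\<dots> = (\<integral>\<^sup>+x. (\<integral>\<^sup>+y. f y * g (y - T x) \<partial>lborel) \<partial>lborel)"
  proof (rule nn_integral_cong)
    fix x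
    have "(\<integral>\<^sup>+y. f (T x + y) * g y \<partial>lborel) = (\<integral>\<^sup>+y. f (y + T x) * g ((y + T x) - T x) \<partial>lborel)"
      by (simp add: add.commute)
    also have "\<dots> = (\<integral>\<^sup>+y. f y * g (y - T x) \<partial>lborel)" by (rule tr) measurable
    finally show "(\<integral>\<^sup>+y. f (T x + y) * g y \<partial>lborel) = (\<integral>\<^sup>+y. f y * g (y - T x) \<partial>lborel)" .
  qed
  also have "\<dots> = (\<integral>\<^sup>+y. (\<integral>\<^sup>+x. f y * g (y - T x) \<partial>lborel) \<partial>lborel)"
    by (rule lborel_pair.Fubini'[symmetric]) measurable
  also have "\<dots> = (\<integral>\<^sup>+y. f y \<partial>lborel) * ?G"
    by (simp add: nn_integral_cmult gT' nn_integral_multc)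
  finally have "(\<integral>\<^sup>+x. f (T x) \<partial>lborel) * ?G = (\<integral>\<^sup>+y. f y \<partial>lborel) * ?G" .
  moreover have "?G = ennreal (unit_ball_vol (real DIM(real^'n)))"
    unfolding g_def by (simp add: emeasure_ball)
  then have "?G \<noteq> 0" "?G \<noteq> top" using unit_ball_vol_pos[of "real CARD('n)"] by (auto simp: ennreal_eq_0_iff not_le[symmetric])
  ultimately show ?thesis by (metis ennreal_mult_cancel_left mult.commute)
qed

lemma distr_lborel_orthogonal:
  fixes T :: "real^'n \<Rightarrow> real^'n"
  assumes T: "orthogonal_transformation T"
  shows "distr lborel borel T = lborel"
proof (rule measure_eqI)
  have lin: "linear T" using T by (rule orthogonal_transformation_linear)
  have [measurable]: "T \<in> borel_measurable borel"
    by (intro borel_measurable_continuous_onI linear_continuous_on linear_conv_bounded_linear[THEN iffD1] lin)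
  fix A assume "A \<in> sets (distr lborel borel T)"
  then have [measurable]: "A \<in> sets borel" by simp
  have "emeasure (distr lborel borel T) A = (\<integral>\<^sup>+x. indicator A (T x) \<partial>lborel)"
  proof -
    have "emeasure (distr lborel borel T) A = (\<integral>\<^sup>+x. indicator A x \<partial>(distr lborel borel T))" by simp
    then show ?thesis by (simp only:) (subst nn_integral_distr, auto)
  qed
  also have "\<dots> = (\<integral>\<^sup>+x. indicator A x \<partial>lborel)"
    by (rule nn_integral_lborel_orthogonal[OF T]) measurable
  finally show "emeasure (distr lborel borel T) A = emeasure lborel A" by simp
qed simp

text \<open>An orthogonal map commutes with \<open>sgn\<close> and preserves the unit ball, so the
  invariance descends from Lebesgue measure through the cone construction.\<close>

lemma distr_sphere_measure_orthogonal:
  fixes T :: "real^'n \<Rightarrow> real^'n"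
  assumes T: "orthogonal_transformation T"
  shows "distr sphere_measure borel T = sphere_measure"
proof -
  let ?h = "\<lambda>x::real^'n. ennreal (real DIM(real^'n)) * indicator (ball 0 1) x"
  have lin: "linear T" using T by (rule orthogonal_transformation_linear)
  have Tm[measurable]: "T \<in> borel_measurable borel"
    by (intro borel_measurable_continuous_onI linear_continuous_on linear_conv_bounded_linear[THEN iffD1] lin)
  have nT: "norm (T x) = norm x" for x using T by (rule orthogonal_transformation_norm)
  have [measurable]: "(sgn :: real^'n \<Rightarrow> real^'n) \<in> borel_measurable borel" by (rule sgn_borel_measurable)
  have "T \<circ> sgn = sgn \<circ> T"
    by (auto simp: fun_eq_iff sgn_div_norm nT linear_scale[OF lin])
  then have "distr sphere_measure borel T = distr (density lborel ?h) borel (sgn \<circ> T)"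
    unfolding sphere_measure_def by (subst distr_distr) auto
  also have "\<dots> = distr (distr (density lborel ?h) borel T) borel sgn"
    by (subst distr_distr) auto
  also have "distr (density lborel ?h) borel T = density (distr lborel borel T) ?h"
  proof (subst density_distr)
    have "?h (T x) = ?h x" for x by (simp add: indicator_def nT)
    then show "distr (density lborel ?h) borel T = distr (density lborel (\<lambda>x. ?h (T x))) borel T" by simp
  qed (use sphere_density_borel_measurable[where 'a="real^'n"] in auto)
  also have "\<dots> = density lborel ?h" by (simp add: distr_lborel_orthogonal[OF T])
  finally show ?thesis by (simp add: sphere_measure_def)
qed

text \<open>A rotation carries \<xi> to its norm times \<open>e\<close>. The distribution of the
  coordinate along \<open>e\<close> is thus one fixed measure serving all \<xi>, and this makes the
  averaged symbol radial in each variable.\<close>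

lemma sphere_integral_rotate:
  fixes g :: "real \<Rightarrow> complex" and \<xi> e :: "real^'n"
  assumes [measurable]: "g \<in> borel_measurable borel" and e: "norm e = 1"
  shows "(\<integral>x. g (\<xi> \<bullet> x) \<partial>sphere_measure) = (\<integral>x. g (norm \<xi> * (e \<bullet> x)) \<partial>sphere_measure)"
proof -
  have "norm \<xi> = norm (norm \<xi> *\<^sub>R e)" using e by simp
  then obtain T where T: "orthogonal_transformation T" "T \<xi> = norm \<xi> *\<^sub>R e"
    using orthogonal_transformation_exists by blast
  have lin: "linear T" using T(1) by (rule orthogonal_transformation_linear)
  have Tm[measurable]: "T \<in> borel_measurable borel"
    by (intro borel_measurable_continuous_onI linear_continuous_on linear_conv_bounded_linear[THEN iffD1] lin)
  have "\<xi> \<bullet> x = norm \<xi> * (e \<bullet> T x)" for x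
    using T unfolding orthogonal_transformation_def by (metis inner_scaleR_left)
  then have "(\<integral>x. g (\<xi> \<bullet> x) \<partial>sphere_measure) = (\<integral>x. g (norm \<xi> * (e \<bullet> T x)) \<partial>sphere_measure)" by simp
  also have "\<dots> = (\<integral>x. g (norm \<xi> * (e \<bullet> x)) \<partial>(distr sphere_measure borel T))"
    by (subst integral_distr) auto
  finally show ?thesis by (simp add: distr_sphere_measure_orthogonal[OF T(1)])
qed

text \<open>This class is closed under partial derivatives because the coefficient \<open>c\<close> absorbs the components
  of the two directions \<open>fst q\<close> and \<open>snd q\<close>.\<close>

inductive slice_integral :: "('a::euclidean_space \<times> 'a) measure \<Rightarrow> ('a \<Rightarrow> complex) \<Rightarrow> (real \<times> real \<Rightarrow> complex) \<Rightarrow> bool"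
  for N h where
  base: "\<lbrakk>schwartz f; schwartz g; c \<in> borel_measurable N; \<And>q. norm (c q) \<le> C;
      \<And>q. norm (fst q) \<noteq> 1 \<or> norm (snd q) \<noteq> 1 \<Longrightarrow> c q = 0\<rbrakk> \<Longrightarrow>
    slice_integral N h (\<lambda>p. \<integral>q. c (fst q) * h (snd q) *
      (f (snd q - fst p *\<^sub>R fst (fst q)) * g (snd q - snd p *\<^sub>R snd (fst q))) \<partial>(N \<Otimes>\<^sub>M lborel))"
| add: "slice_integral N h u \<Longrightarrow> slice_integral N h v \<Longrightarrow> slice_integral N h (\<lambda>p. u p + v p)"

section \<open>Slices of the trilinear form along pairs of directions are Schwartz functions\<close>

lemma slice_integral_zero: "slice_integral N h (\<lambda>p. 0)"
  using slice_integral.base[OF schwartz_zero schwartz_zero, of "\<lambda>q. 0" N 0 h] by simp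

lemma slice_integral_sum:
  assumes "finite I" "\<And>i. i \<in> I \<Longrightarrow> slice_integral N h (u i)"
  shows "slice_integral N h (\<lambda>p. \<Sum>i\<in>I. u i p)"
  using assms
proof (induction I rule: finite_induct)
  case empty
  then show ?case using slice_integral_zero by simp
next
  case (insert i I)
  then show ?case using slice_integral.add[of N h "u i" "\<lambda>p. \<Sum>i\<in>I. u i p"] by simp
qed

context
  fixes N :: "('a::euclidean_space \<times> 'a) measure" and h :: "'a \<Rightarrow> complex"
  assumes N: "finite_measure N" and setsN [measurable_cong]: "sets N = sets (borel \<Otimes>\<^sub>M borel)"
    and h: "schwartz h"
begin

lemma slice_integrable_weight:
  "integrable (N \<Otimes>\<^sub>M lborel) (\<lambda>q. complex_of_real (D * (1 + norm (snd q)) ^ k * norm (h (snd q))))"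
proof -
  have "integrable (N \<Otimes>\<^sub>M lborel) (\<lambda>(q, x). complex_of_real D * complex_of_real ((1 + norm x) ^ k * norm (h x)))"
  proof (rule integrable_pair_mult)
    show "sigma_finite_measure N"
      using N by (simp add: finite_measure_def)
    show "integrable N (\<lambda>q. complex_of_real D)"
      using N finite_measure.integrable_const by blast
    show "integrable lborel (\<lambda>x. complex_of_real ((1 + norm x) ^ k * norm (h x)))"
      by (intro integrable_of_real schwartz_integrable_weight h)
  qed (rule sigma_finite_lborel)
  then show ?thesis by (simp add: case_prod_unfold mult_ac)
qed

lemma slice_integrable:
  assumes f: "schwartz f" and g: "schwartz g" and c[measurable]: "c \<in> borel_measurable N" and C: "\<And>q. norm (c q) \<le> C"
  shows "integrable (N \<Otimes>\<^sub>M lborel) (\<lambda>q. c (fst q) * h (snd q) *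
      (f (snd q - fst p *\<^sub>R fst (fst q)) * g (snd q - snd p *\<^sub>R snd (fst q))))"
proof -
  have [measurable]: "f \<in> borel_measurable borel" "g \<in> borel_measurable borel" "h \<in> borel_measurable borel"
    using f g h by auto
  obtain B1 where B1: "B1 > 0" "\<And>x. (1 + norm x) ^ 0 * norm (f x) \<le> B1"
    using rapidly_decreasingD[OF schwartz_rapidly_decreasing[OF f]] by blast
  obtain B2 where B2: "B2 > 0" "\<And>x. (1 + norm x) ^ 0 * norm (g x) \<le> B2"
    using rapidly_decreasingD[OF schwartz_rapidly_decreasing[OF g]] by blast
  show ?thesis
  proof (rule Bochner_Integration.integrable_bound[OF slice_integrable_weight[of "C * B1 * B2" 0]])
    show "AE q in N \<Otimes>\<^sub>M lborel. norm (c (fst q) * h (snd q) * (f (snd q - fst p *\<^sub>R fst (fst q)) * g (snd q - snd p *\<^sub>R snd (fst q))))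
      \<le> norm (complex_of_real (C * B1 * B2 * (1 + norm (snd q)) ^ 0 * norm (h (snd q))))"
    proof (rule AE_I2)
      fix q
      have C0: "0 \<le> C" using C[of "fst q"] norm_ge_zero order_trans by blast
      have "norm (c (fst q) * h (snd q) * (f (snd q - fst p *\<^sub>R fst (fst q)) * g (snd q - snd p *\<^sub>R snd (fst q))))
        \<le> C * norm (h (snd q)) * (B1 * B2)"
        unfolding norm_mult using C B1 B2 C0 by (intro mult_mono) auto
      then show "norm (c (fst q) * h (snd q) * (f (snd q - fst p *\<^sub>R fst (fst q)) * g (snd q - snd p *\<^sub>R snd (fst q))))
        \<le> norm (complex_of_real (C * B1 * B2 * (1 + norm (snd q)) ^ 0 * norm (h (snd q))))"
        using C0 B1(1) B2(1) by (simp add: abs_mult mult_ac norm_mult)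
    qed
  qed measurable
qed

text \<open>Differentiating in \<open>r\<close> produces minus the derivative of \<open>f\<close>
  along \<theta>, a sum over the basis of components of \<theta> times partials of \<open>f\<close>.
  The unit length of the directions bounds these components, and where a direction is not a unit
  vector the coefficient vanishes.\<close>

lemma slice_integral_derivative:
  assumes "slice_integral N h u"
  shows "\<exists>D. (\<forall>p. (u has_derivative D p) (at p)) \<and> (\<forall>b\<in>Basis. slice_integral N h (\<lambda>p. D p b))"
  using assms
proof induction
  case (base f g c C)
  note f = base(1) and g = base(2) and c[measurable] = base(3) and C = base(4) and c0 = base(5)
  have [measurable]: "f \<in> borel_measurable borel" "g \<in> borel_measurable borel" "h \<in> borel_measurable borel"
    using f g h by auto
  let ?Q = "N \<Otimes>\<^sub>M (lborel :: 'a measure)"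
  let ?f = "\<lambda>p q. f (snd q - fst p *\<^sub>R fst (fst q))" and ?g = "\<lambda>p q. g (snd q - snd p *\<^sub>R snd (fst q))"
  let ?Df = "\<lambda>p q. \<Sum>b\<in>Basis. (- (fst (fst q) \<bullet> b)) *\<^sub>R dpartial b f (snd q - fst p *\<^sub>R fst (fst q))"
  let ?Dg = "\<lambda>p q. \<Sum>b\<in>Basis. (- (snd (fst q) \<bullet> b)) *\<^sub>R dpartial b g (snd q - snd p *\<^sub>R snd (fst q))"
  define D where "D p q v = c (fst q) * h (snd q) * (?f p q * (snd v *\<^sub>R ?Dg p q) + (fst v *\<^sub>R ?Df p q) * ?g p q)"
    for p :: "real \<times> real" and q and v :: "real \<times> real"
  have dm[measurable]: "dpartial b f \<in> borel_measurable borel" "dpartial b g \<in> borel_measurable borel" if "b \<in> Basis" for b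
    using that f g by (auto intro!: schwartz_borel_measurable schwartz_dpartial)
  have Dfm[measurable]: "(\<lambda>q. ?Df p q) \<in> borel_measurable ?Q" "(\<lambda>q. ?Dg p q) \<in> borel_measurable ?Q" for p
    by (auto intro!: borel_measurable_sum borel_measurable_scaleR measurable_compose[OF _ dm(1)] measurable_compose[OF _ dm(2)])
  have chain: "((\<lambda>t. F (x - t *\<^sub>R \<theta>)) has_derivative (\<lambda>v. v *\<^sub>R (\<Sum>b\<in>Basis. (- (\<theta> \<bullet> b)) *\<^sub>R dpartial b F (x - t *\<^sub>R \<theta>)))) (at t)"
    if F: "schwartz F" for F :: "'a \<Rightarrow> complex" and x \<theta> t
  proof -
    have 1: "((\<lambda>t. x - t *\<^sub>R \<theta>) has_derivative (\<lambda>v. - (v *\<^sub>R \<theta>))) (at t)"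
      by (auto intro!: derivative_eq_intros)
    show ?thesis
      using has_derivative_compose[OF 1 schwartz_has_derivative[OF F]]
      by (simp add: scaleR_sum_right)
  qed
  have der: "((\<lambda>p. c (fst q) * h (snd q) * (?f p q * ?g p q)) has_derivative D p q) (at p)" for p q
  proof -
    have 1: "((\<lambda>p. ?f p q) has_derivative (\<lambda>v. fst v *\<^sub>R ?Df p q)) (at p)"
      by (rule has_derivative_compose[OF has_derivative_fst[OF has_derivative_ident] chain[OF f]])
    have 2: "((\<lambda>p. ?g p q) has_derivative (\<lambda>v. snd v *\<^sub>R ?Dg p q)) (at p)"
      by (rule has_derivative_compose[OF has_derivative_snd[OF has_derivative_ident] chain[OF g]])
    show ?thesis
      unfolding D_def[abs_def] by (intro has_derivative_mult_right has_derivative_mult 1 2)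
  qed
  obtain B1 where B1: "B1 > 0" "\<And>x. (1 + norm x) ^ 0 * norm (f x) \<le> B1"
    using rapidly_decreasingD[OF schwartz_rapidly_decreasing[OF f]] by blast
  obtain B2 where B2: "B2 > 0" "\<And>x. (1 + norm x) ^ 0 * norm (g x) \<le> B2"
    using rapidly_decreasingD[OF schwartz_rapidly_decreasing[OF g]] by blast
  have dbound: "\<exists>A>0. \<forall>x \<theta>. norm \<theta> = 1 \<longrightarrow> norm (\<Sum>b\<in>Basis. (- (\<theta> \<bullet> b)) *\<^sub>R dpartial b F x) \<le> A"
    if F: "schwartz F" for F :: "'a \<Rightarrow> complex"
  proof -
    obtain A where A: "A > 0" "\<And>x v. norm (frechet_derivative F (at x) v) \<le> A / (1 + norm x) ^ 0 * norm v"
      using schwartz_derivative_bound[OF F] by blast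
    have "(\<Sum>b\<in>Basis. (- (\<theta> \<bullet> b)) *\<^sub>R dpartial b F x) = frechet_derivative F (at x) (- \<theta>)" for x \<theta>
      using fun_cong[OF frechet_derivative_at[OF schwartz_has_derivative[OF F, of x]], of "- \<theta>"] by simp
    then show ?thesis using A by (intro exI[of _ A]) (metis div_by_1 mult.right_neutral norm_minus_cancel power_0)
  qed
  obtain A1 where A1: "A1 > 0" "\<And>x \<theta>. norm \<theta> = 1 \<Longrightarrow> norm (\<Sum>b\<in>Basis. (- (\<theta> \<bullet> b)) *\<^sub>R dpartial b f x) \<le> A1"
    using dbound[OF f] by blast
  obtain A2 where A2: "A2 > 0" "\<And>x \<theta>. norm \<theta> = 1 \<Longrightarrow> norm (\<Sum>b\<in>Basis. (- (\<theta> \<bullet> b)) *\<^sub>R dpartial b g x) \<le> A2"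
    using dbound[OF g] by blast
  have Dbound: "norm (D p q v) \<le> norm (complex_of_real (C * (B1 * A2 + A1 * B2) * (1 + norm (snd q)) ^ 0 * norm (h (snd q)))) * norm v" for p q v
  proof (cases "norm (fst (fst q)) = 1 \<and> norm (snd (fst q)) = 1")
    case True
    have C0: "0 \<le> C" using C[of "fst q"] norm_ge_zero order_trans by blast
    have v: "norm (fst v) \<le> norm v" "norm (snd v) \<le> norm v" using norm_fst_le[of "fst v" "snd v"] norm_snd_le[of "snd v" "fst v"] by auto
    have "norm (?f p q * (snd v *\<^sub>R ?Dg p q) + (fst v *\<^sub>R ?Df p q) * ?g p q)
      \<le> norm (?f p q) * (norm (snd v) * norm (?Dg p q)) + (norm (fst v) * norm (?Df p q)) * norm (?g p q)"
      by (rule order_trans[OF norm_triangle_ineq]) (simp add: norm_mult)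
    also have "\<dots> \<le> B1 * (norm v * A2) + (norm v * A1) * B2"
      using True B1 B2 v A1 A2 by (intro add_mono mult_mono) auto
    also have "\<dots> = (B1 * A2 + A1 * B2) * norm v" by (simp add: algebra_simps)
    finally have 1: "norm (?f p q * (snd v *\<^sub>R ?Dg p q) + (fst v *\<^sub>R ?Df p q) * ?g p q) \<le> (B1 * A2 + A1 * B2) * norm v" .
    have "norm (D p q v) \<le> C * norm (h (snd q)) * ((B1 * A2 + A1 * B2) * norm v)"
      unfolding D_def norm_mult[of "c (fst q) * h (snd q)"] norm_mult[of "c (fst q)"]
      using 1 C C0 by (intro mult_mono) auto
    moreover have "norm (complex_of_real (C * (B1 * A2 + A1 * B2) * (1 + norm (snd q)) ^ 0 * norm (h (snd q))))
       = C * (B1 * A2 + A1 * B2) * norm (h (snd q))"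
      unfolding norm_of_real using C0 A1(1) A2(1) B1(1) B2(1) by (subst abs_of_nonneg) auto
    ultimately show ?thesis by (simp only: mult_ac)
  next
    case False
    then have "D p q v = 0" using c0[of "fst q"] by (auto simp: D_def)
    then show ?thesis by simp
  qed
  have Dm: "(\<lambda>q. D p q v) \<in> borel_measurable ?Q" for p v
    unfolding D_def by measurable
  have "((\<lambda>p. \<integral>q. c (fst q) * h (snd q) * (?f p q * ?g p q) \<partial>?Q) has_derivative (\<lambda>v. \<integral>q. D p q v \<partial>?Q)) (at p)" for p
  proof (rule has_derivative_integral[of UNIV _ _ _ _ "\<lambda>q. norm (complex_of_real (C * (B1 * A2 + A1 * B2) * (1 + norm (snd q)) ^ 0 * norm (h (snd q))))"])
    show "integrable ?Q (\<lambda>q. c (fst q) * h (snd q) * (?f p q * ?g p q))" for p by (rule slice_integrable[OF f g c C])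
    show "integrable ?Q (\<lambda>q. norm (complex_of_real (C * (B1 * A2 + A1 * B2) * (1 + norm (snd q)) ^ 0 * norm (h (snd q)))))"
      by (rule integrable_norm[OF slice_integrable_weight])
    show "(\<lambda>q. D p q v) \<in> borel_measurable ?Q" for v by (rule Dm)
  qed (use der Dbound in auto)
  moreover have "slice_integral N h (\<lambda>p. \<integral>q. D p q v \<partial>?Q)" if v: "v \<in> Basis" for v
  proof -
    \<comment> \<open>A component of a unit vector is at most 1 in absolute value, so the new
      coefficient obeys the same bound \<open>C\<close>.\<close>
    have weight: "c' \<in> borel_measurable N" "norm (c' q) \<le> C" "norm (fst q) \<noteq> 1 \<or> norm (snd q) \<noteq> 1 \<Longrightarrow> c' q = 0"
      if "b \<in> Basis" "c' = (\<lambda>q. complex_of_real (- (fst q \<bullet> b)) * c q) \<or> c' = (\<lambda>q. complex_of_real (- (snd q \<bullet> b)) * c q)" for b c' q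
    proof -
      show "c' \<in> borel_measurable N" using that(2) by auto
      show *: "norm (fst q) \<noteq> 1 \<or> norm (snd q) \<noteq> 1 \<Longrightarrow> c' q = 0" using that(2) c0[of q] by auto
      show "norm (c' q) \<le> C"
      proof (cases "norm (fst q) \<noteq> 1 \<or> norm (snd q) \<noteq> 1")
        case True
        then show ?thesis using * C[of q] norm_ge_zero[of "c q"] by (metis norm_zero order_trans)
      next
        case False
        then have "\<bar>fst q \<bullet> b\<bar> \<le> 1" "\<bar>snd q \<bullet> b\<bar> \<le> 1"
          using Basis_le_norm[OF \<open>b \<in> Basis\<close>, of "fst q"] Basis_le_norm[OF \<open>b \<in> Basis\<close>, of "snd q"] by auto
        then have "norm (c' q) \<le> 1 * norm (c q)"
          using that(2) by (auto simp: norm_mult intro!: mult_left_le_one_le mult_right_mono)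
        then show ?thesis using C[of q] by simp
      qed
    qed
    \<comment> \<open>The first basis vector of the plane differentiates \<open>f\<close> along the
      first direction, the second differentiates \<open>g\<close> along the second.\<close>
    consider "v = (1, 0)" | "v = (0, 1)" using v by (auto simp: Basis_prod_def)
    then show ?thesis
    proof cases
      case 1
      have "(\<integral>q. D p q v \<partial>?Q) = (\<Sum>b\<in>Basis. \<integral>q. (complex_of_real (- (fst (fst q) \<bullet> b)) * c (fst q)) * h (snd q) * (dpartial b f (snd q - fst p *\<^sub>R fst (fst q)) * g (snd q - snd p *\<^sub>R snd (fst q))) \<partial>?Q)" for p
      proof (subst Bochner_Integration.integral_sum[symmetric])
        fix b :: 'a assume b: "b \<in> Basis"
        show "integrable ?Q (\<lambda>q. (complex_of_real (- (fst (fst q) \<bullet> b)) * c (fst q)) * h (snd q) * (dpartial b f (snd q - fst p *\<^sub>R fst (fst q)) * g (snd q - snd p *\<^sub>R snd (fst q))))"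
          using slice_integrable[OF schwartz_dpartial[OF f b] g weight(1,2)[OF b disjI1[OF refl]]] .
      next
        show "(\<integral>q. D p q v \<partial>?Q) = (\<integral>q. (\<Sum>b\<in>Basis. (complex_of_real (- (fst (fst q) \<bullet> b)) * c (fst q)) * h (snd q) * (dpartial b f (snd q - fst p *\<^sub>R fst (fst q)) * g (snd q - snd p *\<^sub>R snd (fst q)))) \<partial>?Q)"
          by (intro Bochner_Integration.integral_cong refl)
             (simp add: D_def 1 sum_distrib_left sum_distrib_right scaleR_conv_of_real mult_ac)
      qed
      then show ?thesis
      proof (simp only:, intro slice_integral_sum[OF finite_Basis])
        fix b :: 'a assume b: "b \<in> Basis"
        let ?c = "\<lambda>q. complex_of_real (- (fst q \<bullet> b)) * c q"
        have "slice_integral N h (\<lambda>p. \<integral>q. ?c (fst q) * h (snd q) * (dpartial b f (snd q - fst p *\<^sub>R fst (fst q)) * g (snd q - snd p *\<^sub>R snd (fst q))) \<partial>?Q)"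
          by (rule slice_integral.base[OF schwartz_dpartial[OF f b] g]) (use weight[OF b disjI1[OF refl]] in blast)+
        then show "slice_integral N h (\<lambda>p. \<integral>q. complex_of_real (- (fst (fst q) \<bullet> b)) * c (fst q) * h (snd q) * (dpartial b f (snd q - fst p *\<^sub>R fst (fst q)) * g (snd q - snd p *\<^sub>R snd (fst q))) \<partial>?Q)" .
      qed
    next
      case 2
      have "(\<integral>q. D p q v \<partial>?Q) = (\<Sum>b\<in>Basis. \<integral>q. (complex_of_real (- (snd (fst q) \<bullet> b)) * c (fst q)) * h (snd q) * (f (snd q - fst p *\<^sub>R fst (fst q)) * dpartial b g (snd q - snd p *\<^sub>R snd (fst q))) \<partial>?Q)" for p
      proof (subst Bochner_Integration.integral_sum[symmetric])
        fix b :: 'a assume b: "b \<in> Basis"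
        show "integrable ?Q (\<lambda>q. (complex_of_real (- (snd (fst q) \<bullet> b)) * c (fst q)) * h (snd q) * (f (snd q - fst p *\<^sub>R fst (fst q)) * dpartial b g (snd q - snd p *\<^sub>R snd (fst q))))"
          using slice_integrable[OF f schwartz_dpartial[OF g b] weight(1,2)[OF b disjI2[OF refl]]] .
      next
        show "(\<integral>q. D p q v \<partial>?Q) = (\<integral>q. (\<Sum>b\<in>Basis. (complex_of_real (- (snd (fst q) \<bullet> b)) * c (fst q)) * h (snd q) * (f (snd q - fst p *\<^sub>R fst (fst q)) * dpartial b g (snd q - snd p *\<^sub>R snd (fst q)))) \<partial>?Q)"
          by (intro Bochner_Integration.integral_cong refl)
             (simp add: D_def 2 sum_distrib_left sum_distrib_right scaleR_conv_of_real mult_ac)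
      qed
      then show ?thesis
      proof (simp only:, intro slice_integral_sum[OF finite_Basis])
        fix b :: 'a assume b: "b \<in> Basis"
        let ?c = "\<lambda>q. complex_of_real (- (snd q \<bullet> b)) * c q"
        have "slice_integral N h (\<lambda>p. \<integral>q. ?c (fst q) * h (snd q) * (f (snd q - fst p *\<^sub>R fst (fst q)) * dpartial b g (snd q - snd p *\<^sub>R snd (fst q))) \<partial>?Q)"
          by (rule slice_integral.base[OF f schwartz_dpartial[OF g b]]) (use weight[OF b disjI2[OF refl]] in blast)+
        then show "slice_integral N h (\<lambda>p. \<integral>q. complex_of_real (- (snd (fst q) \<bullet> b)) * c (fst q) * h (snd q) * (f (snd q - fst p *\<^sub>R fst (fst q)) * dpartial b g (snd q - snd p *\<^sub>R snd (fst q))) \<partial>?Q)" .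
      qed
    qed
  qed
  ultimately show ?case
    by (intro exI[of _ "\<lambda>p v. \<integral>q. D p q v \<partial>?Q"] conjI allI ballI)
next
  case (add u v)
  then obtain D E where "\<And>p. (u has_derivative D p) (at p)" "\<And>b. b \<in> Basis \<Longrightarrow> slice_integral N h (\<lambda>p. D p b)"
    "\<And>p. (v has_derivative E p) (at p)" "\<And>b. b \<in> Basis \<Longrightarrow> slice_integral N h (\<lambda>p. E p b)" by metis
  then show ?case
    by (intro exI[of _ "\<lambda>p b. D p b + E p b"]) (auto intro!: has_derivative_add slice_integral.add)
qed

text \<open>For a unit vector \<theta>, the size of \<open>r\<close> is at most |x| + |x - r
  \<theta>|, so the decay of \<open>f\<close> becomes decay in \<open>r\<close> at the price of a
  weight in \<open>x\<close>, which \<open>h\<close> absorbs. Both radial variables do this, whence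
  the exponent \<open>2 * k\<close>.\<close>

lemma slice_integral_rapidly_decreasing:
  assumes "slice_integral N h u"
  shows "rapidly_decreasing u"
  using assms
proof induction
  case (base f g c C)
  note f = base(1) and g = base(2) and c[measurable] = base(3) and C = base(4) and c0 = base(5)
  let ?Q = "N \<Otimes>\<^sub>M (lborel :: 'a measure)"
  let ?F = "\<lambda>p q. c (fst q) * h (snd q) * (f (snd q - fst p *\<^sub>R fst (fst q)) * g (snd q - snd p *\<^sub>R snd (fst q)))"
  show ?case
  proof (rule rapidly_decreasingI)
    fix k
    obtain B1 where B1: "B1 > 0" "\<And>x. (1 + norm x) ^ k * norm (f x) \<le> B1"
      using rapidly_decreasingD[OF schwartz_rapidly_decreasing[OF f]] by blast
    obtain B2 where B2: "B2 > 0" "\<And>x. (1 + norm x) ^ k * norm (g x) \<le> B2"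
      using rapidly_decreasingD[OF schwartz_rapidly_decreasing[OF g]] by blast
    have line: "(1 + \<bar>r\<bar>) ^ k * norm (F (x - r *\<^sub>R \<theta>)) \<le> (1 + norm x) ^ k * B"
      if "norm \<theta> = 1" "\<And>x. (1 + norm x) ^ k * norm (F x) \<le> B" for F :: "'a \<Rightarrow> complex" and r x \<theta> B
    proof -
      have "1 + \<bar>r\<bar> \<le> (1 + norm x) * (1 + norm (x - r *\<^sub>R \<theta>))"
        using one_plus_norm_le[of "r *\<^sub>R \<theta>" "- x"] that(1)
        by (simp add: norm_minus_commute[of x] mult.commute)
      then have "(1 + \<bar>r\<bar>) ^ k * norm (F (x - r *\<^sub>R \<theta>)) \<le> ((1 + norm x) * (1 + norm (x - r *\<^sub>R \<theta>))) ^ k * norm (F (x - r *\<^sub>R \<theta>))"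
        by (intro mult_right_mono power_mono) auto
      also have "\<dots> = (1 + norm x) ^ k * ((1 + norm (x - r *\<^sub>R \<theta>)) ^ k * norm (F (x - r *\<^sub>R \<theta>)))"
        by (simp add: power_mult_distrib)
      also have "\<dots> \<le> (1 + norm x) ^ k * B" by (intro mult_left_mono that) auto
      finally show ?thesis .
    qed
    let ?W = "\<lambda>q. C * B1 * B2 * (1 + norm (snd q)) ^ (2 * k) * norm (h (snd q))"
    have "norm p ^ k * norm (\<integral>q. ?F p q \<partial>?Q) \<le> (\<integral>q. norm (complex_of_real (?W q)) \<partial>?Q)" for p :: "real \<times> real"
    proof -
      have "norm p ^ k * norm (\<integral>q. ?F p q \<partial>?Q) = norm (\<integral>q. norm p ^ k *\<^sub>R ?F p q \<partial>?Q)" by simp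
      also have "\<dots> \<le> (\<integral>q. norm (complex_of_real (?W q)) \<partial>?Q)"
      proof (rule order_trans[OF integral_norm_bound Bochner_Integration.integral_mono])
        show "integrable ?Q (\<lambda>q. norm (norm p ^ k *\<^sub>R ?F p q))"
          by (intro integrable_norm integrable_scaleR_right slice_integrable[OF f g c C])
        show "integrable ?Q (\<lambda>q. norm (complex_of_real (?W q)))" by (rule integrable_norm[OF slice_integrable_weight])
        fix q
        show "norm (norm p ^ k *\<^sub>R ?F p q) \<le> norm (complex_of_real (?W q))"
        proof (cases "norm (fst (fst q)) = 1 \<and> norm (snd (fst q)) = 1")
          case True
          have C0: "0 \<le> C" using C[of "fst q"] norm_ge_zero order_trans by blast
          let ?a = "norm (f (snd q - fst p *\<^sub>R fst (fst q)))" and ?b = "norm (g (snd q - snd p *\<^sub>R snd (fst q)))"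
          have "norm p \<le> \<bar>fst p\<bar> + \<bar>snd p\<bar>" using norm_Pair_le[of "fst p" "snd p"] by simp
          also have "\<dots> \<le> (1 + \<bar>fst p\<bar>) * (1 + \<bar>snd p\<bar>)" by (simp add: algebra_simps)
          finally have "norm p ^ k \<le> ((1 + \<bar>fst p\<bar>) * (1 + \<bar>snd p\<bar>)) ^ k" by (intro power_mono) auto
          then have "norm p ^ k * (?a * ?b) \<le> ((1 + \<bar>fst p\<bar>) * (1 + \<bar>snd p\<bar>)) ^ k * (?a * ?b)"
            by (intro mult_right_mono) auto
          also have "\<dots> = ((1 + \<bar>fst p\<bar>) ^ k * ?a) * ((1 + \<bar>snd p\<bar>) ^ k * ?b)"
            by (simp add: power_mult_distrib)
          also have "\<dots> \<le> ((1 + norm (snd q)) ^ k * B1) * ((1 + norm (snd q)) ^ k * B2)"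
            using True B1 B2 by (intro mult_mono line) auto
          finally have 1: "norm p ^ k * (?a * ?b) \<le> ((1 + norm (snd q)) ^ k * B1) * ((1 + norm (snd q)) ^ k * B2)" .
          have "norm (norm p ^ k *\<^sub>R ?F p q) = norm (c (fst q)) * (norm (h (snd q)) * (norm p ^ k * (?a * ?b)))"
            by (simp add: norm_mult)
          also have "\<dots> \<le> C * (norm (h (snd q)) * (((1 + norm (snd q)) ^ k * B1) * ((1 + norm (snd q)) ^ k * B2)))"
            by (rule mult_mono[OF C mult_left_mono[OF 1]]) (auto intro: C0)
          also have "\<dots> = ?W q"
          proof -
            have "(1 + norm (snd q)) ^ (2 * k) = (1 + norm (snd q)) ^ k * (1 + norm (snd q)) ^ k"
              by (simp only: mult_2 power_add)
            then show ?thesis by (simp only: mult_ac)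
          qed
          also have "\<dots> \<le> norm (complex_of_real (?W q))" by (simp only: norm_of_real abs_ge_self)
          finally show ?thesis .
        next
          case False
          then have "c (fst q) = 0" using c0[of "fst q"] by auto
          then show ?thesis by simp
        qed
      qed
      finally show ?thesis .
    qed
    then show "\<exists>K. \<forall>p. norm p ^ k * norm (\<integral>q. ?F p q \<partial>?Q) \<le> K" by blast
  qed
next
  case (add u v)
  then show ?case by (simp add: rapidly_decreasing_add)
qed

lemma slice_integral_schwartz: "slice_integral N h u \<Longrightarrow> schwartz u"
  by (rule schwartz_coinduct(1)[of "slice_integral N h", OF _ slice_integral_derivative slice_integral_rapidly_decreasing])

end

section \<open>Radial extension of the kernel\<close>

text \<open>Inversion expands \<open>f\<close> and \<open>g\<close> in characters, and the remaining
  integral over \<open>x\<close> is the transform of \<open>h\<close> at -(\<xi> + \<eta>). The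
  function of (y, z) given to the kernel is thereby a superposition of characters.\<close>

lemma trilinear_form_fourier:
  fixes f g h :: "'a::euclidean_space \<Rightarrow> complex"
  assumes f: "schwartz f" and g: "schwartz g" and h: "schwartz h"
  shows "(\<integral>x. f (x - y) * g (x - z) * h x \<partial>lborel) =
    (\<integral>q. fourier f (fst q) * fourier g (snd q) * fourier h (- (fst q + snd q)) *
      cis (- 2 * pi * (y \<bullet> fst q + z \<bullet> snd q)) \<partial>(lborel \<Otimes>\<^sub>M lborel))"
proof -
  let ?L = "(lborel :: 'a measure) \<Otimes>\<^sub>M (lborel :: 'a measure)"
  have [measurable]: "fourier f \<in> borel_measurable borel" "fourier g \<in> borel_measurable borel"
    "h \<in> borel_measurable borel"
    using f g h by (auto intro!: fourier_borel_measurable)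
  have sL: "sigma_finite_measure ?L" by (rule lborel_pair.P.sigma_finite_measure_axioms)
  interpret R: pair_sigma_finite "lborel :: 'a measure" ?L
    using sL sigma_finite_lborel by (simp add: pair_sigma_finite_def)
  have fi: "integrable lborel (\<lambda>\<xi>. fourier F \<xi> * cis (2 * pi * (x \<bullet> \<xi>)))"
    if F: "schwartz F" for F :: "'a \<Rightarrow> complex" and x
  proof (rule Bochner_Integration.integrable_bound[OF fourier_schwartz_integrable[OF F]])
    have [measurable]: "fourier F \<in> borel_measurable borel" using F by (auto intro!: fourier_borel_measurable)
    show "(\<lambda>\<xi>. fourier F \<xi> * cis (2 * pi * (x \<bullet> \<xi>))) \<in> borel_measurable lborel"
      unfolding cis_conv_exp by measurable
  qed (auto simp: norm_mult)
  let ?E = "\<lambda>x q. fourier f (fst q) * fourier g (snd q) * (cis (- 2 * pi * (y \<bullet> fst q + z \<bullet> snd q)) * (cis (2 * pi * (x \<bullet> (fst q + snd q))) * h x))"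
  have 1: "f (x - y) * g (x - z) * h x = (\<integral>q. ?E x q \<partial>?L)" for x
  proof -
    have "f (x - y) * g (x - z) = (\<integral>(\<xi>, \<eta>). (fourier f \<xi> * cis (2 * pi * ((x - y) \<bullet> \<xi>))) * (fourier g \<eta> * cis (2 * pi * ((x - z) \<bullet> \<eta>))) \<partial>?L)"
      by (subst integral_pair_mult[OF sigma_finite_lborel sigma_finite_lborel fi[OF f] fi[OF g]])
         (simp only: fourier_inversion[OF f] fourier_inversion[OF g])
    then have "f (x - y) * g (x - z) * h x = (\<integral>q. ((fourier f (fst q) * cis (2 * pi * ((x - y) \<bullet> fst q))) * (fourier g (snd q) * cis (2 * pi * ((x - z) \<bullet> snd q)))) * h x \<partial>?L)"
      by (simp only: case_prod_unfold integral_mult_left_zero)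
    also have "\<dots> = (\<integral>q. ?E x q \<partial>?L)"
    proof (rule Bochner_Integration.integral_cong[OF refl])
      fix q :: "'a \<times> 'a"
      have "cis (2 * pi * ((x - y) \<bullet> fst q)) * cis (2 * pi * ((x - z) \<bullet> snd q)) = cis (- 2 * pi * (y \<bullet> fst q + z \<bullet> snd q)) * cis (2 * pi * (x \<bullet> (fst q + snd q)))"
        by (simp add: cis_mult inner_diff_left inner_add_right algebra_simps)
      moreover have "((A * c1) * (B * c2)) * u = A * B * (d1 * (d2 * u))" if "c1 * c2 = d1 * d2" for A B c1 c2 d1 d2 u :: complex
      proof -
        have "((A * c1) * (B * c2)) * u = A * B * ((c1 * c2) * u)" by (simp only: mult_ac)
        also have "\<dots> = A * B * (d1 * (d2 * u))" unfolding that by (simp only: mult.assoc)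
        finally show ?thesis .
      qed
      ultimately show "((fourier f (fst q) * cis (2 * pi * ((x - y) \<bullet> fst q))) * (fourier g (snd q) * cis (2 * pi * ((x - z) \<bullet> snd q)))) * h x = ?E x q"
        by blast
    qed
    finally show ?thesis .
  qed
  have i: "integrable (lborel \<Otimes>\<^sub>M ?L) (\<lambda>(x, q). ?E x q)"
  proof (rule Bochner_Integration.integrable_bound)
    show "integrable (lborel \<Otimes>\<^sub>M ?L) (\<lambda>(x, q). h x * (case q of (\<xi>, \<eta>) \<Rightarrow> fourier f \<xi> * fourier g \<eta>))"
      by (intro integrable_pair_mult sigma_finite_lborel sL schwartz_integrable h fourier_schwartz_integrable f g)
    show "(\<lambda>(x, q). ?E x q) \<in> borel_measurable (lborel \<Otimes>\<^sub>M ?L)"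
      unfolding cis_conv_exp case_prod_unfold by measurable
  qed (auto simp: norm_mult mult_ac)
  have "(\<integral>x. f (x - y) * g (x - z) * h x \<partial>lborel) = (\<integral>q. (\<integral>x. ?E x q \<partial>lborel) \<partial>?L)"
    unfolding 1 by (rule R.Fubini_integral[OF i, symmetric])
  also have "\<dots> = (\<integral>q. fourier f (fst q) * fourier g (snd q) * fourier h (- (fst q + snd q)) * cis (- 2 * pi * (y \<bullet> fst q + z \<bullet> snd q)) \<partial>?L)"
  proof (rule Bochner_Integration.integral_cong[OF refl])
    fix q :: "'a \<times> 'a"
    have "(\<integral>x. cis (2 * pi * (x \<bullet> (fst q + snd q))) * h x \<partial>lborel) = fourier h (- (fst q + snd q))"
      unfolding fourier_def inner_minus_right by simp
    then have "(\<integral>x. ?E x q \<partial>lborel) = fourier f (fst q) * fourier g (snd q) * (cis (- 2 * pi * (y \<bullet> fst q + z \<bullet> snd q)) * fourier h (- (fst q + snd q)))"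
      by (simp only: integral_mult_right_zero)
    then show "(\<integral>x. ?E x q \<partial>lborel) = fourier f (fst q) * fourier g (snd q) * fourier h (- (fst q + snd q)) * cis (- 2 * pi * (y \<bullet> fst q + z \<bullet> snd q))"
      by (simp only: mult_ac)
  qed
  finally show ?thesis .
qed

text \<open>The first two factors supply decay in \<xi> and in \<eta>; the third depends only on the
  sum and serves as a bounded factor.\<close>

lemma fourier_triple_integrable:
  fixes f g h :: "'a::euclidean_space \<Rightarrow> complex"
  assumes f: "schwartz f" and g: "schwartz g" and h: "schwartz h"
  shows "integrable (lborel \<Otimes>\<^sub>M lborel) (\<lambda>q. fourier f (fst q) * fourier g (snd q) * fourier h (- (fst q + snd q)))"
proof -
  have [measurable]: "fourier f \<in> borel_measurable borel" "fourier g \<in> borel_measurable borel"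
    "fourier h \<in> borel_measurable borel"
    using f g h by (auto intro!: fourier_borel_measurable)
  obtain B where B: "B > 0" "\<And>x. (1 + norm x) ^ 0 * norm (fourier h x) \<le> B"
    using rapidly_decreasingD[OF rapidly_decreasing_fourier[OF h]] by blast
  show ?thesis
  proof (rule Bochner_Integration.integrable_bound)
    show "integrable (lborel \<Otimes>\<^sub>M lborel) (\<lambda>q. complex_of_real B * (case q of (\<xi>, \<eta>) \<Rightarrow> fourier f \<xi> * fourier g \<eta>))"
      by (intro integrable_mult_right integrable_pair_mult sigma_finite_lborel fourier_schwartz_integrable f g)
    show "AE q in lborel \<Otimes>\<^sub>M lborel. norm (fourier f (fst q) * fourier g (snd q) * fourier h (- (fst q + snd q)))
      \<le> norm (complex_of_real B * (case q of (\<xi>, \<eta>) \<Rightarrow> fourier f \<xi> * fourier g \<eta>))"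
    proof (rule AE_I2)
      fix q
      have "norm (fourier f (fst q) * fourier g (snd q) * fourier h (- (fst q + snd q))) \<le> norm (fourier f (fst q) * fourier g (snd q)) * B"
        unfolding norm_mult[of _ "fourier h _"] using B(2)[of "- (fst q + snd q)"] by (intro mult_left_mono) auto
      then show "norm (fourier f (fst q) * fourier g (snd q) * fourier h (- (fst q + snd q)))
        \<le> norm (complex_of_real B * (case q of (\<xi>, \<eta>) \<Rightarrow> fourier f \<xi> * fourier g \<eta>))"
        using B(1) by (simp add: case_prod_unfold norm_mult mult_ac)
    qed
  qed measurable
qed

text \<open>The function \<open>\<psi>\<close> passed to \<open>K\<close> is described twice: as a
  slice integral, which shows that it is Schwartz, and as a superposition of characters over spheres
  and frequencies, which gives the value of \<open>K\<close>.\<close>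

theorem radial_extension_pairing:
  fixes K :: "(real \<times> real \<Rightarrow> complex) \<Rightarrow> complex" and f g h :: "'a::euclidean_space \<Rightarrow> complex"
  assumes K: "tempered_distribution K"
    and symbol: "\<And>f g h. \<lbrakk>schwartz f; schwartz g; schwartz h;
        schwartz (\<lambda>(\<xi>,\<eta>). fourier f \<xi> * fourier g \<eta> * fourier h (- (\<xi> + \<eta>)))\<rbrakk> \<Longrightarrow>
      bilinear_operator K f g h = (\<integral>(\<xi>,\<eta>). m (\<xi>,\<eta>) * (fourier f \<xi> * fourier g \<eta> * fourier h (- (\<xi> + \<eta>))) \<partial>lborel)"
    and m[measurable]: "m \<in> borel_measurable borel" and B: "\<And>\<zeta>. norm (m \<zeta>) \<le> B"
    and cont: "\<And>u v. u \<noteq> 0 \<Longrightarrow> v \<noteq> 0 \<Longrightarrow> isCont m (u, v)"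
    and f: "schwartz f" and g: "schwartz g" and h: "schwartz h"
  shows "bilinear_operator (radial_extension K) f g h = 1 / 4 *
    (\<integral>\<zeta>. fourier f (fst \<zeta>) * fourier g (snd \<zeta>) * fourier h (- (fst \<zeta> + snd \<zeta>)) *
      (\<integral>q. m (fst \<zeta> \<bullet> fst q, snd \<zeta> \<bullet> snd q) \<partial>(sphere_measure \<Otimes>\<^sub>M sphere_measure)) \<partial>lborel)"
proof -
  let ?S = "sphere_measure :: 'a measure"
  let ?L = "(lborel :: 'a measure) \<Otimes>\<^sub>M (lborel :: 'a measure)"
  define N where "N = ?S \<Otimes>\<^sub>M ?S"
  define M where "M = N \<Otimes>\<^sub>M ?L"
  interpret S: finite_measure ?S by (rule finite_sphere_measure)
  interpret SS: pair_sigma_finite ?S ?S ..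
  have N: "finite_measure N" unfolding N_def
    by (intro finite_measure_pair_measure finite_sphere_measure)
  have setsN[measurable_cong]: "sets N = sets (borel \<Otimes>\<^sub>M borel)"
    unfolding N_def by (intro sets_pair_measure_cong) auto
  have sN: "sigma_finite_measure N" using N by (simp add: finite_measure_def)
  have sL: "sigma_finite_measure ?L" by (rule lborel_pair.P.sigma_finite_measure_axioms)
  interpret NL: pair_sigma_finite N ?L using sN sL by (simp add: pair_sigma_finite_def)
  interpret NB: pair_sigma_finite N "lborel :: 'a measure"
    using sN sigma_finite_lborel by (simp add: pair_sigma_finite_def)
  have setsM[measurable_cong]: "sets M = sets ((borel \<Otimes>\<^sub>M borel) \<Otimes>\<^sub>M (borel \<Otimes>\<^sub>M borel))"
    unfolding M_def by (intro sets_pair_measure_cong setsN) auto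
  have [measurable]: "f \<in> borel_measurable borel" "g \<in> borel_measurable borel" "h \<in> borel_measurable borel"
    using f g h by auto
  have [measurable]: "fourier f \<in> borel_measurable borel" "fourier g \<in> borel_measurable borel"
    "fourier h \<in> borel_measurable borel"
    by (auto intro!: fourier_borel_measurable)
  define W where "W \<zeta> = fourier f (fst \<zeta>) * fourier g (snd \<zeta>) * fourier h (- (fst \<zeta> + snd \<zeta>))" for \<zeta>
  have Wi: "integrable ?L W" unfolding W_def by (rule fourier_triple_integrable[OF f g h])
  have [measurable]: "W \<in> borel_measurable (borel \<Otimes>\<^sub>M borel)"
    unfolding W_def by measurable
  define \<Phi> where "\<Phi> y z = (\<integral>x. f (x - y) * g (x - z) * h x \<partial>lborel)" for y z
  \<comment> \<open>Since r \<theta> \<bullet> \<xi> = r (\<theta> \<bullet> \<xi>), restricting a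
    character of R^n x R^n to a pair of lines gives the planar character with this
    frequency.\<close>
  define p where "p x = (fst (snd x) \<bullet> fst (fst x), snd (snd x) \<bullet> snd (fst x))" for x :: "('a \<times> 'a) \<times> ('a \<times> 'a)"
  have pm[measurable]: "p \<in> borel_measurable M"
    unfolding p_def by measurable
  define \<psi> where "\<psi> a = (\<integral>\<theta>. (\<integral>\<omega>. \<Phi> (fst a *\<^sub>R \<theta>) (snd a *\<^sub>R \<omega>) \<partial>?S) \<partial>?S)" for a
  have WMi: "integrable M (\<lambda>x. W (snd x))"
  proof -
    have "integrable M (\<lambda>(q, \<zeta>). 1 * W \<zeta>)"
      unfolding M_def using finite_measure.integrable_const[OF N]
      by (intro integrable_pair_mult sN sL Wi) blast
    then show ?thesis by (simp add: case_prod_unfold)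
  qed
  have Wci: "integrable M (\<lambda>x. W (snd x) * cis (- 2 * pi * (a \<bullet> p x)))" for a
    by (rule Bochner_Integration.integrable_bound[OF WMi]) (measurable, auto simp: norm_mult cis_conv_exp)
  have inner: "(\<integral>\<zeta>. W \<zeta> * cis (- 2 * pi * (a \<bullet> p (q, \<zeta>))) \<partial>?L) = \<Phi> (fst a *\<^sub>R fst q) (snd a *\<^sub>R snd q)" for a q
    unfolding \<Phi>_def trilinear_form_fourier[OF f g h] W_def
    by (cases a) (simp add: p_def inner_Pair inner_commute)
  have \<Phi>_int: "integrable N (\<lambda>q. \<Phi> (fst a *\<^sub>R fst q) (snd a *\<^sub>R snd q))" for a
    using NL.integrable_fst'[OF Wci[of a, unfolded M_def]] by (simp only: snd_conv inner)
  have \<psi>_pair: "\<psi> a = (\<integral>q. \<Phi> (fst a *\<^sub>R fst q) (snd a *\<^sub>R snd q) \<partial>N)" for a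
    using SS.integral_fst'[OF \<Phi>_int[unfolded N_def]] by (simp add: \<psi>_def N_def)
  have \<psi>_fourier: "\<psi> a = (\<integral>x. W (snd x) * cis (- 2 * pi * (a \<bullet> p x)) \<partial>M)" for a
    using NL.integral_fst'[OF Wci[of a, unfolded M_def]] unfolding \<psi>_pair
    by (simp only: M_def snd_conv inner)
  have \<psi>_schwartz: "schwartz \<psi>"
  proof -
    \<comment> \<open>\<open>sphere_measure\<close> is concentrated on unit vectors only almost
      everywhere, whereas \<open>slice_integral\<close> asks for a coefficient vanishing at all
      other directions; \<open>c\<close> equals 1 almost everywhere and leaves the integral
      unchanged.\<close>
    define c :: "'a \<times> 'a \<Rightarrow> complex" where "c q = (if norm (fst q) = 1 \<and> norm (snd q) = 1 then 1 else 0)" for q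
    have [measurable]: "c \<in> borel_measurable N" unfolding c_def by measurable
    have cN: "AE q in N. c q = 1"
    proof -
      have "AE \<theta> in ?S. AE \<omega> in ?S. norm (fst (\<theta>, \<omega>)) = 1 \<and> norm (snd (\<theta>, \<omega>)) = 1"
        using AE_sphere_norm[where 'a='a]
      proof eventually_elim
        case (elim \<theta>)
        show ?case using AE_sphere_norm[where 'a='a] by eventually_elim (use elim in simp)
      qed
      moreover have "{q \<in> space (?S \<Otimes>\<^sub>M ?S). norm (fst q) = 1 \<and> norm (snd q) = 1} \<in> sets (?S \<Otimes>\<^sub>M ?S)"
        by measurable
      ultimately have "AE q in N. norm (fst q) = 1 \<and> norm (snd q) = 1"
        unfolding N_def by (intro SS.AE_pair_measure) auto
      then show ?thesis by eventually_elim (simp add: c_def)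
    qed
    have si: "integrable (N \<Otimes>\<^sub>M lborel) (\<lambda>q. c (fst q) * h (snd q) * (f (snd q - fst a *\<^sub>R fst (fst q)) * g (snd q - snd a *\<^sub>R snd (fst q))))" for a
      by (rule slice_integrable[OF N setsN h f g]) (auto simp: c_def)
    have "\<psi> a = (\<integral>q. c (fst q) * h (snd q) * (f (snd q - fst a *\<^sub>R fst (fst q)) * g (snd q - snd a *\<^sub>R snd (fst q))) \<partial>(N \<Otimes>\<^sub>M lborel))" for a
    proof -
      have *: "(\<integral>x. c q * h x * (f (x - fst a *\<^sub>R fst q) * g (x - snd a *\<^sub>R snd q)) \<partial>lborel) = c q * \<Phi> (fst a *\<^sub>R fst q) (snd a *\<^sub>R snd q)" for q
      proof -
        have "(\<integral>x. c q * h x * (f (x - fst a *\<^sub>R fst q) * g (x - snd a *\<^sub>R snd q)) \<partial>lborel) = (\<integral>x. c q * (f (x - fst a *\<^sub>R fst q) * g (x - snd a *\<^sub>R snd q) * h x) \<partial>lborel)"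
          by (simp add: mult_ac)
        then show ?thesis by (simp only: \<Phi>_def integral_mult_right_zero)
      qed
      have "(\<integral>q. c (fst q) * h (snd q) * (f (snd q - fst a *\<^sub>R fst (fst q)) * g (snd q - snd a *\<^sub>R snd (fst q))) \<partial>(N \<Otimes>\<^sub>M lborel))
        = (\<integral>q. c q * \<Phi> (fst a *\<^sub>R fst q) (snd a *\<^sub>R snd q) \<partial>N)"
        using NB.integral_fst'[OF si[of a]] by (simp add: *)
      also have "\<dots> = (\<integral>q. \<Phi> (fst a *\<^sub>R fst q) (snd a *\<^sub>R snd q) \<partial>N)"
      proof (rule integral_cong_AE)
        show "AE q in N. c q * \<Phi> (fst a *\<^sub>R fst q) (snd a *\<^sub>R snd q) = \<Phi> (fst a *\<^sub>R fst q) (snd a *\<^sub>R snd q)"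
          using cN by eventually_elim simp
        show "(\<lambda>q. c q * \<Phi> (fst a *\<^sub>R fst q) (snd a *\<^sub>R snd q)) \<in> borel_measurable N"
          using \<Phi>_int[of a] by (intro borel_measurable_times) auto
      qed (use \<Phi>_int[of a] in auto)
      finally show ?thesis by (simp only: \<psi>_pair)
    qed
    then have "\<psi> = (\<lambda>a. \<integral>q. c (fst q) * h (snd q) * (f (snd q - fst a *\<^sub>R fst (fst q)) * g (snd q - snd a *\<^sub>R snd (fst q))) \<partial>(N \<Otimes>\<^sub>M lborel))"
      by (rule ext)
    moreover have "slice_integral N h \<dots>"
      by (rule slice_integral.base[OF f g, of _ _ 1]) (auto simp: c_def)
    ultimately show ?thesis using slice_integral_schwartz[OF N setsN h] by simp
  qed
  have cont_ae: "AE x in M. isCont m (p x)"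
  proof -
    \<comment> \<open>For nonzero directions, each component of \<open>p\<close> vanishes only on a
      hyperplane of frequency space.\<close>
    have "AE q in N. AE \<zeta> in ?L. fst (p (q, \<zeta>)) \<noteq> 0 \<and> snd (p (q, \<zeta>)) \<noteq> 0"
    proof -
      have hyper: "AE \<zeta> in ?L. v \<bullet> \<zeta> \<noteq> 0" if "v \<noteq> 0" for v :: "'a \<times> 'a"
        unfolding lborel_prod by (rule AE_inner_nonzero[OF that])
      have "AE \<theta> in ?S. AE \<omega> in ?S. fst (\<theta>, \<omega>) \<noteq> 0 \<and> snd (\<theta>, \<omega>) \<noteq> 0"
        using AE_sphere_norm[where 'a='a]
      proof eventually_elim
        case (elim \<theta>)
        show ?case using AE_sphere_norm[where 'a='a] by eventually_elim (use elim in auto)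
      qed
      moreover have "{q \<in> space (?S \<Otimes>\<^sub>M ?S). fst q \<noteq> 0 \<and> snd q \<noteq> 0} \<in> sets (?S \<Otimes>\<^sub>M ?S)"
        by measurable
      ultimately have "AE q in N. fst q \<noteq> 0 \<and> snd q \<noteq> 0"
        unfolding N_def by (intro SS.AE_pair_measure) auto
      then show ?thesis
      proof eventually_elim
        case (elim q)
        have "AE \<zeta> in ?L. (fst q, 0) \<bullet> \<zeta> \<noteq> 0" "AE \<zeta> in ?L. (0, snd q) \<bullet> \<zeta> \<noteq> 0"
          using elim by (auto intro!: hyper simp: zero_prod_def)
        then show ?case by eventually_elim (auto simp: p_def inner_prod_def inner_commute)
      qed
    qed
    moreover have "{x \<in> space (N \<Otimes>\<^sub>M ?L). fst (p x) \<noteq> 0 \<and> snd (p x) \<noteq> 0} \<in> sets (N \<Otimes>\<^sub>M ?L)"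
      unfolding p_def by measurable
    ultimately have "AE x in M. fst (p x) \<noteq> 0 \<and> snd (p x) \<noteq> 0"
      unfolding M_def by (intro NL.AE_pair_measure) auto
    then show ?thesis
    proof eventually_elim
      case (elim x)
      then show ?case using cont[of "fst (p x)" "snd (p x)"] by simp
    qed
  qed
  have \<psi>_eq: "\<psi> = (\<lambda>a. \<integral>x. W (snd x) * cis (- 2 * pi * (a \<bullet> p x)) \<partial>M)"
    using \<psi>_fourier by (rule ext)
  have "K (\<lambda>a. \<integral>x. W (snd x) * cis (- 2 * pi * (a \<bullet> p x)) \<partial>M) = (\<integral>x. W (snd x) * m (p x) \<partial>M)"
  proof (rule tempered_pairing_characters[OF K symbol m B _ WMi pm cont_ae])
    show "sigma_finite_measure M" unfolding M_def by (rule NL.P.sigma_finite_measure_axioms)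
    show "schwartz (\<lambda>a. \<integral>x. W (snd x) * cis (- 2 * pi * (a \<bullet> p x)) \<partial>M)"
      using \<psi>_schwartz unfolding \<psi>_eq .
  qed auto
  then have K\<psi>: "K \<psi> = (\<integral>x. W (snd x) * m (p x) \<partial>M)" unfolding \<psi>_eq .
  have Wmi: "integrable M (\<lambda>x. W (snd x) * m (p x))"
  proof (rule Bochner_Integration.integrable_bound)
    show "integrable M (\<lambda>x. norm (W (snd x)) * B)" using WMi by simp
    show "AE x in M. norm (W (snd x) * m (p x)) \<le> norm (norm (W (snd x)) * B)"
      by (intro AE_I2) (simp only: norm_mult real_norm_def abs_mult abs_norm_cancel, intro mult_left_mono norm_ge_zero order_trans[OF B abs_ge_self])
    show "(\<lambda>x. W (snd x) * m (p x)) \<in> borel_measurable M"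
    proof -
      have "(\<lambda>x. m (p x)) \<in> borel_measurable M" using measurable_compose[OF pm m] .
      then show ?thesis using WMi by (intro borel_measurable_times) auto
    qed
  qed
  have "bilinear_operator (radial_extension K) f g h = 1 / 4 * K \<psi>"
    unfolding bilinear_operator_def radial_extension_def \<psi>_def \<Phi>_def by (simp add: case_prod_unfold)
  also have "K \<psi> = (\<integral>\<zeta>. \<integral>q. W \<zeta> * m (p (q, \<zeta>)) \<partial>N \<partial>?L)"
    unfolding K\<psi> M_def using NL.integral_snd[of "\<lambda>q \<zeta>. W \<zeta> * m (p (q, \<zeta>))"] Wmi
    by (simp add: case_prod_unfold M_def)
  also have "\<dots> = (\<integral>\<zeta>. W \<zeta> * (\<integral>q. m (fst \<zeta> \<bullet> fst q, snd \<zeta> \<bullet> snd q) \<partial>N) \<partial>lborel)"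
    by (simp add: p_def lborel_prod)
  finally show ?thesis unfolding W_def N_def .
qed

section \<open>Radial Marcinkiewicz symbols\<close>

lemma vector_derivative_increment_bound:
  fixes f :: "real \<Rightarrow> complex"
  assumes "a \<le> b" and f: "\<And>t. t \<in> {a..b} \<Longrightarrow> (f has_vector_derivative f' t) (at t)"
    and B: "\<And>t. t \<in> {a..b} \<Longrightarrow> norm (f' t) \<le> B"
  shows "norm (f b - f a) \<le> B * (b - a)"
proof -
  have "norm (f b - f a) \<le> B * norm (b - a)"
  proof (rule differentiable_bound[of "{a..b}" f "\<lambda>t h. h *\<^sub>R f' t"])
    show "(f has_derivative (\<lambda>h. h *\<^sub>R f' t)) (at t within {a..b})" if "t \<in> {a..b}" for t
      using f[OF that] by (auto simp: has_vector_derivative_def intro: has_derivative_at_withinI)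
    show "onorm (\<lambda>h. h *\<^sub>R f' t) \<le> B" if "t \<in> {a..b}" for t
      using mult_right_mono[OF B[OF that] abs_ge_zero] by (intro onorm_le) (simp add: mult.commute)
  qed (use \<open>a \<le> b\<close> in auto)
  then show ?thesis using \<open>a \<le> b\<close> by simp
qed

text \<open>The mean value inequality is used twice, each time after subtracting the affine term
  built from \<open>A\<close>: first in \<open>v\<close> for \<open>Gx\<close>, then in
  \<open>u\<close> for the difference of two slices of \<open>G\<close>.\<close>

lemma mixed_difference_bound:
  fixes G :: "real \<Rightarrow> real \<Rightarrow> complex"
  assumes h: "h > 0"
    and G: "\<And>u v. u \<in> {x..x+h} \<Longrightarrow> v \<in> {y..y+h} \<Longrightarrow> ((\<lambda>u. G u v) has_vector_derivative Gx u v) (at u)"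
    and Gx: "\<And>u v. u \<in> {x..x+h} \<Longrightarrow> v \<in> {y..y+h} \<Longrightarrow> ((\<lambda>v. Gx u v) has_vector_derivative Gxy u v) (at v)"
    and e: "\<And>u v. u \<in> {x..x+h} \<Longrightarrow> v \<in> {y..y+h} \<Longrightarrow> norm (Gxy u v - A) \<le> e"
  shows "norm (G (x + h) (y + h) - G (x + h) y - G x (y + h) + G x y - (h * h) *\<^sub>R A) \<le> e * h * h"
proof -
  have 1: "norm (Gx u (y + h) - Gx u y - h *\<^sub>R A) \<le> e * h" if u: "u \<in> {x..x+h}" for u
  proof -
    have "norm ((Gx u (y + h) - (y + h) *\<^sub>R A) - (Gx u y - y *\<^sub>R A)) \<le> e * ((y + h) - y)"
    proof (rule vector_derivative_increment_bound)
      show "((\<lambda>v. Gx u v - v *\<^sub>R A) has_vector_derivative (Gxy u v - A)) (at v)" if "v \<in> {y..y+h}" for v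
        using Gx[OF u that] by (auto intro!: derivative_eq_intros)
    qed (use h e[OF u] in auto)
    then show ?thesis by (simp add: algebra_simps)
  qed
  have "norm ((G (x + h) (y + h) - G (x + h) y - (x + h) *\<^sub>R (h *\<^sub>R A)) - (G x (y + h) - G x y - x *\<^sub>R (h *\<^sub>R A))) \<le> e * h * ((x + h) - x)"
  proof (rule vector_derivative_increment_bound)
    show "((\<lambda>u. G u (y + h) - G u y - u *\<^sub>R (h *\<^sub>R A)) has_vector_derivative (Gx u (y + h) - Gx u y - h *\<^sub>R A)) (at u)"
      if "u \<in> {x..x+h}" for u
      using G[OF that, of "y + h"] G[OF that, of y] h by (auto intro!: derivative_eq_intros)
  qed (use h 1 in auto)
  then show ?thesis by (simp add: algebra_simps)
qed

lemma has_vector_derivative_slice: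
  fixes F :: "real \<times> real \<Rightarrow> complex"
  assumes "F differentiable (at (u, v))"
  shows "((\<lambda>u. F (u, v)) has_vector_derivative frechet_derivative F (at (u, v)) (1, 0)) (at u)"
    and "((\<lambda>v. F (u, v)) has_vector_derivative frechet_derivative F (at (u, v)) (0, 1)) (at v)"
proof -
  have D: "(F has_derivative frechet_derivative F (at (u, v))) (at (u, v))"
    using assms frechet_derivative_works by blast
  have lin: "linear (frechet_derivative F (at (u, v)))" using D by (rule has_derivative_linear)
  have 1: "((\<lambda>u. (u, v)) has_derivative (\<lambda>h. (h, 0))) (at u)"
    by (auto intro!: derivative_eq_intros)
  have 2: "((\<lambda>v. (u, v)) has_derivative (\<lambda>h. (0, h))) (at v)"
    by (auto intro!: derivative_eq_intros)
  have e: "(h, 0) = h *\<^sub>R (1, 0 :: real)" "(0, h) = h *\<^sub>R (0 :: real, 1)" for h :: real by auto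
  show "((\<lambda>u. F (u, v)) has_vector_derivative frechet_derivative F (at (u, v)) (1, 0)) (at u)"
    using has_derivative_compose[OF 1 D] unfolding has_vector_derivative_def
    by (subst (asm) e(1)) (simp only: linear_scale[OF lin])
  show "((\<lambda>v. F (u, v)) has_vector_derivative frechet_derivative F (at (u, v)) (0, 1)) (at v)"
    using has_derivative_compose[OF 2 D] unfolding has_vector_derivative_def
    by (subst (asm) e(2)) (simp only: linear_scale[OF lin])
qed

text \<open>Schwarz's theorem. The second difference over a small square is symmetric in the order
  of differencing, and divided by h^2 it is close to either mixed partial by
  \<open>mixed_difference_bound\<close>.\<close>

lemma mixed_partials_commute:
  fixes F :: "real \<times> real \<Rightarrow> complex"
  assumes U: "open U" "p \<in> U" and F: "smooth_on U F"
  shows "partials [(0, 1), (1, 0)] F p = partials [(1, 0), (0, 1)] F p"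
proof -
  obtain x y where p: "p = (x, y)" by (cases p)
  have B: "(1, 0) \<in> (Basis :: (real \<times> real) set)" "(0, 1) \<in> (Basis :: (real \<times> real) set)"
    by (auto simp: Basis_prod_def)
  have diff: "partials bs F differentiable (at q)" if "q \<in> U" "bs \<in> lists {(1, 0), (0, 1)}" for q bs
    using F that B unfolding smooth_on_def
    by (metis (no_types, opaque_lifting) empty_subsetI insert_subset lists_mono subsetD)
  let ?A = "partials [(0, 1), (1, 0)] F" and ?B = "partials [(1, 0), (0, 1)] F"
  have le2: "norm (?A p - ?B p) \<le> 2 * e" if e: "e > 0" for e
  proof -
    have "isCont ?A p" "isCont ?B p"
      using diff[OF U(2)] by (auto intro!: differentiable_imp_continuous_within simp del: partials.simps)
    then obtain d1 d2 where d: "d1 > 0" "\<And>q. dist q p < d1 \<Longrightarrow> norm (?A q - ?A p) < e"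
      "d2 > 0" "\<And>q. dist q p < d2 \<Longrightarrow> norm (?B q - ?B p) < e"
      using e unfolding continuous_at_eps_delta dist_norm by metis
    obtain d0 where d0: "d0 > 0" "ball p d0 \<subseteq> U" using U openE by blast
    \<comment> \<open>Points of the square of side \<open>h\<close> are within 2 h < 4 h of the
      corner \<open>p\<close>, hence inside all three balls.\<close>
    define h where "h = min d0 (min d1 d2) / 4"
    have h: "h > 0" using d d0 by (simp add: h_def)
    have near: "dist (u, v) p < min d0 (min d1 d2)" if "u \<in> {x..x+h}" "v \<in> {y..y+h}" for u v
    proof -
      have "dist (u, v) p \<le> dist u x + dist v y"
        unfolding p dist_norm using norm_Pair_le[of "u - x" "v - y"] by simp
      also have "\<dots> \<le> 2 * h" using that by (simp add: dist_real_def)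
      also have "\<dots> < 4 * h" using h by simp
      finally show ?thesis by (simp add: h_def)
    qed
    then have inU: "(u, v) \<in> U" if "u \<in> {x..x+h}" "v \<in> {y..y+h}" for u v
      using that d0 by (force simp: dist_commute)
    have 1: "norm (F (x + h, y + h) - F (x + h, y) - F (x, y + h) + F (x, y) - (h * h) *\<^sub>R ?A p) \<le> e * h * h"
    proof (rule mixed_difference_bound[where G="\<lambda>u v. F (u, v)" and Gx="\<lambda>u v. partials [(1,0)] F (u, v)" and Gxy="\<lambda>u v. ?A (u, v)"])
      show "((\<lambda>u. F (u, v)) has_vector_derivative partials [(1, 0)] F (u, v)) (at u)" if "u \<in> {x..x+h}" "v \<in> {y..y+h}" for u v
        using has_vector_derivative_slice(1)[of F u v] diff[OF inU[OF that], of "[]"] by simp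
      show "((\<lambda>v. partials [(1, 0)] F (u, v)) has_vector_derivative ?A (u, v)) (at v)" if "u \<in> {x..x+h}" "v \<in> {y..y+h}" for u v
        using has_vector_derivative_slice(2)[of "partials [(1, 0)] F" u v] diff[OF inU[OF that], of "[(1, 0)]"] by simp
      show "norm (?A (u, v) - ?A p) \<le> e" if "u \<in> {x..x+h}" "v \<in> {y..y+h}" for u v
        using d(2)[of "(u, v)"] near[OF that] by (simp del: partials.simps add: less_imp_le)
    qed (rule h)
    have 2: "norm (F (x + h, y + h) - F (x, y + h) - F (x + h, y) + F (x, y) - (h * h) *\<^sub>R ?B p) \<le> e * h * h"
    proof (rule mixed_difference_bound[where G="\<lambda>v u. F (u, v)" and Gx="\<lambda>v u. partials [(0,1)] F (u, v)" and Gxy="\<lambda>v u. ?B (u, v)"])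
      show "((\<lambda>v. F (u, v)) has_vector_derivative partials [(0, 1)] F (u, v)) (at v)" if "v \<in> {y..y+h}" "u \<in> {x..x+h}" for u v
        using has_vector_derivative_slice(2)[of F u v] diff[OF inU[OF that(2,1)], of "[]"] by simp
      show "((\<lambda>u. partials [(0, 1)] F (u, v)) has_vector_derivative ?B (u, v)) (at u)" if "v \<in> {y..y+h}" "u \<in> {x..x+h}" for u v
        using has_vector_derivative_slice(1)[of "partials [(0, 1)] F" u v] diff[OF inU[OF that(2,1)], of "[(0, 1)]"] by simp
      show "norm (?B (u, v) - ?B p) \<le> e" if "v \<in> {y..y+h}" "u \<in> {x..x+h}" for u v
        using d(4)[of "(u, v)"] near[OF that(2,1)] by (simp del: partials.simps add: less_imp_le)
    qed (rule h)
    have "(h * h) *\<^sub>R (?A p - ?B p) = (F (x + h, y + h) - F (x, y + h) - F (x + h, y) + F (x, y) - (h * h) *\<^sub>R ?B p)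
       - (F (x + h, y + h) - F (x + h, y) - F (x, y + h) + F (x, y) - (h * h) *\<^sub>R ?A p)"
      by (simp add: algebra_simps del: partials.simps)
    then have "norm ((h * h) *\<^sub>R (?A p - ?B p)) \<le> e * h * h + e * h * h"
      by (simp only:) (rule order_trans[OF norm_triangle_ineq4 add_mono[OF 2 1]])
    then have "(h * h) * norm (?A p - ?B p) \<le> (h * h) * (2 * e)" by (simp del: partials.simps add: mult_ac)
    then show ?thesis using h by (simp del: partials.simps)
  qed
  have "norm (?A p - ?B p) \<le> 0"
  proof (rule field_le_epsilon)
    fix e :: real assume "0 < e"
    then show "norm (?A p - ?B p) \<le> 0 + e" using le2[of "e / 2"] by (simp del: partials.simps)
  qed
  then show ?thesis by (simp del: partials.simps)
qed

section \<open>Averages of a Marcinkiewicz symbol over dilations of the two variables\<close>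

definition off_axes :: "('a::real_normed_vector \<times> 'b::real_normed_vector) set" where
  "off_axes = {(x, y). x \<noteq> 0 \<and> y \<noteq> 0}"

lemma open_off_axes: "open (off_axes :: ('a::real_normed_vector \<times> 'b::real_normed_vector) set)"
proof -
  have "(off_axes :: ('a \<times> 'b) set) = (- {0}) \<times> (- {0})" by (auto simp: off_axes_def)
  moreover have "open ((- {0}) \<times> (- {0}) :: ('a \<times> 'b) set)"
    by (intro open_Times open_Compl closed_singleton)
  ultimately show ?thesis by (simp only:)
qed

lemma mem_off_axes: "p \<in> off_axes \<longleftrightarrow> fst p \<noteq> 0 \<and> snd p \<noteq> 0"
  by (cases p) (simp add: off_axes_def)

text \<open>The value 0 on the axes, where a Marcinkiewicz function is unconstrained, makes the integrands below
  vanish, hence differentiable, at the directions orthogonal to the chosen coordinate.\<close>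

definition mixed_partial :: "(real \<times> real \<Rightarrow> complex) \<Rightarrow> nat \<Rightarrow> nat \<Rightarrow> real \<times> real \<Rightarrow> complex" where
  "mixed_partial m a b p = (if p \<in> off_axes then partials (replicate a (1, 0) @ replicate b (0, 1)) m p else 0)"

context
  fixes m :: "real \<times> real \<Rightarrow> complex"
  assumes m: "marcinkiewicz_function m"
begin

lemma marcinkiewicz_smooth: "smooth_on off_axes m"
  using m by (simp add: marcinkiewicz_function_def off_axes_def)

lemma partials_differentiable:
  assumes "p \<in> off_axes" "bs \<in> lists {(1, 0), (0, 1)}"
  shows "partials bs m differentiable (at p)"
proof -
  have "{(1, 0), (0, 1)} \<subseteq> (Basis :: (real \<times> real) set)" by (auto simp: Basis_prod_def)
  then have "bs \<in> lists Basis" using assms(2) lists_mono by blast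
  then show ?thesis using marcinkiewicz_smooth assms(1) by (simp add: smooth_on_def)
qed

lemma replicates_in_lists: "replicate a (1, 0) @ replicate b (0, 1) \<in> lists {(1, 0), (0, 1)}"
  by (simp add: in_lists_conv_set set_replicate_conv_if)

text \<open>\<open>mixed_partial\<close> fixes one order, second-variable derivatives innermost. A
  new derivative in the second variable arrives outermost and has to be moved inward past the
  \<open>a\<close> others, one exchange at a time.\<close>

lemma partials_snd_commute:
  assumes "p \<in> off_axes"
  shows "partials ((0, 1) # replicate a (1, 0) @ replicate b (0, 1)) m p = partials (replicate a (1, 0) @ replicate (Suc b) (0, 1)) m p"
  using assms
proof (induction a arbitrary: p)
  case (Suc a)
  let ?F = "partials (replicate a (1, 0) @ replicate b (0, 1)) m"
  have "smooth_on off_axes ?F"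
    unfolding smooth_on_def partials_append[symmetric]
  proof (intro ballI)
    fix bs and q :: "real \<times> real" assume "bs \<in> lists (Basis :: (real \<times> real) set)" "q \<in> off_axes"
    then show "partials (bs @ replicate a (1, 0) @ replicate b (0, 1)) m differentiable at q"
      by (intro partials_differentiable) (auto simp: Basis_prod_def)
  qed
  then have "partials [(0, 1), (1, 0)] ?F p = partials [(1, 0), (0, 1)] ?F p"
    using mixed_partials_commute[OF open_off_axes Suc.prems] by blast
  then have "partials ((0, 1) # replicate (Suc a) (1, 0) @ replicate b (0, 1)) m p
     = partials [(1, 0)] (partials ((0, 1) # replicate a (1, 0) @ replicate b (0, 1)) m) p" by simp
  also have "\<dots> = partials [(1, 0)] (partials (replicate a (1, 0) @ replicate (Suc b) (0, 1)) m) p"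
    by (rule partials_cong_open[OF open_off_axes Suc.prems Suc.IH])
  finally show ?case by simp
qed simp

text \<open>With the order normalized, the two-index family is closed under differentiation, each
  derivative raising one index.\<close>

lemma mixed_partial_has_derivative:
  assumes p: "p \<in> off_axes"
  shows "(mixed_partial m a b has_derivative
    (\<lambda>v. fst v *\<^sub>R mixed_partial m (Suc a) b p + snd v *\<^sub>R mixed_partial m a (Suc b) p)) (at p)"
proof -
  let ?F = "partials (replicate a (1, 0) @ replicate b (0, 1)) m"
  have D: "(?F has_derivative frechet_derivative ?F (at p)) (at p)"
    using partials_differentiable[OF p replicates_in_lists] frechet_derivative_works by blast
  have lin: "linear (frechet_derivative ?F (at p))" using D by (rule has_derivative_linear)
  have "frechet_derivative ?F (at p) v = fst v *\<^sub>R mixed_partial m (Suc a) b p + snd v *\<^sub>R mixed_partial m a (Suc b) p" for v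
  proof -
    have "v = fst v *\<^sub>R (1, 0) + snd v *\<^sub>R (0, 1)" by (cases v) simp
    then have "frechet_derivative ?F (at p) v = fst v *\<^sub>R frechet_derivative ?F (at p) (1, 0) + snd v *\<^sub>R frechet_derivative ?F (at p) (0, 1)"
      by (metis linear_add[OF lin] linear_scale[OF lin])
    then show ?thesis using p partials_snd_commute[OF p, of a b] by (simp add: mixed_partial_def)
  qed
  then have "frechet_derivative ?F (at p) = (\<lambda>v. fst v *\<^sub>R mixed_partial m (Suc a) b p + snd v *\<^sub>R mixed_partial m a (Suc b) p)"
    by (rule ext)
  with D have "(?F has_derivative (\<lambda>v. fst v *\<^sub>R mixed_partial m (Suc a) b p + snd v *\<^sub>R mixed_partial m a (Suc b) p)) (at p)"
    by simp
  then show ?thesis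
    by (rule has_derivative_transform_within_open[OF _ open_off_axes p]) (simp add: mixed_partial_def)
qed

lemma mixed_partial_bound:
  obtains C where "C \<ge> 0" "\<And>x y. \<bar>x\<bar> ^ a * \<bar>y\<bar> ^ b * norm (mixed_partial m a b (x, y)) \<le> C"
proof -
  have l: "replicate a 1 \<in> lists (Basis :: real set)" "replicate b 1 \<in> lists (Basis :: real set)" by auto
  obtain C where C: "\<And>x y. x \<noteq> 0 \<Longrightarrow> y \<noteq> 0 \<Longrightarrow> norm x ^ length (replicate a (1::real)) * norm y ^ length (replicate b (1::real)) *
     norm (partials (map (\<lambda>b. (b, 0)) (replicate a 1) @ map (\<lambda>b. (0, b)) (replicate b 1)) m (x, y)) \<le> C"
    using m l unfolding marcinkiewicz_function_def by blast
  show ?thesis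
  proof (rule that)
    \<comment> \<open>On the axes \<open>mixed_partial\<close> is 0, so the maximum with 0 extends
      the bound to the whole plane.\<close>
    show "\<bar>x\<bar> ^ a * \<bar>y\<bar> ^ b * norm (mixed_partial m a b (x, y)) \<le> max 0 C" for x y
      using C[of x y] by (auto simp: mixed_partial_def mem_off_axes)
  qed simp
qed

lemma mixed_partial_borel_measurable [measurable]: "mixed_partial m a b \<in> borel_measurable borel"
proof -
  let ?F = "partials (replicate a (1, 0) @ replicate b (0, 1)) m"
  have "continuous_on off_axes ?F"
    by (intro continuous_at_imp_continuous_on ballI differentiable_imp_continuous_within partials_differentiable replicates_in_lists)
  then have "(\<lambda>p. indicator off_axes p *\<^sub>R ?F p) \<in> borel_measurable borel"
    by (intro borel_measurable_continuous_on_indicator borel_open open_off_axes)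
  moreover have "mixed_partial m a b = (\<lambda>p. indicator off_axes p *\<^sub>R ?F p)"
    by (auto simp: mixed_partial_def indicator_def)
  ultimately show ?thesis by simp
qed

context
  fixes N :: "'x measure" and T S :: "'x \<Rightarrow> real"
  assumes N: "finite_measure N" and T[measurable]: "T \<in> borel_measurable N" and S[measurable]: "S \<in> borel_measurable N"
begin

text \<open>The derivative of order (a, b) of the average of m(\<rho> T, \<sigma> S), with the
  powers of \<open>T\<close> and \<open>S\<close> that the chain rule produces.\<close>

definition marginal :: "nat \<Rightarrow> nat \<Rightarrow> real \<times> real \<Rightarrow> complex" where
  "marginal a b p = (\<integral>x. complex_of_real (T x ^ a * S x ^ b) * mixed_partial m a b (fst p * T x, snd p * S x) \<partial>N)"

text \<open>The chain-rule powers combine with the weights at \<open>p\<close> into the weights at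
  the dilated point, where the Marcinkiewicz bound applies. The constant is uniform even where
  \<open>T\<close> or \<open>S\<close> is small, so a finite measure is enough for
  integration.\<close>

lemma marginal_integrand_bound:
  obtains C where "C \<ge> 0" "\<And>p x. \<bar>fst p\<bar> ^ a * \<bar>snd p\<bar> ^ b *
    norm (complex_of_real (T x ^ a * S x ^ b) * mixed_partial m a b (fst p * T x, snd p * S x)) \<le> C"
proof -
  obtain C where C: "C \<ge> 0" "\<And>x y. \<bar>x\<bar> ^ a * \<bar>y\<bar> ^ b * norm (mixed_partial m a b (x, y)) \<le> C"
    using mixed_partial_bound by blast
  have "\<bar>fst p\<bar> ^ a * \<bar>snd p\<bar> ^ b * norm (complex_of_real (T x ^ a * S x ^ b) * mixed_partial m a b (fst p * T x, snd p * S x))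
    = \<bar>fst p * T x\<bar> ^ a * \<bar>snd p * S x\<bar> ^ b * norm (mixed_partial m a b (fst p * T x, snd p * S x))" for p x
    by (simp add: norm_mult norm_power abs_mult power_mult_distrib)
  then show ?thesis using C that by simp
qed

lemma marginal_integrand_measurable:
  "(\<lambda>x. complex_of_real (T x ^ a * S x ^ b) * mixed_partial m a b (fst p * T x, snd p * S x)) \<in> borel_measurable N"
proof -
  have "(\<lambda>x. (fst p * T x, snd p * S x)) \<in> borel_measurable N" by measurable
  from measurable_compose[OF this mixed_partial_borel_measurable]
  show ?thesis by measurable
qed

lemma marginal_integrable:
  assumes "p \<in> off_axes"
  shows "integrable N (\<lambda>x. complex_of_real (T x ^ a * S x ^ b) * mixed_partial m a b (fst p * T x, snd p * S x))"
proof -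
  obtain C where C: "C \<ge> 0" "\<And>p x. \<bar>fst p\<bar> ^ a * \<bar>snd p\<bar> ^ b *
    norm (complex_of_real (T x ^ a * S x ^ b) * mixed_partial m a b (fst p * T x, snd p * S x)) \<le> C"
    using marginal_integrand_bound by blast
  have pos: "0 < \<bar>fst p\<bar> ^ a * \<bar>snd p\<bar> ^ b" using assms by (simp add: mem_off_axes)
  show ?thesis
  proof (rule finite_measure.integrable_const_bound[OF N _ marginal_integrand_measurable])
    show "AE x in N. norm (complex_of_real (T x ^ a * S x ^ b) * mixed_partial m a b (fst p * T x, snd p * S x)) \<le> C / (\<bar>fst p\<bar> ^ a * \<bar>snd p\<bar> ^ b)"
      using C(2) pos by (intro AE_I2) (simp only: pos_le_divide_eq mult.commute)
  qed
qed

lemma marginal_bound: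
  obtains C where "C \<ge> 0" "\<And>p. p \<in> off_axes \<Longrightarrow> \<bar>fst p\<bar> ^ a * \<bar>snd p\<bar> ^ b * norm (marginal a b p) \<le> C"
proof -
  obtain C where C: "C \<ge> 0" "\<And>p x. \<bar>fst p\<bar> ^ a * \<bar>snd p\<bar> ^ b *
    norm (complex_of_real (T x ^ a * S x ^ b) * mixed_partial m a b (fst p * T x, snd p * S x)) \<le> C"
    using marginal_integrand_bound by blast
  have "\<bar>fst p\<bar> ^ a * \<bar>snd p\<bar> ^ b * norm (marginal a b p) \<le> C * measure N (space N)" if p: "p \<in> off_axes" for p
  proof -
    let ?c = "\<bar>fst p\<bar> ^ a * \<bar>snd p\<bar> ^ b"
    let ?F = "\<lambda>x. complex_of_real (T x ^ a * S x ^ b) * mixed_partial m a b (fst p * T x, snd p * S x)"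
    have "?c * norm (marginal a b p) = norm (\<integral>x. ?c *\<^sub>R ?F x \<partial>N)"
      by (simp add: marginal_def abs_mult power_abs)
    also have "\<dots> \<le> (\<integral>x. C \<partial>N)"
    proof (rule order_trans[OF integral_norm_bound Bochner_Integration.integral_mono])
      show "integrable N (\<lambda>x. norm (?c *\<^sub>R ?F x))"
        by (intro integrable_norm integrable_scaleR_right marginal_integrable p)
      show "integrable N (\<lambda>x. C)" by (rule finite_measure.integrable_const[OF N])
      show "norm (?c *\<^sub>R ?F x) \<le> C" for x
        using C(2)[of p x] by (simp only: norm_scaleR) (simp add: abs_mult power_abs)
    qed
    also have "\<dots> = C * measure N (space N)" by simp
    finally show ?thesis .
  qed
  moreover have "C * measure N (space N) \<ge> 0" using C(1) by simp
  ultimately show ?thesis using that by blast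
qed

lemma marginal_has_derivative:
  assumes p: "p \<in> off_axes"
  shows "(marginal a b has_derivative
    (\<lambda>v. fst v *\<^sub>R marginal (Suc a) b p + snd v *\<^sub>R marginal a (Suc b) p)) (at p)"
proof -
  let ?F = "\<lambda>a b p x. complex_of_real (T x ^ a * S x ^ b) * mixed_partial m a b (fst p * T x, snd p * S x)"
  \<comment> \<open>Half the distance of the nearer coordinate from 0: on the ball of this radius
    both coordinates stay at least \<open>r\<close>, which turns the weighted bounds into constant
    majorants.\<close>
  define r where "r = min \<bar>fst p\<bar> \<bar>snd p\<bar> / 2"
  have r: "r > 0" using p by (simp add: r_def mem_off_axes)
  have near: "r \<le> \<bar>fst q\<bar> \<and> r \<le> \<bar>snd q\<bar>" if "q \<in> ball p r" for q
  proof -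
    have "\<bar>fst p - fst q\<bar> \<le> norm (p - q)" "\<bar>snd p - snd q\<bar> \<le> norm (p - q)"
      using norm_fst_le[of "fst (p - q)" "snd (p - q)"] norm_snd_le[of "snd (p - q)" "fst (p - q)"]
      unfolding prod.collapse unfolding fst_diff snd_diff real_norm_def .
    moreover have "norm (p - q) < r" using that by (simp add: dist_norm)
    moreover have "2 * r \<le> \<bar>fst p\<bar>" "2 * r \<le> \<bar>snd p\<bar>" by (auto simp: r_def)
    ultimately show ?thesis by linarith
  qed
  have off: "q \<in> off_axes" if "q \<in> ball p r" for q
    using near[OF that] r by (auto simp: mem_off_axes)
  have dom: "\<exists>A\<ge>0. \<forall>q\<in>ball p r. \<forall>x. norm (?F a b q x) \<le> A" for a b
  proof -
    obtain C where C: "C \<ge> 0" "\<And>p x. \<bar>fst p\<bar> ^ a * \<bar>snd p\<bar> ^ b * norm (?F a b p x) \<le> C"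
      using marginal_integrand_bound by blast
    have "norm (?F a b q x) \<le> C / (r ^ a * r ^ b)" if "q \<in> ball p r" for q x
    proof -
      have "r ^ a * r ^ b * norm (?F a b q x) \<le> \<bar>fst q\<bar> ^ a * \<bar>snd q\<bar> ^ b * norm (?F a b q x)"
        using near[OF that] r by (intro mult_right_mono mult_mono power_mono) auto
      then show ?thesis using C(2)[of q x] r by (simp add: pos_le_divide_eq mult_ac)
    qed
    then show ?thesis using C(1) r by (intro exI[of _ "C / (r ^ a * r ^ b)"]) auto
  qed
  obtain A1 where A1: "A1 \<ge> 0" "\<And>q x. q \<in> ball p r \<Longrightarrow> norm (?F (Suc a) b q x) \<le> A1" using dom by blast
  obtain A2 where A2: "A2 \<ge> 0" "\<And>q x. q \<in> ball p r \<Longrightarrow> norm (?F a (Suc b) q x) \<le> A2" using dom by blast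
  have "((\<lambda>p. \<integral>x. ?F a b p x \<partial>N) has_derivative (\<lambda>v. \<integral>x. fst v *\<^sub>R ?F (Suc a) b p x + snd v *\<^sub>R ?F a (Suc b) p x \<partial>N)) (at p)"
  proof (rule has_derivative_integral[of "ball p r" _ _ _ "\<lambda>q x v. fst v *\<^sub>R ?F (Suc a) b q x + snd v *\<^sub>R ?F a (Suc b) q x" "\<lambda>x. A1 + A2"])
    show "integrable N (?F a b q)" if "q \<in> ball p r" for q
      by (rule marginal_integrable[OF off[OF that]])
    show "integrable N (\<lambda>x. A1 + A2)" by (rule finite_measure.integrable_const[OF N])
    show "(\<lambda>x. fst v *\<^sub>R ?F (Suc a) b p x + snd v *\<^sub>R ?F a (Suc b) p x) \<in> borel_measurable N" for v
      by (intro borel_measurable_add borel_measurable_scaleR borel_measurable_const marginal_integrand_measurable)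
    show "norm (fst v *\<^sub>R ?F (Suc a) b q x + snd v *\<^sub>R ?F a (Suc b) q x) \<le> (A1 + A2) * norm v" if q: "q \<in> ball p r" for q x and v :: "real \<times> real"
    proof -
      have v: "\<bar>fst v\<bar> \<le> norm v" "\<bar>snd v\<bar> \<le> norm v"
        using norm_fst_le[of "fst v" "snd v"] norm_snd_le[of "snd v" "fst v"] by auto
      have "norm (fst v *\<^sub>R ?F (Suc a) b q x + snd v *\<^sub>R ?F a (Suc b) q x) \<le> \<bar>fst v\<bar> * norm (?F (Suc a) b q x) + \<bar>snd v\<bar> * norm (?F a (Suc b) q x)"
        by (rule order_trans[OF norm_triangle_ineq]) (simp only: norm_scaleR order_refl)
      also have "\<dots> \<le> norm v * A1 + norm v * A2"
        by (intro add_mono mult_mono v A1(2)[OF q] A2(2)[OF q]) auto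
      finally show ?thesis by (simp add: algebra_simps)
    qed
    show "((\<lambda>q. ?F a b q x) has_derivative (\<lambda>v. fst v *\<^sub>R ?F (Suc a) b q x + snd v *\<^sub>R ?F a (Suc b) q x)) (at q)" if q: "q \<in> ball p r" for q x
    proof (cases "T x = 0 \<or> S x = 0")
      case True
      then have "mixed_partial m i j (fst q * T x, snd q * S x) = 0" for i j q
        by (auto simp: mixed_partial_def mem_off_axes)
      then show ?thesis by simp
    next
      case False
      have 1: "((\<lambda>q. (fst q * T x, snd q * S x)) has_derivative (\<lambda>v. (fst v * T x, snd v * S x))) (at q)"
        by (auto intro!: derivative_eq_intros)
      have "(fst q * T x, snd q * S x) \<in> off_axes" using False off[OF q] by (simp add: mem_off_axes)
      from has_derivative_mult_right[OF has_derivative_compose[OF 1 mixed_partial_has_derivative[OF this]], of "complex_of_real (T x ^ a * S x ^ b)"]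
      show ?thesis by (simp add: scaleR_conv_of_real algebra_simps)
    qed
  qed (use r in auto)
  moreover have "(\<integral>x. fst v *\<^sub>R ?F (Suc a) b p x + snd v *\<^sub>R ?F a (Suc b) p x \<partial>N) = fst v *\<^sub>R marginal (Suc a) b p + snd v *\<^sub>R marginal a (Suc b) p" for v
    unfolding marginal_def
    by (subst Bochner_Integration.integral_add) (auto simp del: of_real_mult of_real_power power_Suc intro!: integrable_scaleR_right marginal_integrable p)
  ultimately show ?thesis unfolding marginal_def[abs_def] by (simp only:)
qed

end

end

text \<open>The indices are the orders of decay in the two variables; each derivative raises one of them by 1.\<close>

inductive radial_symbol :: "(nat \<Rightarrow> nat \<Rightarrow> real \<times> real \<Rightarrow> complex) \<Rightarrow> nat \<Rightarrow> nat \<Rightarrow>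
    ('a::euclidean_space \<times> 'a \<Rightarrow> complex) \<Rightarrow> bool" for M where
  base: "radial_symbol M a b (\<lambda>p. M a b (norm (fst p), norm (snd p)))"
| const: "radial_symbol M 0 0 (\<lambda>p. c)"
| zero: "radial_symbol M k l (\<lambda>p. 0)"
| direction_fst: "radial_symbol M 0 0 (\<lambda>p. complex_of_real (fst p \<bullet> c / norm (fst p)))"
| direction_snd: "radial_symbol M 0 0 (\<lambda>p. complex_of_real (snd p \<bullet> c / norm (snd p)))"
| inverse_fst: "radial_symbol M 1 0 (\<lambda>p. complex_of_real (1 / norm (fst p)))"
| inverse_snd: "radial_symbol M 0 1 (\<lambda>p. complex_of_real (1 / norm (snd p)))"
| add: "radial_symbol M k l f \<Longrightarrow> radial_symbol M k l g \<Longrightarrow> radial_symbol M k l (\<lambda>p. f p + g p)"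
| mult: "radial_symbol M k l f \<Longrightarrow> radial_symbol M k' l' g \<Longrightarrow> radial_symbol M (k + k') (l + l') (\<lambda>p. f p * g p)"

section \<open>Derivatives of functions of the two norms\<close>

lemma has_derivative_norm_fst:
  assumes "fst p \<noteq> (0 :: 'a::euclidean_space)"
  shows "((\<lambda>p :: 'a \<times> 'b::euclidean_space. norm (fst p)) has_derivative (\<lambda>v. fst v \<bullet> sgn (fst p))) (at p)"
  by (rule has_derivative_compose[OF has_derivative_fst[OF has_derivative_ident] has_derivative_norm[OF assms]])

lemma has_derivative_norm_snd:
  assumes "snd p \<noteq> (0 :: 'b::euclidean_space)"
  shows "((\<lambda>p :: 'a::euclidean_space \<times> 'b. norm (snd p)) has_derivative (\<lambda>v. snd v \<bullet> sgn (snd p))) (at p)"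
  by (rule has_derivative_compose[OF has_derivative_snd[OF has_derivative_ident] has_derivative_norm[OF assms]])

lemma radial_symbol_mult_eq:
  "radial_symbol M k l f \<Longrightarrow> radial_symbol M k' l' g \<Longrightarrow> i = k + k' \<Longrightarrow> j = l + l' \<Longrightarrow> radial_symbol M i j (\<lambda>p. f p * g p)"
  using radial_symbol.mult by blast

context
  fixes M :: "nat \<Rightarrow> nat \<Rightarrow> real \<times> real \<Rightarrow> complex"
  assumes M_derivative: "\<And>a b p. p \<in> off_axes \<Longrightarrow> (M a b has_derivative
      (\<lambda>v. fst v *\<^sub>R M (Suc a) b p + snd v *\<^sub>R M a (Suc b) p)) (at p)"
    and M_bound: "\<And>a b. \<exists>C\<ge>0. \<forall>p\<in>off_axes. \<bar>fst p\<bar> ^ a * \<bar>snd p\<bar> ^ b * norm (M a b p) \<le> C"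
begin

lemma radial_symbol_bound:
  fixes f :: "'a::euclidean_space \<times> 'a \<Rightarrow> complex"
  assumes "radial_symbol M k l f"
  shows "\<exists>C\<ge>0. \<forall>p\<in>off_axes. norm (fst p) ^ k * norm (snd p) ^ l * norm (f p) \<le> C"
  using assms
proof induction
  case (base a b)
  obtain C where C: "C \<ge> 0" "\<And>p. p \<in> off_axes \<Longrightarrow> \<bar>fst p\<bar> ^ a * \<bar>snd p\<bar> ^ b * norm (M a b p) \<le> C"
    using M_bound by blast
  have "norm (fst p) ^ a * norm (snd p) ^ b * norm (M a b (norm (fst p), norm (snd p))) \<le> C" if "p \<in> off_axes" for p :: "'a \<times> 'a"
    using C(2)[of "(norm (fst p), norm (snd p))"] that by (simp add: mem_off_axes)
  with C(1) show ?case by blast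
next
  case (const c)
  show ?case by (rule exI[of _ "norm c"]) simp
next
  case (direction_fst c)
  have "\<bar>x \<bullet> c\<bar> / norm x \<le> norm c" if "x \<noteq> 0" for x :: 'a
    using that Cauchy_Schwarz_ineq2[of x c] by (simp add: pos_divide_le_eq mult.commute)
  then show ?case by (intro exI[of _ "norm c"]) (auto simp: mem_off_axes norm_divide)
next
  case (direction_snd c)
  have "\<bar>x \<bullet> c\<bar> / norm x \<le> norm c" if "x \<noteq> 0" for x :: 'a
    using that Cauchy_Schwarz_ineq2[of x c] by (simp add: pos_divide_le_eq mult.commute)
  then show ?case by (intro exI[of _ "norm c"]) (auto simp: mem_off_axes norm_divide)
next
  case (add k l f g)
  then obtain C D where *: "C \<ge> 0" "D \<ge> 0" "\<And>p. p \<in> off_axes \<Longrightarrow> norm (fst p) ^ k * norm (snd p) ^ l * norm (f p) \<le> C"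
    "\<And>p. p \<in> off_axes \<Longrightarrow> norm (fst p) ^ k * norm (snd p) ^ l * norm (g p) \<le> D" by blast
  have "norm (fst p) ^ k * norm (snd p) ^ l * norm (f p + g p) \<le> C + D" if p: "p \<in> off_axes" for p
  proof -
    have "norm (fst p) ^ k * norm (snd p) ^ l * norm (f p + g p) \<le> norm (fst p) ^ k * norm (snd p) ^ l * (norm (f p) + norm (g p))"
      by (intro mult_left_mono norm_triangle_ineq) simp
    then show ?thesis using *(3,4)[OF p] by (simp add: distrib_left)
  qed
  then show ?case using * by (intro exI[of _ "C + D"]) auto
next
  case (mult k l f k' l' g)
  then obtain C D where *: "C \<ge> 0" "D \<ge> 0" "\<And>p. p \<in> off_axes \<Longrightarrow> norm (fst p) ^ k * norm (snd p) ^ l * norm (f p) \<le> C"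
    "\<And>p. p \<in> off_axes \<Longrightarrow> norm (fst p) ^ k' * norm (snd p) ^ l' * norm (g p) \<le> D" by blast
  have "norm (fst p) ^ (k + k') * norm (snd p) ^ (l + l') * norm (f p * g p) \<le> C * D" if p: "p \<in> off_axes" for p
  proof -
    have "norm (fst p) ^ (k + k') * norm (snd p) ^ (l + l') * norm (f p * g p)
      = (norm (fst p) ^ k * norm (snd p) ^ l * norm (f p)) * (norm (fst p) ^ k' * norm (snd p) ^ l' * norm (g p))"
      by (simp add: power_add norm_mult mult_ac)
    also have "\<dots> \<le> C * D" using * p by (intro mult_mono) auto
    finally show ?thesis .
  qed
  then show ?case using * by (intro exI[of _ "C * D"]) auto
qed (auto intro!: exI[of _ 1] simp: mem_off_axes norm_divide)

text \<open>Every derivative of a generator is made of generators again: |\<xi>| has derivative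
  (\<xi>\<bullet>e)/|\<xi>| along \<open>e\<close>, a direction factor gives (e\<bullet>c)/|\<xi>|
  minus the product of two direction factors with 1/|\<xi>|, and 1/|\<xi>| gives a direction factor
  times -1/|\<xi>|^2. In each case exactly one order of decay is gained in the variable
  differentiated.\<close>

lemma radial_symbol_derivative:
  fixes f :: "'a::euclidean_space \<times> 'a \<Rightarrow> complex"
  assumes "radial_symbol M k l f"
  shows "\<exists>D. (\<forall>p\<in>off_axes. (f has_derivative D p) (at p)) \<and>
    (\<forall>b\<in>Basis. (\<exists>g. radial_symbol M (Suc k) l g \<and> (\<forall>p\<in>off_axes. D p (b, 0) = g p)) \<and>
       (\<exists>g. radial_symbol M k (Suc l) g \<and> (\<forall>p\<in>off_axes. D p (0, b) = g p)))"
  using assms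
proof induction
  case (base a b)
  let ?n = "\<lambda>p::'a \<times> 'a. (norm (fst p), norm (snd p))"
  let ?D = "\<lambda>p v. (fst v \<bullet> sgn (fst p)) *\<^sub>R M (Suc a) b (?n p) + (snd v \<bullet> sgn (snd p)) *\<^sub>R M a (Suc b) (?n p)"
  show ?case
  proof (intro exI[of _ ?D] conjI ballI)
    fix p :: "'a \<times> 'a" assume p: "p \<in> off_axes"
    have "(?n has_derivative (\<lambda>v. (fst v \<bullet> sgn (fst p), snd v \<bullet> sgn (snd p)))) (at p)"
      using p by (intro has_derivative_Pair has_derivative_norm_fst has_derivative_norm_snd) (auto simp: mem_off_axes)
    moreover have "(M a b has_derivative (\<lambda>v. fst v *\<^sub>R M (Suc a) b (?n p) + snd v *\<^sub>R M a (Suc b) (?n p))) (at (?n p))"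
      by (rule M_derivative) (use p in \<open>simp add: mem_off_axes\<close>)
    ultimately show "((\<lambda>p. M a b (?n p)) has_derivative ?D p) (at p)"
      using has_derivative_compose by fastforce
  next
    fix e :: 'a
    have "radial_symbol M (Suc a) b (\<lambda>p. complex_of_real (fst p \<bullet> e / norm (fst p)) * M (Suc a) b (?n p))"
      by (rule radial_symbol_mult_eq[OF radial_symbol.direction_fst radial_symbol.base]) auto
    then show "\<exists>g. radial_symbol M (Suc a) b g \<and> (\<forall>p\<in>off_axes. ?D p (e, 0) = g p)"
      by (intro exI conjI) (auto simp: sgn_div_norm scaleR_conv_of_real inner_commute divide_inverse mult.commute)
    have "radial_symbol M a (Suc b) (\<lambda>p. complex_of_real (snd p \<bullet> e / norm (snd p)) * M a (Suc b) (?n p))"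
      by (rule radial_symbol_mult_eq[OF radial_symbol.direction_snd radial_symbol.base]) auto
    then show "\<exists>g. radial_symbol M a (Suc b) g \<and> (\<forall>p\<in>off_axes. ?D p (0, e) = g p)"
      by (intro exI conjI) (auto simp: sgn_div_norm scaleR_conv_of_real inner_commute divide_inverse mult.commute)
  qed
next
  case (const c)
  show ?case by (rule exI[of _ "\<lambda>p v. 0"]) (auto intro: radial_symbol.zero)
next
  case (zero k l)
  show ?case by (rule exI[of _ "\<lambda>p v. 0"]) (auto intro: radial_symbol.zero)
next
  case (direction_fst c)
  \<comment> \<open>The quotient rule is written as sums and products of generators, with
    \<open>- 1 *\<close> as a constant factor, so that it can be read off as a member of the
    class.\<close>
  let ?D = "\<lambda>p v :: 'a \<times> 'a. complex_of_real ((fst v \<bullet> c) * (1 / norm (fst p)) + - 1 * ((fst p \<bullet> c / norm (fst p)) * ((fst p \<bullet> fst v / norm (fst p)) * (1 / norm (fst p)))))"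
  show ?case
  proof (intro exI[of _ ?D] conjI ballI)
    fix p :: "'a \<times> 'a" assume p: "p \<in> off_axes"
    then show "((\<lambda>p. complex_of_real (fst p \<bullet> c / norm (fst p))) has_derivative ?D p) (at p)"
      by (auto intro!: derivative_eq_intros has_derivative_norm_fst has_derivative_norm_snd simp: mem_off_axes sgn_div_norm fun_eq_iff field_simps power2_eq_square inner_commute)
  next
    fix e :: 'a
    have "radial_symbol M (Suc 0) 0 (\<lambda>p::'a \<times> 'a. complex_of_real (e \<bullet> c) * complex_of_real (1 / norm (fst p))
      + complex_of_real (- 1) * (complex_of_real (fst p \<bullet> c / norm (fst p)) * (complex_of_real (fst p \<bullet> e / norm (fst p)) * complex_of_real (1 / norm (fst p)))))"
      by (intro radial_symbol.add radial_symbol_mult_eq[OF radial_symbol.const[of M "complex_of_real (e \<bullet> c)"] radial_symbol.inverse_fst]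
        radial_symbol_mult_eq[OF radial_symbol.const[of M "complex_of_real (- 1)"] radial_symbol_mult_eq[OF radial_symbol.direction_fst
          radial_symbol_mult_eq[OF radial_symbol.direction_fst radial_symbol.inverse_fst refl refl] refl refl]]) auto
    then show "\<exists>g. radial_symbol M (Suc 0) 0 g \<and> (\<forall>p\<in>off_axes. ?D p (e, 0) = g p)"
      by (intro exI conjI) auto
    show "\<exists>g. radial_symbol M 0 (Suc 0) g \<and> (\<forall>p\<in>off_axes. ?D p (0, e) = g p)"
      by (rule exI[of _ "\<lambda>p. 0"]) (auto intro: radial_symbol.zero)
  qed
next
  case (direction_snd c)
  let ?D = "\<lambda>p v :: 'a \<times> 'a. complex_of_real ((snd v \<bullet> c) * (1 / norm (snd p)) + - 1 * ((snd p \<bullet> c / norm (snd p)) * ((snd p \<bullet> snd v / norm (snd p)) * (1 / norm (snd p)))))"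
  show ?case
  proof (intro exI[of _ ?D] conjI ballI)
    fix p :: "'a \<times> 'a" assume p: "p \<in> off_axes"
    then show "((\<lambda>p. complex_of_real (snd p \<bullet> c / norm (snd p))) has_derivative ?D p) (at p)"
      by (auto intro!: derivative_eq_intros has_derivative_norm_fst has_derivative_norm_snd simp: mem_off_axes sgn_div_norm fun_eq_iff field_simps power2_eq_square inner_commute)
  next
    fix e :: 'a
    have "radial_symbol M 0 (Suc 0) (\<lambda>p::'a \<times> 'a. complex_of_real (e \<bullet> c) * complex_of_real (1 / norm (snd p))
      + complex_of_real (- 1) * (complex_of_real (snd p \<bullet> c / norm (snd p)) * (complex_of_real (snd p \<bullet> e / norm (snd p)) * complex_of_real (1 / norm (snd p)))))"
      by (intro radial_symbol.add radial_symbol_mult_eq[OF radial_symbol.const[of M "complex_of_real (e \<bullet> c)"] radial_symbol.inverse_snd]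
        radial_symbol_mult_eq[OF radial_symbol.const[of M "complex_of_real (- 1)"] radial_symbol_mult_eq[OF radial_symbol.direction_snd
          radial_symbol_mult_eq[OF radial_symbol.direction_snd radial_symbol.inverse_snd refl refl] refl refl]]) auto
    then show "\<exists>g. radial_symbol M 0 (Suc 0) g \<and> (\<forall>p\<in>off_axes. ?D p (0, e) = g p)"
      by (intro exI conjI) auto
    show "\<exists>g. radial_symbol M (Suc 0) 0 g \<and> (\<forall>p\<in>off_axes. ?D p (e, 0) = g p)"
      by (rule exI[of _ "\<lambda>p. 0"]) (auto intro: radial_symbol.zero)
  qed
next
  case inverse_fst
  let ?D = "\<lambda>p v :: 'a \<times> 'a. complex_of_real (- 1 * ((fst p \<bullet> fst v / norm (fst p)) * ((1 / norm (fst p)) * (1 / norm (fst p)))))"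
  show ?case
  proof (intro exI[of _ ?D] conjI ballI)
    fix p :: "'a \<times> 'a" assume p: "p \<in> off_axes"
    then show "((\<lambda>p. complex_of_real (1 / norm (fst p))) has_derivative ?D p) (at p)"
      by (auto intro!: derivative_eq_intros has_derivative_norm_fst has_derivative_norm_snd simp: mem_off_axes sgn_div_norm fun_eq_iff field_simps power2_eq_square inner_commute)
  next
    fix e :: 'a
    have "radial_symbol M (Suc 1) 0 (\<lambda>p::'a \<times> 'a. complex_of_real (- 1) * (complex_of_real (fst p \<bullet> e / norm (fst p)) * (complex_of_real (1 / norm (fst p)) * complex_of_real (1 / norm (fst p)))))"
      by (intro radial_symbol_mult_eq[OF radial_symbol.const[of M "complex_of_real (- 1)"] radial_symbol_mult_eq[OF radial_symbol.direction_fst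
          radial_symbol_mult_eq[OF radial_symbol.inverse_fst radial_symbol.inverse_fst refl refl] refl refl]]) auto
    then show "\<exists>g. radial_symbol M (Suc 1) 0 g \<and> (\<forall>p\<in>off_axes. ?D p (e, 0) = g p)"
      by (intro exI conjI) auto
    show "\<exists>g. radial_symbol M 1 (Suc 0) g \<and> (\<forall>p\<in>off_axes. ?D p (0, e) = g p)"
      by (rule exI[of _ "\<lambda>p. 0"]) (auto intro: radial_symbol.zero)
  qed
next
  case inverse_snd
  let ?D = "\<lambda>p v :: 'a \<times> 'a. complex_of_real (- 1 * ((snd p \<bullet> snd v / norm (snd p)) * ((1 / norm (snd p)) * (1 / norm (snd p)))))"
  show ?case
  proof (intro exI[of _ ?D] conjI ballI)
    fix p :: "'a \<times> 'a" assume p: "p \<in> off_axes"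
    then show "((\<lambda>p. complex_of_real (1 / norm (snd p))) has_derivative ?D p) (at p)"
      by (auto intro!: derivative_eq_intros has_derivative_norm_fst has_derivative_norm_snd simp: mem_off_axes sgn_div_norm fun_eq_iff field_simps power2_eq_square inner_commute)
  next
    fix e :: 'a
    have "radial_symbol M 0 (Suc 1) (\<lambda>p::'a \<times> 'a. complex_of_real (- 1) * (complex_of_real (snd p \<bullet> e / norm (snd p)) * (complex_of_real (1 / norm (snd p)) * complex_of_real (1 / norm (snd p)))))"
      by (intro radial_symbol_mult_eq[OF radial_symbol.const[of M "complex_of_real (- 1)"] radial_symbol_mult_eq[OF radial_symbol.direction_snd
          radial_symbol_mult_eq[OF radial_symbol.inverse_snd radial_symbol.inverse_snd refl refl] refl refl]]) auto
    then show "\<exists>g. radial_symbol M 0 (Suc 1) g \<and> (\<forall>p\<in>off_axes. ?D p (0, e) = g p)"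
      by (intro exI conjI) auto
    show "\<exists>g. radial_symbol M (Suc 0) 1 g \<and> (\<forall>p\<in>off_axes. ?D p (e, 0) = g p)"
      by (rule exI[of _ "\<lambda>p. 0"]) (auto intro: radial_symbol.zero)
  qed
next
  case (add k l f g)
  from add.IH(1) obtain D where D: "\<And>p. p \<in> off_axes \<Longrightarrow> (f has_derivative D p) (at p)"
    "\<And>b. b \<in> Basis \<Longrightarrow> \<exists>g. radial_symbol M (Suc k) l g \<and> (\<forall>p\<in>off_axes. D p (b, 0) = g p)"
    "\<And>b. b \<in> Basis \<Longrightarrow> \<exists>g. radial_symbol M k (Suc l) g \<and> (\<forall>p\<in>off_axes. D p (0, b) = g p)" by blast
  from add.IH(2) obtain E where E: "\<And>p. p \<in> off_axes \<Longrightarrow> (g has_derivative E p) (at p)"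
    "\<And>b. b \<in> Basis \<Longrightarrow> \<exists>g. radial_symbol M (Suc k) l g \<and> (\<forall>p\<in>off_axes. E p (b, 0) = g p)"
    "\<And>b. b \<in> Basis \<Longrightarrow> \<exists>g. radial_symbol M k (Suc l) g \<and> (\<forall>p\<in>off_axes. E p (0, b) = g p)" by blast
  show ?case
  proof (intro exI[of _ "\<lambda>p v. D p v + E p v"] conjI ballI)
    show "((\<lambda>p. f p + g p) has_derivative (\<lambda>v. D p v + E p v)) (at p)" if "p \<in> off_axes" for p
      by (intro has_derivative_add D(1) E(1) that)
    fix b :: 'a assume b: "b \<in> Basis"
    obtain F G where "radial_symbol M (Suc k) l F" "radial_symbol M (Suc k) l G" "\<forall>p\<in>off_axes. D p (b, 0) = F p" "\<forall>p\<in>off_axes. E p (b, 0) = G p"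
      using D(2)[OF b] E(2)[OF b] by blast
    then show "\<exists>g. radial_symbol M (Suc k) l g \<and> (\<forall>p\<in>off_axes. D p (b, 0) + E p (b, 0) = g p)"
      by (intro exI[of _ "\<lambda>p. F p + G p"]) (auto intro: radial_symbol.add)
    obtain F G where "radial_symbol M k (Suc l) F" "radial_symbol M k (Suc l) G" "\<forall>p\<in>off_axes. D p (0, b) = F p" "\<forall>p\<in>off_axes. E p (0, b) = G p"
      using D(3)[OF b] E(3)[OF b] by blast
    then show "\<exists>g. radial_symbol M k (Suc l) g \<and> (\<forall>p\<in>off_axes. D p (0, b) + E p (0, b) = g p)"
      by (intro exI[of _ "\<lambda>p. F p + G p"]) (auto intro: radial_symbol.add)
  qed
next
  case (mult k l f k' l' g)
  from mult.IH(1) obtain D where D: "\<And>p. p \<in> off_axes \<Longrightarrow> (f has_derivative D p) (at p)"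
    "\<And>b. b \<in> Basis \<Longrightarrow> \<exists>g. radial_symbol M (Suc k) l g \<and> (\<forall>p\<in>off_axes. D p (b, 0) = g p)"
    "\<And>b. b \<in> Basis \<Longrightarrow> \<exists>g. radial_symbol M k (Suc l) g \<and> (\<forall>p\<in>off_axes. D p (0, b) = g p)" by blast
  from mult.IH(2) obtain E where E: "\<And>p. p \<in> off_axes \<Longrightarrow> (g has_derivative E p) (at p)"
    "\<And>b. b \<in> Basis \<Longrightarrow> \<exists>g. radial_symbol M (Suc k') l' g \<and> (\<forall>p\<in>off_axes. E p (b, 0) = g p)"
    "\<And>b. b \<in> Basis \<Longrightarrow> \<exists>g. radial_symbol M k' (Suc l') g \<and> (\<forall>p\<in>off_axes. E p (0, b) = g p)" by blast
  note fg = mult.hyps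
  show ?case
  proof (intro exI[of _ "\<lambda>p v. f p * E p v + D p v * g p"] conjI ballI)
    show "((\<lambda>p. f p * g p) has_derivative (\<lambda>v. f p * E p v + D p v * g p)) (at p)" if "p \<in> off_axes" for p
      by (intro has_derivative_mult D(1) E(1) that)
    fix b :: 'a assume b: "b \<in> Basis"
    obtain F G where "radial_symbol M (Suc k) l F" "radial_symbol M (Suc k') l' G" "\<forall>p\<in>off_axes. D p (b, 0) = F p" "\<forall>p\<in>off_axes. E p (b, 0) = G p"
      using D(2)[OF b] E(2)[OF b] by blast
    then show "\<exists>h. radial_symbol M (Suc (k + k')) (l + l') h \<and> (\<forall>p\<in>off_axes. f p * E p (b, 0) + D p (b, 0) * g p = h p)"
      by (intro exI[of _ "\<lambda>p. f p * G p + F p * g p"] conjI radial_symbol.add)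
         (auto intro: radial_symbol_mult_eq[OF fg(1)] radial_symbol_mult_eq[OF _ fg(2)])
    obtain F G where "radial_symbol M k (Suc l) F" "radial_symbol M k' (Suc l') G" "\<forall>p\<in>off_axes. D p (0, b) = F p" "\<forall>p\<in>off_axes. E p (0, b) = G p"
      using D(3)[OF b] E(3)[OF b] by blast
    then show "\<exists>h. radial_symbol M (k + k') (Suc (l + l')) h \<and> (\<forall>p\<in>off_axes. f p * E p (0, b) + D p (0, b) * g p = h p)"
      by (intro exI[of _ "\<lambda>p. f p * G p + F p * g p"] conjI radial_symbol.add)
         (auto intro: radial_symbol_mult_eq[OF fg(1)] radial_symbol_mult_eq[OF _ fg(2)])
  qed
qed

lemma radial_symbol_dpartial:
  fixes f :: "'a::euclidean_space \<times> 'a \<Rightarrow> complex"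
  assumes f: "radial_symbol M k l f" and F: "\<And>p. p \<in> off_axes \<Longrightarrow> F p = f p" and b: "b \<in> Basis"
  shows "\<exists>g. radial_symbol M (Suc k) l g \<and> (\<forall>p\<in>off_axes. dpartial (b, 0) F p = g p)"
    and "\<exists>g. radial_symbol M k (Suc l) g \<and> (\<forall>p\<in>off_axes. dpartial (0, b) F p = g p)"
proof -
  obtain D where D: "\<And>p. p \<in> off_axes \<Longrightarrow> (f has_derivative D p) (at p)"
    "\<exists>g. radial_symbol M (Suc k) l g \<and> (\<forall>p\<in>off_axes. D p (b, 0) = g p)"
    "\<exists>g. radial_symbol M k (Suc l) g \<and> (\<forall>p\<in>off_axes. D p (0, b) = g p)"
    using radial_symbol_derivative[OF f] b by blast
  have "frechet_derivative F (at p) = D p" if "p \<in> off_axes" for p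
    using frechet_derivative_cong_open[OF open_off_axes that, of F f] F frechet_derivative_at[OF D(1)[OF that]] by simp
  with D(2,3) show "\<exists>g. radial_symbol M (Suc k) l g \<and> (\<forall>p\<in>off_axes. dpartial (b, 0) F p = g p)"
    and "\<exists>g. radial_symbol M k (Suc l) g \<and> (\<forall>p\<in>off_axes. dpartial (0, b) F p = g p)" by auto
qed

lemma radial_symbol_marcinkiewicz:
  fixes f :: "'a::euclidean_space \<times> 'a \<Rightarrow> complex"
  assumes f: "radial_symbol M 0 0 f"
  shows "marcinkiewicz_function f"
  unfolding marcinkiewicz_function_def
proof (intro conjI ballI)
  have "smooth_on off_axes f"
  proof (rule smooth_on_coinduct(1)[of _ "\<lambda>f. \<exists>k l. radial_symbol M k l f", OF open_off_axes])
    show "\<exists>k l. radial_symbol M k l f" using f by blast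
    fix f :: "'a \<times> 'a \<Rightarrow> complex" assume "\<exists>k l. radial_symbol M k l f"
    then obtain k l where "radial_symbol M k l f" by blast
    from radial_symbol_derivative[OF this] obtain D where D: "\<And>p. p \<in> off_axes \<Longrightarrow> (f has_derivative D p) (at p)"
      "\<And>b. b \<in> Basis \<Longrightarrow> \<exists>g. radial_symbol M (Suc k) l g \<and> (\<forall>p\<in>off_axes. D p (b, 0) = g p)"
      "\<And>b. b \<in> Basis \<Longrightarrow> \<exists>g. radial_symbol M k (Suc l) g \<and> (\<forall>p\<in>off_axes. D p (0, b) = g p)" by blast
    have "\<exists>g. (\<exists>k l. radial_symbol M k l g) \<and> (\<forall>p\<in>off_axes. D p b = g p)" if "b \<in> Basis" for b
      using that D(2,3) unfolding Basis_prod_def by blast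
    with D(1) show "\<exists>D. (\<forall>p\<in>off_axes. (f has_derivative D p) (at p)) \<and>
        (\<forall>b\<in>Basis. \<exists>g. (\<exists>k l. radial_symbol M k l g) \<and> (\<forall>p\<in>off_axes. D p b = g p))" by blast
  qed
  then show "smooth_on {(\<xi>, \<eta>). \<xi> \<noteq> 0 \<and> \<eta> \<noteq> 0} f" by (simp only: off_axes_def)
  fix \<alpha> \<beta> :: "'a list" assume \<alpha>: "\<alpha> \<in> lists Basis" and \<beta>: "\<beta> \<in> lists Basis"
  \<comment> \<open>The entries at the end of a list are differentiated first, so the \<beta> part
    is built before the \<alpha> part.\<close>
  have \<beta>': "\<exists>g. radial_symbol M 0 (length \<beta>) g \<and> (\<forall>p\<in>off_axes. partials (map (\<lambda>b. (0, b)) \<beta>) f p = g p)"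
    using \<beta>
  proof (induction \<beta>)
    case Nil
    then show ?case using f by auto
  next
    case (Cons b \<beta>)
    then obtain g where g: "radial_symbol M 0 (length \<beta>) g" "\<And>p. p \<in> off_axes \<Longrightarrow> partials (map (\<lambda>b. (0, b)) \<beta>) f p = g p"
      by auto
    have "b \<in> Basis" by (rule Cons.hyps(1))
    from radial_symbol_dpartial(2)[OF g this] show ?case by simp
  qed
  have "\<exists>g. radial_symbol M (length \<alpha>) (length \<beta>) g \<and>
     (\<forall>p\<in>off_axes. partials (map (\<lambda>b. (b, 0)) \<alpha> @ map (\<lambda>b. (0, b)) \<beta>) f p = g p)"
    using \<alpha>
  proof (induction \<alpha>)
    case Nil
    then show ?case using \<beta>' by auto
  next
    case (Cons b \<alpha>)
    then obtain g where g: "radial_symbol M (length \<alpha>) (length \<beta>) g"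
      "\<And>p. p \<in> off_axes \<Longrightarrow> partials (map (\<lambda>b. (b, 0)) \<alpha> @ map (\<lambda>b. (0, b)) \<beta>) f p = g p"
      by auto
    have "b \<in> Basis" by (rule Cons.hyps(1))
    from radial_symbol_dpartial(1)[OF g this] show ?case by simp
  qed
  then obtain g where g: "radial_symbol M (length \<alpha>) (length \<beta>) g"
    "\<And>p. p \<in> off_axes \<Longrightarrow> partials (map (\<lambda>b. (b, 0)) \<alpha> @ map (\<lambda>b. (0, b)) \<beta>) f p = g p" by blast
  from radial_symbol_bound[OF g(1)] obtain C where
    "\<And>p. p \<in> off_axes \<Longrightarrow> norm (fst p) ^ length \<alpha> * norm (snd p) ^ length \<beta> * norm (g p) \<le> C" by blast
  then show "\<exists>C. \<forall>\<xi> \<eta>. \<xi> \<noteq> 0 \<longrightarrow> \<eta> \<noteq> 0 \<longrightarrow> norm \<xi> ^ length \<alpha> * norm \<eta> ^ length \<beta> *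
     norm (partials (map (\<lambda>b. (b, 0)) \<alpha> @ map (\<lambda>b. (0, b)) \<beta>) f (\<xi>, \<eta>)) \<le> C"
    using g(2) by (intro exI[of _ C]) (force simp: mem_off_axes)
qed

end

section \<open>Bilinear operators with a bounded symbol\<close>

lemma schwartz_tendsto_const: "schwartz f \<Longrightarrow> schwartz_tendsto (\<lambda>_. f) f"
  by (simp add: schwartz_tendsto_def uniform_limit_const)

text \<open>Weighted uniform convergence with tolerance 1 gives the eventual common majorant with
  constant C + 1; together with pointwise convergence this is the input of dominated
  convergence.\<close>

lemma fourier_schwartz_tendsto_dominated:
  fixes F :: "nat \<Rightarrow> 'a::euclidean_space \<Rightarrow> complex"
  assumes F: "schwartz_tendsto F f"
  obtains A where "A > 0" "\<forall>\<^sub>F j in sequentially. \<forall>\<xi>. norm (fourier (F j) \<xi>) \<le> A / (1 + norm \<xi>) ^ N"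
    "\<And>\<xi>. (\<lambda>j. fourier (F j) \<xi>) \<longlonglongrightarrow> fourier f \<xi>"
proof -
  have f: "schwartz f" using F by (simp add: schwartz_tendsto_def)
  obtain C where C: "C > 0" "\<And>\<xi>. (1 + norm \<xi>) ^ N * norm (fourier f \<xi>) \<le> C"
    using rapidly_decreasingD[OF rapidly_decreasing_fourier[OF f]] by blast
  have "\<forall>\<^sub>F j in sequentially. \<forall>\<xi>. norm (fourier (F j) \<xi>) \<le> (C + 1) / (1 + norm \<xi>) ^ N"
    using fourier_schwartz_tendsto[OF F zero_less_one, of N]
  proof eventually_elim
    case (elim j)
    show ?case
    proof
      fix \<xi> :: 'a
      have p: "0 < (1 + norm \<xi>) ^ N" by (simp add: add_pos_nonneg)
      have "norm (fourier (F j) \<xi>) \<le> norm (fourier f \<xi>) + norm (fourier (F j) \<xi> - fourier f \<xi>)"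
        using norm_triangle_sub[of "fourier (F j) \<xi>" "fourier f \<xi>"] by simp
      then have "(1 + norm \<xi>) ^ N * norm (fourier (F j) \<xi>) \<le> (1 + norm \<xi>) ^ N * (norm (fourier f \<xi>) + norm (fourier (F j) \<xi> - fourier f \<xi>))"
        using p by (intro mult_left_mono) auto
      also have "\<dots> \<le> C + 1" using C(2)[of \<xi>] elim[rule_format, of \<xi>] by (simp add: distrib_left)
      finally show "norm (fourier (F j) \<xi>) \<le> (C + 1) / (1 + norm \<xi>) ^ N"
        using p by (simp add: pos_le_divide_eq mult.commute)
    qed
  qed
  moreover have "(\<lambda>j. fourier (F j) \<xi>) \<longlonglongrightarrow> fourier f \<xi>" for \<xi>
  proof (rule LIMSEQ_I)
    fix r :: real assume r: "r > 0"
    have "\<forall>\<^sub>F j in sequentially. norm (fourier (F j) \<xi> - fourier f \<xi>) < r"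
      using fourier_schwartz_tendsto[OF F half_gt_zero[OF r], of 0]
    proof eventually_elim
      case (elim j)
      then have "(1 + norm \<xi>) ^ 0 * norm (fourier (F j) \<xi> - fourier f \<xi>) \<le> r / 2" by blast
      then show ?case using r by simp
    qed
    then show "\<exists>no. \<forall>n\<ge>no. norm (fourier (F n) \<xi> - fourier f \<xi>) < r"
      by (simp add: eventually_sequentially)
  qed
  ultimately show ?thesis using C(1) that[of "C + 1"] by simp
qed

context
  fixes m :: "'a::euclidean_space \<times> 'a \<Rightarrow> complex" and B :: real
  assumes m[measurable]: "m \<in> borel_measurable borel" and B: "\<And>\<zeta>. norm (m \<zeta>) \<le> B"
begin

definition symbol_form :: "('a \<Rightarrow> complex) \<Rightarrow> ('a \<Rightarrow> complex) \<Rightarrow> ('a \<Rightarrow> complex) \<Rightarrow> complex" where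
  "symbol_form f g h = (\<integral>\<zeta>. fourier f (fst \<zeta>) * fourier g (snd \<zeta>) * fourier h (- (fst \<zeta> + snd \<zeta>)) * m \<zeta> \<partial>lborel)"

lemma fourier_triple_measurable:
  assumes "schwartz f" "schwartz g" "schwartz h"
  shows "(\<lambda>\<zeta>. fourier f (fst \<zeta>) * fourier g (snd \<zeta>) * fourier h (- (fst \<zeta> + snd \<zeta>)) * m \<zeta>) \<in> borel_measurable (lborel :: ('a \<times> 'a) measure)"
proof -
  have "(\<lambda>\<zeta>. fourier f (fst \<zeta>) * fourier g (snd \<zeta>) * fourier h (- (fst \<zeta> + snd \<zeta>))) \<in> borel_measurable (lborel :: ('a \<times> 'a) measure)"
    using fourier_triple_integrable[OF assms] unfolding lborel_prod by auto
  then show ?thesis by (rule borel_measurable_times) simp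
qed

lemma symbol_form_integrable:
  assumes "schwartz f" "schwartz g" "schwartz h"
  shows "integrable lborel (\<lambda>\<zeta>. fourier f (fst \<zeta>) * fourier g (snd \<zeta>) * fourier h (- (fst \<zeta> + snd \<zeta>)) * m \<zeta>)"
proof (rule Bochner_Integration.integrable_bound)
  show "integrable lborel (\<lambda>\<zeta>. norm (fourier f (fst \<zeta>) * fourier g (snd \<zeta>) * fourier h (- (fst \<zeta> + snd \<zeta>))) * B)"
    using fourier_triple_integrable[OF assms] unfolding lborel_prod by (intro integrable_mult_left integrable_norm)
  show "AE \<zeta> in lborel. norm (fourier f (fst \<zeta>) * fourier g (snd \<zeta>) * fourier h (- (fst \<zeta> + snd \<zeta>)) * m \<zeta>)
     \<le> norm (norm (fourier f (fst \<zeta>) * fourier g (snd \<zeta>) * fourier h (- (fst \<zeta> + snd \<zeta>))) * B)"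
    by (intro AE_I2) (simp only: norm_mult real_norm_def abs_mult abs_norm_cancel, intro mult_left_mono order_trans[OF B abs_ge_self], simp)
qed (rule fourier_triple_measurable[OF assms])

text \<open>The transforms of \<open>F j\<close> and \<open>G j\<close> bring integrable majorants
  in \<xi> and \<eta>, those of \<open>H j\<close> a constant. Letting all three arguments vary
  covers continuity in the inputs and in the test function at once.\<close>

lemma symbol_form_tendsto:
  assumes F: "schwartz_tendsto F f" and G: "schwartz_tendsto G g" and H: "schwartz_tendsto H h"
  shows "(\<lambda>j. symbol_form (F j) (G j) (H j)) \<longlonglongrightarrow> symbol_form f g h"
proof -
  let ?N = "DIM('a) + 2"
  have S: "schwartz (F j)" "schwartz (G j)" "schwartz (H j)" "schwartz f" "schwartz g" "schwartz h" for j
    using assms by (auto simp: schwartz_tendsto_def)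
  obtain A1 where A1: "A1 > 0" "\<forall>\<^sub>F j in sequentially. \<forall>\<xi>. norm (fourier (F j) \<xi>) \<le> A1 / (1 + norm \<xi>) ^ ?N"
    "\<And>\<xi>. (\<lambda>j. fourier (F j) \<xi>) \<longlonglongrightarrow> fourier f \<xi>"
    using fourier_schwartz_tendsto_dominated[OF F] by blast
  obtain A2 where A2: "A2 > 0" "\<forall>\<^sub>F j in sequentially. \<forall>\<xi>. norm (fourier (G j) \<xi>) \<le> A2 / (1 + norm \<xi>) ^ ?N"
    "\<And>\<xi>. (\<lambda>j. fourier (G j) \<xi>) \<longlonglongrightarrow> fourier g \<xi>"
    using fourier_schwartz_tendsto_dominated[OF G] by blast
  obtain A3 where A3: "A3 > 0" "\<forall>\<^sub>F j in sequentially. \<forall>\<xi>. norm (fourier (H j) \<xi>) \<le> A3 / (1 + norm \<xi>) ^ 0"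
    "\<And>\<xi>. (\<lambda>j. fourier (H j) \<xi>) \<longlonglongrightarrow> fourier h \<xi>"
    using fourier_schwartz_tendsto_dominated[OF H] by blast
  from A1(2) A2(2) A3(2) have "\<forall>\<^sub>F j in sequentially. (\<forall>\<xi>. norm (fourier (F j) \<xi>) \<le> A1 / (1 + norm \<xi>) ^ ?N) \<and>
     (\<forall>\<xi>. norm (fourier (G j) \<xi>) \<le> A2 / (1 + norm \<xi>) ^ ?N) \<and> (\<forall>\<xi>. norm (fourier (H j) \<xi>) \<le> A3)"
    by eventually_elim simp
  \<comment> \<open>The majorants hold only from some index on, so the sequences are shifted by
    \<open>J\<close> before dominated convergence.\<close>
  then obtain J where J: "\<And>j \<xi>. j \<ge> J \<Longrightarrow> norm (fourier (F j) \<xi>) \<le> A1 / (1 + norm \<xi>) ^ ?N"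
    "\<And>j \<xi>. j \<ge> J \<Longrightarrow> norm (fourier (G j) \<xi>) \<le> A2 / (1 + norm \<xi>) ^ ?N"
    "\<And>j \<xi>. j \<ge> J \<Longrightarrow> norm (fourier (H j) \<xi>) \<le> A3"
    unfolding eventually_sequentially by blast
  let ?W = "\<lambda>\<zeta>::'a \<times> 'a. A1 / (1 + norm (fst \<zeta>)) ^ ?N * (A2 / (1 + norm (snd \<zeta>)) ^ ?N) * A3 * B"
  have "(\<lambda>j. symbol_form (F (j + J)) (G (j + J)) (H (j + J))) \<longlonglongrightarrow> symbol_form f g h"
    unfolding symbol_form_def
  proof (rule integral_dominated_convergence[where w="?W"])
    show "integrable lborel ?W"
    proof -
      have i: "integrable lborel (\<lambda>x::'a. complex_of_real (A / (1 + norm x) ^ ?N))" for A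
        using integrable_mult_right[OF integrable_inverse_one_plus_norm_power[OF order_refl, where 'a='a], of A]
        by (intro integrable_of_real) simp
      have "integrable (lborel \<Otimes>\<^sub>M lborel) (\<lambda>(x::'a, y::'a). complex_of_real (A1 / (1 + norm x) ^ ?N) * complex_of_real (A2 / (1 + norm y) ^ ?N))"
        by (rule integrable_pair_mult[OF sigma_finite_lborel sigma_finite_lborel i i])
      then have "integrable lborel (\<lambda>\<zeta>::'a \<times> 'a. complex_of_real (A1 / (1 + norm (fst \<zeta>)) ^ ?N * (A2 / (1 + norm (snd \<zeta>)) ^ ?N)))"
        by (simp add: lborel_prod case_prod_unfold)
      then have "integrable lborel (\<lambda>\<zeta>::'a \<times> 'a. A1 / (1 + norm (fst \<zeta>)) ^ ?N * (A2 / (1 + norm (snd \<zeta>)) ^ ?N))"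
        by (simp only: complex_of_real_integrable_eq)
      then show ?thesis by (intro integrable_mult_left)
    qed
    show "AE \<zeta> in lborel. norm (fourier (F (j + J)) (fst \<zeta>) * fourier (G (j + J)) (snd \<zeta>) * fourier (H (j + J)) (- (fst \<zeta> + snd \<zeta>)) * m \<zeta>) \<le> ?W \<zeta>" for j
    proof (rule AE_I2)
      fix \<zeta> :: "'a \<times> 'a"
      have B0: "0 \<le> B" using B[of \<zeta>] norm_ge_zero order_trans by blast
      show "norm (fourier (F (j + J)) (fst \<zeta>) * fourier (G (j + J)) (snd \<zeta>) * fourier (H (j + J)) (- (fst \<zeta> + snd \<zeta>)) * m \<zeta>) \<le> ?W \<zeta>"
        unfolding norm_mult using A1(1) A2(1) A3(1) B0
        by (intro mult_mono J B) (auto intro!: mult_nonneg_nonneg divide_nonneg_nonneg)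
    qed
    show "AE \<zeta> in lborel. (\<lambda>j. fourier (F (j + J)) (fst \<zeta>) * fourier (G (j + J)) (snd \<zeta>) * fourier (H (j + J)) (- (fst \<zeta> + snd \<zeta>)) * m \<zeta>)
      \<longlonglongrightarrow> fourier f (fst \<zeta>) * fourier g (snd \<zeta>) * fourier h (- (fst \<zeta> + snd \<zeta>)) * m \<zeta>"
      by (intro AE_I2 tendsto_mult tendsto_const LIMSEQ_ignore_initial_segment A1(3) A2(3) A3(3))
  qed (intro fourier_triple_measurable S)+
  then show ?thesis by (rule LIMSEQ_offset)
qed

lemma symbol_form_add:
  assumes "schwartz f" "schwartz f'" "schwartz g" "schwartz h"
  shows "symbol_form (\<lambda>x. f x + f' x) g h = symbol_form f g h + symbol_form f' g h"
    and "symbol_form g (\<lambda>x. f x + f' x) h = symbol_form g f h + symbol_form g f' h"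
    and "symbol_form g h (\<lambda>x. f x + f' x) = symbol_form g h f + symbol_form g h f'"
  unfolding symbol_form_def fourier_add[OF schwartz_integrable[OF assms(1)] schwartz_integrable[OF assms(2)]]
  by (subst Bochner_Integration.integral_add[symmetric];
      (intro symbol_form_integrable assms | simp only: distrib_left distrib_right))+

lemma symbol_form_cmult:
  shows "symbol_form (\<lambda>x. c * f x) g h = c * symbol_form f g h"
    and "symbol_form f (\<lambda>x. c * g x) h = c * symbol_form f g h"
    and "symbol_form f g (\<lambda>x. c * h x) = c * symbol_form f g h"
  unfolding symbol_form_def fourier_cmult integral_mult_right_zero[symmetric] by (simp_all only: mult_ac)

text \<open>Translating \<open>f\<close> and \<open>g\<close> multiplies by the characters in \<xi>
  and in \<eta>; translating \<open>h\<close> the other way gives their product, because its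
  transform is taken at -(\<xi> + \<eta>).\<close>

lemma symbol_form_translate:
  "symbol_form (\<lambda>x. f (x - a)) (\<lambda>x. g (x - a)) h = symbol_form f g (\<lambda>x. h (x + a))"
proof -
  have "fourier (\<lambda>x. h (x + a)) \<xi> = cis (- 2 * pi * ((- a) \<bullet> \<xi>)) * fourier h \<xi>" for \<xi>
    using fourier_translate[of h "- a" \<xi>] by simp
  moreover have "cis (- 2 * pi * ((- a) \<bullet> (- (\<xi> + \<eta>)))) = cis (- 2 * pi * (a \<bullet> \<xi>)) * cis (- 2 * pi * (a \<bullet> \<eta>))" for \<xi> \<eta>
    by (simp add: cis_mult inner_add_right inner_diff_right distrib_left)
  ultimately show ?thesis
    unfolding symbol_form_def fourier_translate by (simp only: mult_ac)
qed

lemma symbol_form_multiplier: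
  assumes T: "\<And>f g h. schwartz f \<Longrightarrow> schwartz g \<Longrightarrow> schwartz h \<Longrightarrow> T f g h = symbol_form f g h"
  shows "bilinear_fourier_multiplier T"
  unfolding bilinear_fourier_multiplier_def tempered_distribution_def
proof (intro conjI allI impI)
  fix f g h :: "'a \<Rightarrow> complex" and F
  assume fg: "schwartz f" "schwartz g" and F: "schwartz_tendsto F h"
  then have "schwartz (F j)" "schwartz h" for j by (auto simp: schwartz_tendsto_def)
  then show "(\<lambda>j. T f g (F j)) \<longlonglongrightarrow> T f g h"
    using symbol_form_tendsto[OF schwartz_tendsto_const[OF fg(1)] schwartz_tendsto_const[OF fg(2)] F] fg by (simp add: T)
next
  fix F G and f g h :: "'a \<Rightarrow> complex"
  assume F: "schwartz_tendsto F f" and G: "schwartz_tendsto G g" and h: "schwartz h"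
  then have "schwartz (F j)" "schwartz f" "schwartz (G j)" "schwartz g" for j by (auto simp: schwartz_tendsto_def)
  then show "(\<lambda>j. T (F j) (G j) h) \<longlonglongrightarrow> T f g h"
    using symbol_form_tendsto[OF F G schwartz_tendsto_const[OF h]] h by (simp add: T)
next
  fix a :: 'a and f g h :: "'a \<Rightarrow> complex" assume "schwartz f" "schwartz g" "schwartz h"
  then show "T (\<lambda>x. f (x - a)) (\<lambda>x. g (x - a)) h = T f g (\<lambda>x. h (x + a))"
    using schwartz_translate(1)[of f a] schwartz_translate(1)[of g a] schwartz_translate(1)[of h "- a"]
    by (simp add: T symbol_form_translate)
qed (simp_all add: T schwartz_add(1) schwartz_cmult(1) symbol_form_add symbol_form_cmult)

lemma bounded_symbol_integrable:
  assumes \<phi>: "schwartz \<phi>"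
  shows "integrable lborel (\<lambda>x. m x * \<phi> x)"
proof (rule Bochner_Integration.integrable_bound)
  have [measurable]: "\<phi> \<in> borel_measurable borel" using \<phi> by auto
  show "integrable lborel (\<lambda>x. B * norm (\<phi> x))" using schwartz_integrable[OF \<phi>] by simp
  show "(\<lambda>x. m x * \<phi> x) \<in> borel_measurable lborel" by measurable
  show "AE x in lborel. norm (m x * \<phi> x) \<le> norm (B * norm (\<phi> x))"
    by (intro AE_I2) (simp only: norm_mult real_norm_def abs_mult abs_norm_cancel, intro mult_right_mono order_trans[OF B abs_ge_self] norm_ge_zero)
qed

lemma lebesgue_bounded_symbol:
  assumes \<phi>: "schwartz \<phi>"
  shows "integrable lebesgue (\<lambda>x. m x * \<phi> x)"
    and "(\<integral>x. m x * \<phi> x \<partial>lebesgue) = (\<integral>x. m x * \<phi> x \<partial>lborel)"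
proof -
  have [measurable]: "\<phi> \<in> borel_measurable borel" using \<phi> by auto
  have "(\<lambda>x. m x * \<phi> x) \<in> borel_measurable lborel" by measurable
  then show "integrable lebesgue (\<lambda>x. m x * \<phi> x)"
    and "(\<integral>x. m x * \<phi> x \<partial>lebesgue) = (\<integral>x. m x * \<phi> x \<partial>lborel)"
    using bounded_symbol_integrable[OF \<phi>] by (auto simp: integrable_completion integral_completion)
qed

lemma bounded_symbol_tempered: "tempered_distribution (\<lambda>\<phi>. \<integral>x. m x * \<phi> x \<partial>lebesgue)"
  unfolding tempered_distribution_def
proof (intro conjI allI impI)
  fix f g :: "'a \<times> 'a \<Rightarrow> complex" assume fg: "schwartz f" "schwartz g"
  then show "(\<integral>x. m x * (f x + g x) \<partial>lebesgue) = (\<integral>x. m x * f x \<partial>lebesgue) + (\<integral>x. m x * g x \<partial>lebesgue)"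
    using lebesgue_bounded_symbol(1)[OF fg(1)] lebesgue_bounded_symbol(1)[OF fg(2)] by (simp add: distrib_left)
next
  fix c and f :: "'a \<times> 'a \<Rightarrow> complex"
  have "(\<integral>x. m x * (c * f x) \<partial>lebesgue) = (\<integral>x. c * (m x * f x) \<partial>lebesgue)" by (simp add: mult_ac)
  then show "(\<integral>x. m x * (c * f x) \<partial>lebesgue) = c * (\<integral>x. m x * f x \<partial>lebesgue)" by simp
next
  fix F and f :: "'a \<times> 'a \<Rightarrow> complex" assume F: "schwartz_tendsto F f"
  have Fj: "schwartz (F j)" and f: "schwartz f" for j using F by (auto simp: schwartz_tendsto_def)
  let ?k = "DIM('a \<times> 'a) + 2"
  define I where "I = (\<integral>x. 1 / (1 + norm x) ^ ?k \<partial>(lborel :: ('a \<times> 'a) measure))"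
  have Ii: "integrable lborel (\<lambda>x::'a \<times> 'a. 1 / (1 + norm x) ^ ?k)" by (rule integrable_inverse_one_plus_norm_power) simp
  have I0: "I \<ge> 0" unfolding I_def by (intro Bochner_Integration.integral_nonneg) simp
  have B0: "B \<ge> 0" using B[of 0] norm_ge_zero order_trans by blast
  have "(\<lambda>j. \<integral>x. m x * F j x \<partial>lborel) \<longlonglongrightarrow> (\<integral>x. m x * f x \<partial>lborel)"
  proof (rule LIMSEQ_I)
    fix r :: real assume r: "r > 0"
    \<comment> \<open>Weighted closeness \<epsilon> of the test functions costs at most B I
      \<epsilon> in the integral; the summand 1 keeps the denominator positive.\<close>
    define \<epsilon> where "\<epsilon> = r / (B * I + 1)"
    have e: "\<epsilon> > 0" "B * I * \<epsilon> < r" using r B0 I0 by (auto simp: \<epsilon>_def field_simps add_pos_nonneg)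
    have "\<forall>\<^sub>F j in sequentially. norm ((\<integral>x. m x * F j x \<partial>lborel) - (\<integral>x. m x * f x \<partial>lborel)) < r"
      using schwartz_tendsto_weight[OF F lists.Nil e(1), of ?k]
    proof eventually_elim
      case (elim j)
      have "norm ((\<integral>x. m x * F j x \<partial>lborel) - (\<integral>x. m x * f x \<partial>lborel)) = norm (\<integral>x. m x * F j x - m x * f x \<partial>lborel)"
        by (subst Bochner_Integration.integral_diff[OF bounded_symbol_integrable[OF Fj] bounded_symbol_integrable[OF f]]) simp
      also have "\<dots> \<le> (\<integral>x. B * \<epsilon> * (1 / (1 + norm x) ^ ?k) \<partial>(lborel :: ('a \<times> 'a) measure))"
      proof (rule Bochner_Integration.integral_norm_bound_integral)
        show "integrable lborel (\<lambda>x. m x * F j x - m x * f x)"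
          by (intro Bochner_Integration.integrable_diff bounded_symbol_integrable Fj f)
        show "integrable lborel (\<lambda>x::'a \<times> 'a. B * \<epsilon> * (1 / (1 + norm x) ^ ?k))" by (rule integrable_mult_right[OF Ii])
        fix x :: "'a \<times> 'a"
        have p: "0 < (1 + norm x) ^ ?k" by (simp add: add_pos_nonneg)
        have "norm (F j x - f x) \<le> \<epsilon> * (1 / (1 + norm x) ^ ?k)"
          using elim[rule_format, of x] p by (simp add: pos_le_divide_eq mult.commute del: power_Suc power_add add_2_eq_Suc')
        then have "norm (m x) * norm (F j x - f x) \<le> B * (\<epsilon> * (1 / (1 + norm x) ^ ?k))"
          using B[of x] B0 by (intro mult_mono) auto
        then show "norm (m x * F j x - m x * f x) \<le> B * \<epsilon> * (1 / (1 + norm x) ^ ?k)"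
          by (simp only: right_diff_distrib[symmetric] norm_mult mult.assoc)
      qed
      also have "\<dots> = B * I * \<epsilon>"
        unfolding I_def by (subst integral_mult_right_zero) (simp only: mult_ac)
      finally show ?case using e by simp
    qed
    then show "\<exists>no. \<forall>n\<ge>no. norm ((\<integral>x. m x * F n x \<partial>lborel) - (\<integral>x. m x * f x \<partial>lborel)) < r"
      by (simp add: eventually_sequentially)
  qed
  then show "(\<lambda>j. \<integral>x. m x * F j x \<partial>lebesgue) \<longlonglongrightarrow> (\<integral>x. m x * f x \<partial>lebesgue)"
    by (simp add: lebesgue_bounded_symbol(2) Fj f)
qed

lemma symbol_form_marcinkiewicz_type:
  assumes T: "\<And>f g h. schwartz f \<Longrightarrow> schwartz g \<Longrightarrow> schwartz h \<Longrightarrow> T f g h = symbol_form f g h"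
    and m': "marcinkiewicz_function m"
  shows "marcinkiewicz_type T"
  unfolding marcinkiewicz_type_def
proof (intro conjI exI)
  \<comment> \<open>Integration against \<open>m\<close> is a formula valid for every argument, so
    its value on the product of three transforms is the integral in \<open>symbol_form\<close>,
    taken over the completed measure.\<close>
  let ?u = "\<lambda>\<phi>. \<integral>x. m x * \<phi> x \<partial>lebesgue"
  show "bilinear_fourier_multiplier T" by (rule symbol_form_multiplier[OF T])
  show "represented_by ?u m"
    unfolding represented_by_def using lebesgue_bounded_symbol(1) by blast
  show "marcinkiewicz_function m" by (rule m')
  show "bilinear_symbol T ?u"
    unfolding bilinear_symbol_def
  proof (intro conjI allI impI bounded_symbol_tempered)
    fix f g h :: "'a \<Rightarrow> complex" assume S: "schwartz f" "schwartz g" "schwartz h"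
    have "T f g h = (\<integral>\<zeta>. m \<zeta> * (case \<zeta> of (\<xi>, \<eta>) \<Rightarrow> fourier f \<xi> * fourier g \<eta> * fourier h (- (\<xi> + \<eta>))) \<partial>lborel)"
      unfolding T[OF S] symbol_form_def by (simp only: case_prod_unfold mult.commute)
    also have "\<dots> = (\<integral>\<zeta>. m \<zeta> * (case \<zeta> of (\<xi>, \<eta>) \<Rightarrow> fourier f \<xi> * fourier g \<eta> * fourier h (- (\<xi> + \<eta>))) \<partial>lebesgue)"
      by (rule integral_completion[symmetric])
         (use fourier_triple_measurable[OF S] in \<open>simp only: case_prod_unfold mult.commute\<close>)
    finally show "T f g h = ?u (\<lambda>(\<xi>, \<eta>). fourier f \<xi> * fourier g \<eta> * fourier h (- (\<xi> + \<eta>)))" .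
  qed
qed

end

section \<open>The averaged symbol on R^n\<close>

lemma AE_off_axes: "AE p in (lborel :: ('a::euclidean_space \<times> 'b::euclidean_space) measure). p \<in> off_axes"
proof -
  obtain b :: 'a where b: "b \<in> Basis" using nonempty_Basis by blast
  obtain c :: 'b where c: "c \<in> Basis" using nonempty_Basis by blast
  from b c have "AE p in lborel. (b, 0 :: 'b) \<bullet> p \<noteq> 0" "AE p in lborel. (0 :: 'a, c) \<bullet> p \<noteq> 0"
    by (auto intro!: AE_inner_nonzero simp: zero_prod_def nonzero_Basis)
  then show ?thesis by eventually_elim (auto simp: mem_off_axes inner_prod_def)
qed

theorem proposition3p1:
  fixes K :: "(real \<times> real \<Rightarrow> complex) \<Rightarrow> complex"
  assumes "tempered_distribution K"
    and "bi_even K"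
    and "marcinkiewicz_type (bilinear_operator K)"
    and "odd CARD('n::finite)"
    and "CARD('n) \<ge> 3"
  shows "marcinkiewicz_type
    (bilinear_operator (radial_extension K :: ((real^'n) \<times> (real^'n) \<Rightarrow> complex) \<Rightarrow> complex))"
proof -
  obtain u m where u: "bilinear_symbol (bilinear_operator K) u" "represented_by u m" "marcinkiewicz_function m"
    using assms(3) by (auto simp: marcinkiewicz_type_def)
  \<comment> \<open>A Borel representative of the symbol: the given \<open>m\<close> is arbitrary on
    the axes, whereas this one is 0 there, bounded everywhere, and continuous off the axes.\<close>
  define m0 where "m0 = mixed_partial m 0 0"
  have m0[measurable]: "m0 \<in> borel_measurable borel"
    unfolding m0_def by (rule mixed_partial_borel_measurable[OF u(3)])
  have m0_eq: "m0 p = m p" if "p \<in> off_axes" for p using that by (simp add: m0_def mixed_partial_def)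
  obtain B where B: "\<And>p. norm (m0 p) \<le> B"
    using mixed_partial_bound[OF u(3), of 0 0] unfolding m0_def by (metis mult_1 power_0 surj_pair)
  have m0_cont: "isCont m0 (x, y)" if "x \<noteq> 0" "y \<noteq> 0" for x y
    unfolding m0_def using mixed_partial_has_derivative[OF u(3), of "(x, y)" 0 0] that
    by (intro has_derivative_continuous) (simp add: mem_off_axes)
  \<comment> \<open>The axes are a null set, so \<open>m\<close> may be replaced by
    \<open>m0\<close> under the completed measure; Borel measurability of \<open>m0\<close> then
    allows the passage to \<open>lborel\<close>.\<close>
  have symbol: "bilinear_operator K f g h = (\<integral>(\<xi>,\<eta>). m0 (\<xi>,\<eta>) * (fourier f \<xi> * fourier g \<eta> * fourier h (- (\<xi> + \<eta>))) \<partial>lborel)"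
    if S: "schwartz f" "schwartz g" "schwartz h" "schwartz (\<lambda>(\<xi>,\<eta>). fourier f \<xi> * fourier g \<eta> * fourier h (- (\<xi> + \<eta>)))" for f g h
  proof -
    let ?W = "\<lambda>(\<xi>,\<eta>). fourier f \<xi> * fourier g \<eta> * fourier h (- (\<xi> + \<eta>))"
    have [measurable]: "?W \<in> borel_measurable borel" using S(4) by (rule schwartz_borel_measurable)
    have 1: "bilinear_operator K f g h = u ?W" using u(1) S unfolding bilinear_symbol_def by blast
    have 2: "u ?W = (\<integral>x. m x * ?W x \<partial>lebesgue)" and i: "integrable lebesgue (\<lambda>x. m x * ?W x)"
      using u(2) S(4) unfolding represented_by_def by blast+
    have mW: "(\<lambda>x. m0 x * ?W x) \<in> borel_measurable lborel" by measurable
    have "(\<integral>x. m x * ?W x \<partial>lebesgue) = (\<integral>x. m0 x * ?W x \<partial>lebesgue)"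
    proof (rule integral_cong_AE)
      show "(\<lambda>x. m x * ?W x) \<in> borel_measurable lebesgue" using i by auto
      show "(\<lambda>x. m0 x * ?W x) \<in> borel_measurable lebesgue" using mW by (rule measurable_completion)
      have "AE x in lebesgue. x \<in> (off_axes :: (real \<times> real) set)" using AE_off_axes by (rule AE_completion)
      then show "AE x in lebesgue. m x * ?W x = m0 x * ?W x" by eventually_elim (simp add: m0_eq)
    qed
    also have "\<dots> = (\<integral>x. m0 x * ?W x \<partial>lborel)" by (rule integral_completion[OF mW])
    finally show ?thesis
      unfolding 1 2 by (simp add: case_prod_unfold)
  qed
  let ?S = "sphere_measure :: (real^'n) measure"
  define N where "N = ?S \<Otimes>\<^sub>M ?S"
  interpret SS: pair_sigma_finite ?S ?S
    using finite_sphere_measure[where 'a="real^'n"] by (simp add: pair_sigma_finite_def finite_measure_def)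
  have N: "finite_measure N" unfolding N_def
    by (intro finite_measure_pair_measure finite_sphere_measure)
  have setsN[measurable_cong]: "sets N = sets (borel \<Otimes>\<^sub>M borel)"
    unfolding N_def by (intro sets_pair_measure_cong) auto
  obtain e :: "real^'n" where e: "norm e = 1" using vector_choose_size[of 1] by auto
  \<comment> \<open>The coordinates of the two sphere points along the fixed unit vector
    \<open>e\<close>; these are the random dilation factors of \<open>marginal\<close>.\<close>
  let ?T = "\<lambda>q :: (real^'n) \<times> (real^'n). e \<bullet> fst q" and ?U = "\<lambda>q :: (real^'n) \<times> (real^'n). e \<bullet> snd q"
  have TU: "?T \<in> borel_measurable N" "?U \<in> borel_measurable N" by measurable
  define M where "M = marginal m N ?T ?U"
  \<comment> \<open>The factor 1/4 is the one in \<open>radial_extension\<close>: bi-evenness makes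
    the positive quadrant a quarter of the plane.\<close>
  define m' where "m' \<zeta> = 1 / 4 * M 0 0 (norm (fst \<zeta>), norm (snd \<zeta>))" for \<zeta> :: "(real^'n) \<times> (real^'n)"
  have m'_eq: "m' \<zeta> = 1 / 4 * (\<integral>q. m0 (norm (fst \<zeta>) * (e \<bullet> fst q), norm (snd \<zeta>) * (e \<bullet> snd q)) \<partial>N)" for \<zeta>
    by (simp add: m'_def M_def marginal_def[OF u(3) N TU] m0_def)
  have sN: "sigma_finite_measure N" using N by (simp add: finite_measure_def)
  have m'_meas: "m' \<in> borel_measurable borel"
  proof -
    have "(\<lambda>\<zeta>. \<integral>q. m0 (norm (fst \<zeta>) * (e \<bullet> fst q), norm (snd \<zeta>) * (e \<bullet> snd q)) \<partial>N) \<in> borel_measurable ((borel :: (real^'n) measure) \<Otimes>\<^sub>M borel)"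
    proof (rule sigma_finite_measure.borel_measurable_lebesgue_integral[OF sN])
      have "(\<lambda>(\<zeta>, q). (norm (fst \<zeta>) * (e \<bullet> fst q), norm (snd \<zeta>) * (e \<bullet> snd q))) \<in> borel_measurable (((borel :: (real^'n) measure) \<Otimes>\<^sub>M borel) \<Otimes>\<^sub>M N)"
        unfolding case_prod_unfold by measurable
      from measurable_compose[OF this m0]
      show "(\<lambda>(\<zeta>, q). m0 (norm (fst \<zeta>) * (e \<bullet> fst q), norm (snd \<zeta>) * (e \<bullet> snd q))) \<in> borel_measurable (((borel :: (real^'n) measure) \<Otimes>\<^sub>M borel) \<Otimes>\<^sub>M N)"
        by (simp add: case_prod_unfold)
    qed
    from borel_measurable_times[OF borel_measurable_const this]
    show ?thesis unfolding m'_eq[abs_def] borel_prod[symmetric] .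
  qed
  have bounded: "integrable N (\<lambda>q. m0 (F q))" if "F \<in> borel_measurable N" for F
    by (rule finite_measure.integrable_const_bound[OF N, of _ B])
       (use B measurable_compose[OF that m0] in \<open>auto intro!: AE_I2\<close>)
  have m'_bound: "norm (m' \<zeta>) \<le> 1 / 4 * (B * measure N (space N))" for \<zeta>
  proof -
    have "norm (\<integral>q. m0 (norm (fst \<zeta>) * (e \<bullet> fst q), norm (snd \<zeta>) * (e \<bullet> snd q)) \<partial>N) \<le> (\<integral>q. B \<partial>N)"
    proof (rule order_trans[OF integral_norm_bound Bochner_Integration.integral_mono])
      show "integrable N (\<lambda>q. norm (m0 (norm (fst \<zeta>) * (e \<bullet> fst q), norm (snd \<zeta>) * (e \<bullet> snd q))))"
        by (intro integrable_norm bounded) measurable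
    qed (use B finite_measure.integrable_const[OF N] in auto)
    then show ?thesis by (simp add: m'_eq norm_mult mult.commute)
  qed
  \<comment> \<open>Fubini separates the two spheres so that each variable is rotated on its own,
    first \<omega> for fixed \<theta>, then \<theta> with the \<omega>-integral as the function on
    the line.\<close>
  have rotate: "(\<integral>q. m0 (fst \<zeta> \<bullet> fst q, snd \<zeta> \<bullet> snd q) \<partial>N) = 4 * m' \<zeta>" for \<zeta>
  proof -
    have fub: "(\<integral>q. m0 (F (fst q), G (snd q)) \<partial>N) = (\<integral>\<theta>. \<integral>\<omega>. m0 (F \<theta>, G \<omega>) \<partial>?S \<partial>?S)"
      if [measurable]: "F \<in> borel_measurable borel" "G \<in> borel_measurable borel" for F G :: "real^'n \<Rightarrow> real"
    proof -
      have "integrable N (\<lambda>q. m0 (F (fst q), G (snd q)))" by (rule bounded) measurable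
      from SS.integral_fst'[OF this[unfolded N_def]] show ?thesis by (simp add: N_def)
    qed
    have pm: "(\<lambda>t. m0 (t, r)) \<in> borel_measurable borel" "(\<lambda>t. m0 (r, t)) \<in> borel_measurable borel" for r
      by (auto intro!: measurable_compose[OF _ m0] borel_measurable_Pair)
    have "(\<integral>q. m0 (fst \<zeta> \<bullet> fst q, snd \<zeta> \<bullet> snd q) \<partial>N) = (\<integral>\<theta>. \<integral>\<omega>. m0 (fst \<zeta> \<bullet> \<theta>, snd \<zeta> \<bullet> \<omega>) \<partial>?S \<partial>?S)"
      by (rule fub) auto
    also have "\<dots> = (\<integral>\<theta>. \<integral>\<omega>. m0 (fst \<zeta> \<bullet> \<theta>, norm (snd \<zeta>) * (e \<bullet> \<omega>)) \<partial>?S \<partial>?S)"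
      by (intro Bochner_Integration.integral_cong refl sphere_integral_rotate[OF _ e, of "\<lambda>t. m0 (_, t)"] pm)
    also have "\<dots> = (\<integral>\<theta>. \<integral>\<omega>. m0 (norm (fst \<zeta>) * (e \<bullet> \<theta>), norm (snd \<zeta>) * (e \<bullet> \<omega>)) \<partial>?S \<partial>?S)"
    proof (rule sphere_integral_rotate[OF _ e, of "\<lambda>t. \<integral>\<omega>. m0 (t, norm (snd \<zeta>) * (e \<bullet> \<omega>)) \<partial>?S"])
      show "(\<lambda>t. \<integral>\<omega>. m0 (t, norm (snd \<zeta>) * (e \<bullet> \<omega>)) \<partial>?S) \<in> borel_measurable borel"
      proof (rule sigma_finite_measure.borel_measurable_lebesgue_integral)
        show "sigma_finite_measure ?S"
          using finite_sphere_measure[where 'a="real^'n"] by (simp add: finite_measure_def)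
        have "(\<lambda>x :: real \<times> (real^'n). (fst x, norm (snd \<zeta>) * (e \<bullet> snd x))) \<in> borel_measurable (borel \<Otimes>\<^sub>M ?S)" by measurable
        from measurable_compose[OF this m0]
        show "(\<lambda>(t, \<omega>). m0 (t, norm (snd \<zeta>) * (e \<bullet> \<omega>))) \<in> borel_measurable (borel \<Otimes>\<^sub>M ?S)" by (simp add: case_prod_unfold)
      qed
    qed
    also have "\<dots> = (\<integral>q. m0 (norm (fst \<zeta>) * (e \<bullet> fst q), norm (snd \<zeta>) * (e \<bullet> snd q)) \<partial>N)"
      by (rule fub[symmetric]) auto
    finally show ?thesis by (simp add: m'_eq)
  qed
  show ?thesis
  proof (rule symbol_form_marcinkiewicz_type[OF m'_meas m'_bound])
    fix f g h :: "real^'n \<Rightarrow> complex" assume S: "schwartz f" "schwartz g" "schwartz h"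
    let ?W = "\<lambda>\<zeta>. fourier f (fst \<zeta>) * fourier g (snd \<zeta>) * fourier h (- (fst \<zeta> + snd \<zeta>))"
    have "bilinear_operator (radial_extension K) f g h = 1 / 4 *
      (\<integral>\<zeta>. ?W \<zeta> * (\<integral>q. m0 (fst \<zeta> \<bullet> fst q, snd \<zeta> \<bullet> snd q) \<partial>(?S \<Otimes>\<^sub>M ?S)) \<partial>lborel)"
      by (rule radial_extension_pairing[OF assms(1) symbol m0 B m0_cont S])
    also have "\<dots> = (\<integral>\<zeta>. 1 / 4 * (?W \<zeta> * (4 * m' \<zeta>)) \<partial>lborel)"
      unfolding N_def[symmetric] rotate by (rule integral_mult_right_zero[symmetric])
    also have "\<dots> = symbol_form m' f g h"
      unfolding symbol_form_def[OF m'_meas m'_bound] by (simp add: mult_ac)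
    finally show "bilinear_operator (radial_extension K) f g h = symbol_form m' f g h" .
  next
    have "radial_symbol M 0 0 (\<lambda>\<zeta> :: (real^'n) \<times> (real^'n). (1 / 4) * M 0 0 (norm (fst \<zeta>), norm (snd \<zeta>)))"
      by (rule radial_symbol_mult_eq[OF radial_symbol.const radial_symbol.base]) auto
    then have "radial_symbol M 0 0 m'" by (simp only: m'_def[abs_def])
    then show "marcinkiewicz_function m'"
    proof (rule radial_symbol_marcinkiewicz[rotated 2])
      show "(M a b has_derivative (\<lambda>v. fst v *\<^sub>R M (Suc a) b p + snd v *\<^sub>R M a (Suc b) p)) (at p)" if "p \<in> off_axes" for a b p
        unfolding M_def by (rule marginal_has_derivative[OF u(3) N TU that])
      show "\<exists>C\<ge>0. \<forall>p\<in>off_axes. \<bar>fst p\<bar> ^ a * \<bar>snd p\<bar> ^ b * norm (M a b p) \<le> C" for a b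
      proof -
        obtain C where "C \<ge> 0" "\<And>p. p \<in> off_axes \<Longrightarrow> \<bar>fst p\<bar> ^ a * \<bar>snd p\<bar> ^ b * norm (M a b p) \<le> C"
          unfolding M_def using marginal_bound[OF u(3) N TU] by blast
        then show ?thesis by blast
      qed
    qed
  qed
qed

end
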